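(* For any smooth embedding of the torus $\mathcal T:S^1\times S^1\hookrightarrow S^4$, one has $n(\mathcal T)=0$; that is, the map $\mathrm{Kh}(\mathcal T):\mathbb Z\to\mathbb Z$ induced on odd Khovanov homology by $\mathcal T$, regarded as a link cobordism from the empty link to itself, is zero.
   Context: **The projective TQFT $\mathcal F$.** For a closed 1-manifold $S$ let $V(S)$ be the free abelian group on the components of $S$ and $\mathcal F(S)=\Lambda^*(V(S))$ (so $\mathcal F(\emptyset)=\mathbb Z$). To elementary compact orientable cobordisms $S_1\to S_2$ it assigns: - merge of components $a_i,a_{i+1}$ into $a$: $\Lambda^*V(S_1)\to\Lambda^*(V(S_1)/(a_i-a_{i+1}))\cong\Lambda^*V(S_2)$; - split of $a$ into $a_i,a_{i+1}$: $\Lambda^*V(S_1)\cong(a_i-a_{i+1})\wedge\Lambda^*V(S_2)\hookrightarrow\Lambda^*V(S_2)$, i.e. lift $x$ to $\Lambda^*V(S_2)$ and take $\pm(a_i-a_{i+1})\wedge x$. The sign is specified by an arrow on the cobordism from one outgoing circle to the other: the factor is (tail circle) $-$ (head circle); - birth: the map induced by $V(S_1)\hookrightarrow V(S_2)$; - death of a component $a$: contraction with the dual of $a$, i.e. $a\wedge x\mapsto x$ and $x\mapsto 0$ for $x$ not involving $a$. **Odd Khovanov complex.** Let $D$ be an oriented link diagram with $n$ crossings. The 0-resolution of a crossing joins the two regions swept out when the over-strand is rotated counterclockwise, and the 1-resolution joins the other two regions. For $v\in\{0,1\}^n$ let $D_v$ be the resolved diagram. Decorate each crossing with an arrow joining the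 two arcs of its 0-resolution; rotating it clockwise by $90^\circ$ gives an arrow joining the two arcs of the 1-resolution, and this fixes the signs of the split maps. Each edge of the cube (changing one coordinate from 0 to 1) carries the corresponding map $\mathcal F$, multiplied by a sign $\epsilon=\pm1$ chosen so that all square faces anticommute. For faces where a single circle splits into two and merges back, so that both composites vanish, there are two configurations, distinguished by whether, travelling counterclockwise on the circle from the tail of the arrow inside the circle, the next endpoint met is the tail or the head of the arrow outside. One configuration is treated as a commuting face and the other as an anticommuting face when choosing $\epsilon$; either convention gives isomorphic complexes. $\mathcal C(D)=\bigoplus_v\mathcal F(D_v)$, with homological degree $|v|=\sum_iv_i$ shifted by the number of negative crossings, is the odd Khovanov complex, and $\mathrm{Kh}(L)$ is its homology; $\mathrm{Kh}(\emptyset)=\mathbb Z$. **Cobordism maps (Migdail–Wehrli).** A smooth link cobordism in $\mathbb R^3\times I$ is presented by a movie of Morse moves, Reidemeister moves and planar isotopies, and is assigned the composite of the following maps. - Morse moves (birth, saddle, death) act by the corresponding maps $\mathcal F$ on every resolution, with signs making the total map a chain map. - Reidemeister I, $D\to D'$ adding a kink. If the extra circle $O$ appears in the 0-resolution of the kink, $\mathcal C(D)\to\mathcal C(D')$ is the split map into the 0-resolution $D\sqcup O$, and $\mathcal C(D')\to\mathcal C(D)$ is the death of $O$ on the 0-resolution and zero on the 1-resolution. If $O$ appears in the 1-resolution, $\mathcal C(D)\to\mathcal C(D')$ is the birth of $O$ into the 1-resolution, and $\mathcal C(D')\to\mathcal C(D)$ is the merge of $O$ on the 1-resolution and zero on the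 0-resolution. - Reidemeister II, $D\to D'$ adding two crossings. One of the two mixed resolutions of the two new crossings is isotopic to $D$; the other is $D_s\sqcup O$, where $D_s$ is obtained from $D$ by a saddle and $O$ is a small circle. $\mathcal C(D)\to\mathcal C(D')$ has components $\pm\mathrm{id}$ into the first and $\pm$(saddle followed by birth of $O$) into the second; $\mathcal C(D')\to\mathcal C(D)$ has components $\pm\mathrm{id}$ on the first and $\pm$(death of $O$ followed by the saddle $D_s\to D$) on the second; all other components vanish, and signs are chosen so that these are chain maps. - Reidemeister III. Resolving the central crossing presents $\mathcal C(D_1)$ and $\mathcal C(D_2)$ as mapping cones of $d$ and $d'$. For one resolution of the central crossing the two resulting diagrams agree; for the other, each simplifies by a Reidemeister II move to the same diagram. If $\bar e,\bar e'$ are the Reidemeister II maps introducing the two crossings on the two sides, and $\bar e^{-1},(\bar e')^{-1}$ the corresponding maps removing them, the map $\mathcal C(D_1)\to\mathcal C(D_2)$ is the composite of homotopy equivalences from the two cones to the cones in which the second resolution is replaced by its simplification; these simplified cones are identical up to signs. When the agreeing resolution is the source of the cone, its components are $\pm\mathrm{id}$ on the source, $\pm\bar e'\circ\bar e^{-1}$ on the target, and a diagonal component $\bar E\circ d'$ with $\bar E$ a chain homotopy between $\bar e'\circ(\bar e')^{-1}$ and the identity; the other case is symmetric. By a theorem of Migdail and Wehrli, the induced map on $\mathrm{Kh}$ is invariant, up to an overall sign, under smooth isotopy rel boundary of link cobordisms in $\mathbb R^3\times I$. **Closed surfaces.** A smoothly embedded closed surface in $S^4$ is viewed, after isotopy off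 a point, as a link cobordism in $\mathbb R^3\times I$ from the empty link to itself, and so induces $\mathrm{Kh}(\mathcal T):\mathbb Z\to\mathbb Z$, well defined up to sign; $n(\mathcal T)=|\mathrm{Kh}(\mathcal T)(1)|$. *)

theory Defs
  imports "HOL-Complex_Analysis.Complex_Analysis" "HOL-Library.Function_Algebras"
begin

section \<open>Smooth tori in the 4-sphere\<close>

primrec Ck :: "nat \<Rightarrow> ('a::real_normed_vector \<Rightarrow> 'b::real_normed_vector) \<Rightarrow> bool" where
  "Ck 0 f \<longleftrightarrow> continuous_on UNIV f"
| "Ck (Suc k) f \<longleftrightarrow> f differentiable_on UNIV \<and> (\<forall>v. Ck k (\<lambda>x. frechet_derivative f (at x) v))"

definition smooth :: "('a::real_normed_vector \<Rightarrow> 'b::real_normed_vector) \<Rightarrow> bool" where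
  "smooth f \<longleftrightarrow> (\<forall>k. Ck k f)"

text \<open>
  \<open>R3\<close> is the plane of projection times the height (the observer sits at height plus infinity);
  the last factor of \<open>R4\<close> is the time of the movie. The 4-sphere is \<open>sphere 0 1\<close> in \<open>R5\<close>; the
  norm of a product type is the Euclidean one.
\<close>

type_synonym R3 = "complex \<times> real"
type_synonym R4 = "R3 \<times> real"
type_synonym R5 = "R4 \<times> real"

definition torus :: "(complex \<times> complex) set" where
  "torus = sphere 0 1 \<times> sphere 0 1"

text \<open>Smoothness and derivatives of a map on the torus are those of its lift to the universal cover.\<close>

definition lift :: "(complex \<times> complex \<Rightarrow> 'b) \<Rightarrow> real \<times> real \<Rightarrow> 'b" where
  "lift f = (\<lambda>(a, b). f (cis a, cis b))"

text \<open>The torus is compact, so an injective immersion is an embedding.\<close>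

definition smooth_torus_embedding :: "(complex \<times> complex \<Rightarrow> R5) \<Rightarrow> bool" where
  "smooth_torus_embedding T \<longleftrightarrow>
     T ` torus \<subseteq> sphere 0 1 \<and> inj_on T torus \<and> smooth (lift T) \<and>
     (\<forall>q. inj (frechet_derivative (lift T) (at q)))"

definition smooth_isotopy :: "(real \<Rightarrow> complex \<times> complex \<Rightarrow> R5) \<Rightarrow> bool" where
  "smooth_isotopy H \<longleftrightarrow>
     smooth (\<lambda>(u, q). lift (H u) q) \<and> (\<forall>u\<in>{0..1}. smooth_torus_embedding (H u))"

definition north_pole :: R5 where
  "north_pole = (0, 1)"

definition stereographic :: "R5 \<Rightarrow> R4" where
  "stereographic = (\<lambda>(q, s). q /\<^sub>R (1 - s))"

definition slice :: "(complex \<times> complex \<Rightarrow> R4) \<Rightarrow> real \<Rightarrow> R3 set" where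
  "slice G t = {p. (p, t) \<in> G ` torus}"

definition critical_points :: "(complex \<times> complex \<Rightarrow> R4) \<Rightarrow> (complex \<times> complex) set" where
  "critical_points G =
     {(cis a, cis b) | a b. frechet_derivative (\<lambda>q. snd (lift G q)) (at (a, b)) = (\<lambda>_. 0)}"


section \<open>The exterior algebra on a finite set of circles\<close>

text \<open>
  For a finite set \<open>A\<close>, let \<open>V\<close> be the free abelian group on \<open>A\<close>. We realise \<open>\<Lambda>\<^sup>*V\<close> as the group
  of alternating tensors inside the tensor algebra of \<open>V\<close>: the product \<open>a\<^sub>1 \<and> \<dots> \<and> a\<^sub>k\<close> corresponds
  to the sum over all permutations \<open>\<sigma>\<close> of \<open>sgn \<sigma>\<close> times the word \<open>a\<^bsub>\<sigma>1\<^esub>\<dots>a\<^bsub>\<sigma>k\<^esub>\<close>, and a tensor is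
  represented by its coefficient function on words. Since \<open>V\<close> is free, this is an isomorphism over
  the integers, natural in \<open>V\<close>.
\<close>

type_synonym circle = "complex set"
type_synonym ext = "circle list \<Rightarrow> int"

definition exterior :: "circle set \<Rightarrow> ext set" where
  "exterior A =
     {x. (\<forall>w. x w \<noteq> 0 \<longrightarrow> distinct w \<and> set w \<subseteq> A) \<and>
         (\<forall>us a b vs. x (us @ a # b # vs) = - x (us @ b # a # vs))}"

definition scale :: "int \<Rightarrow> ext \<Rightarrow> ext" where
  "scale k x = (\<lambda>w. k * x w)"

text \<open>The map \<open>\<Lambda>\<^sup>*V(A) \<rightarrow> \<Lambda>\<^sup>*V(B)\<close> induced by a map \<open>h : A \<rightarrow> B\<close> of generators.\<close>

definition push :: "(circle \<Rightarrow> circle) \<Rightarrow> circle set \<Rightarrow> ext \<Rightarrow> ext" where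
  "push h A x = (\<lambda>w. \<Sum>u | set u \<subseteq> A \<and> map h u = w. x u)"

definition wedge :: "circle \<Rightarrow> ext \<Rightarrow> ext" where
  "wedge a x = (\<lambda>w. \<Sum>i<length w.
     if w ! i = a then (-1) ^ i * x (take i w @ drop (Suc i) w) else 0)"

text \<open>Contraction with the dual of \<open>a\<close>, i.e. the map of a death of \<open>a\<close>. The map of a birth is
  the inclusion of exterior algebras, which is the identity on coefficient functions.\<close>

definition contract :: "circle \<Rightarrow> ext \<Rightarrow> ext" where
  "contract a x = (\<lambda>w. x (a # w))"


section \<open>Link diagrams and their resolutions\<close>

text \<open>
  A chart of a disc in the plane is an orientation preserving embedding of the closed unit disc;
  orientation is expressed by the winding number of the boundary.
\<close>

definition disc_chart :: "(complex \<Rightarrow> complex) \<Rightarrow> bool" where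
  "disc_chart \<beta> \<longleftrightarrow> continuous_on (cball 0 1) \<beta> \<and> inj_on \<beta> (cball 0 1) \<and>
     winding_number (\<beta> \<circ> circlepath 0 1) (\<beta> 0) = 1"

abbreviation disc :: "(complex \<Rightarrow> complex) \<Rightarrow> complex set" where
  "disc \<beta> \<equiv> \<beta> ` cball 0 1"

text \<open>
  In the chart of a crossing the over-strand is the real axis and the under-strand the imaginary
  axis. Rotating the over-strand counterclockwise sweeps out the first and the third quadrant, so
  the arcs of the 0-resolution lie in the second and the fourth one.

  The chart also encodes the arrow decorating the crossing: on the 0-resolution it points from the
  fourth to the second quadrant, hence on the 1-resolution (after a clockwise quarter turn) from
  the third to the first. The opposite arrow is obtained by precomposing the chart with negation.
\<close>

definition cross :: "complex set" where
  "cross = {z \<in> cball 0 1. Re z = 0 \<or> Im z = 0}"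

definition res0 :: "complex set" where
  "res0 = closed_segment 1 (-\<i>) \<union> closed_segment \<i> (-1)"

definition res1 :: "complex set" where
  "res1 = closed_segment 1 \<i> \<union> closed_segment (-1) (-\<i>)"

record diagram =
  curve :: "complex set"
  xings :: "complex set"
  chart :: "complex \<Rightarrow> complex \<Rightarrow> complex"

text \<open>A vertex \<open>v\<close> of the cube is given by the set of crossings that are 1-resolved.\<close>

type_synonym vertex = "complex set"

definition resolution :: "diagram \<Rightarrow> vertex \<Rightarrow> complex set" where
  "resolution D v = (curve D - (\<Union>x\<in>xings D. disc (chart D x))) \<union>
     (\<Union>x\<in>xings D. chart D x ` (if x \<in> v then res1 else res0))"

abbreviation circles :: "diagram \<Rightarrow> vertex \<Rightarrow> circle set" where
  "circles D v \<equiv> components (resolution D v)"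

definition closed_1_manifold :: "complex set \<Rightarrow> bool" where
  "closed_1_manifold S \<longleftrightarrow>
     finite (components S) \<and> (\<forall>C\<in>components S. C homeomorphic (sphere 0 1 :: complex set))"

text \<open>The last condition says that \<open>curve D\<close> is a finite union of closed curves whose only
  multiple points are the crossings.\<close>

definition link_diagram :: "diagram \<Rightarrow> bool" where
  "link_diagram D \<longleftrightarrow>
     finite (xings D) \<and>
     (\<forall>x\<in>xings D. disc_chart (chart D x) \<and> chart D x 0 = x \<and>
        curve D \<inter> disc (chart D x) = chart D x ` cross) \<and>
     (\<forall>x\<in>xings D. \<forall>y\<in>xings D. x \<noteq> y \<longrightarrow> disc (chart D x) \<inter> disc (chart D y) = {}) \<and>
     (\<forall>v\<subseteq>xings D. closed_1_manifold (resolution D v))"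

definition depicts :: "diagram \<Rightarrow> R3 set \<Rightarrow> bool" where
  "depicts D L \<longleftrightarrow>
     fst ` L = curve D \<and>
     (\<forall>p\<in>L. \<forall>q\<in>L. fst p = fst q \<and> p \<noteq> q \<longrightarrow> fst p \<in> xings D) \<and>
     (\<forall>x\<in>xings D. \<exists>over under :: real \<Rightarrow> real.
        continuous_on {-1..1} over \<and> continuous_on {-1..1} under \<and> under 0 < over 0 \<and>
        {p \<in> L. fst p \<in> disc (chart D x)} =
          (\<lambda>s. (chart D x (of_real s), over s)) ` {-1..1} \<union>
          (\<lambda>s. (chart D x (\<i> * of_real s), under s)) ` {-1..1})"

definition image_diagram :: "(complex \<Rightarrow> complex) \<Rightarrow> diagram \<Rightarrow> diagram" where
  "image_diagram \<phi> D = \<lparr>curve = \<phi> ` curve D, xings = \<phi> ` xings D,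
     chart = (\<lambda>x. \<phi> \<circ> chart D (inv \<phi> x))\<rparr>"

definition resolve :: "diagram \<Rightarrow> complex \<Rightarrow> bool \<Rightarrow> diagram" where
  "resolve D c r = \<lparr>
     curve = (curve D - disc (chart D c)) \<union> chart D c ` (if r then res1 else res0),
     xings = xings D - {c}, chart = chart D\<rparr>"


section \<open>The odd Khovanov complex\<close>

text \<open>
  The map of a saddle that replaces, in the disc with chart \<open>\<beta>\<close>, the arcs \<open>res0\<close> of \<open>S\<^sub>1\<close> by the
  arcs \<open>res1\<close> of \<open>S\<^sub>2\<close>. Components avoiding the disc are common to \<open>S\<^sub>1\<close> and \<open>S\<^sub>2\<close>. The arrow
  on \<open>res1\<close> runs from the component \<open>t\<close> of \<open>S\<^sub>2\<close> to the component \<open>h\<close>. If \<open>t = h\<close> this is a merge.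
  Otherwise it is a split, and \<open>y\<close> is the lift of \<open>x\<close> that sends the component being split to \<open>t\<close>.
\<close>

definition saddle :: "(complex \<Rightarrow> complex) \<Rightarrow> complex set \<Rightarrow> complex set \<Rightarrow> ext \<Rightarrow> ext" where
  "saddle \<beta> S\<^sub>1 S\<^sub>2 x =
     (let t = connected_component_set S\<^sub>2 (\<beta> (-1));
          h = connected_component_set S\<^sub>2 (\<beta> 1);
          y = push (\<lambda>a. if a \<inter> disc \<beta> = {} then a else t) (components S\<^sub>1) x
      in if t = h then y else wedge t y - wedge h y)"

definition edge :: "diagram \<Rightarrow> vertex \<Rightarrow> complex \<Rightarrow> ext \<Rightarrow> ext" where
  "edge D v x = saddle (chart D x) (resolution D v) (resolution D (insert x v))"

type_synonym edge_signs = "vertex \<Rightarrow> complex \<Rightarrow> int"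

text \<open>
  The face at \<open>v\<close> in the directions \<open>x\<close>, \<open>y\<close> splits a single circle and merges it back iff the
  arrows at \<open>x\<close> and \<open>y\<close> have interleaved endpoints on one circle. Here \<open>\<gamma>\<close> runs once
  counterclockwise around this circle, starting at the tail of the arrow \<open>x\<close>, which lies inside;
  the arrow \<open>y\<close> lies outside. The flag says whether the next endpoint met is the tail of \<open>y\<close>.
\<close>

definition split_merge_face :: "bool \<Rightarrow> diagram \<Rightarrow> vertex \<Rightarrow> complex \<Rightarrow> complex \<Rightarrow> bool" where
  "split_merge_face tail_first D v x y \<longleftrightarrow>
     (let tail = (\<lambda>z. chart D z ((1 - \<i>) / 2)); head = (\<lambda>z. chart D z ((\<i> - 1) / 2)) in
      \<exists>\<gamma>. simple_path \<gamma> \<and> pathfinish \<gamma> = pathstart \<gamma> \<and> path_image \<gamma> \<in> circles D v \<and>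
        winding_number \<gamma> x = 1 \<and> y \<in> outside (path_image \<gamma>) \<and> pathstart \<gamma> = tail x \<and>
        (\<exists>a b c. 0 < a \<and> a < b \<and> b < c \<and> c < 1 \<and> \<gamma> b = head x \<and>
           (if tail_first then \<gamma> a = tail y \<and> \<gamma> c = head y
            else \<gamma> a = head y \<and> \<gamma> c = tail y)))"

text \<open>
  \<open>cv\<close> is the convention for the split-merge faces: which of the two configurations is treated as a
  commuting face, i.e. carries an odd number of minus signs.
\<close>

definition sign_assignment :: "bool \<Rightarrow> diagram \<Rightarrow> edge_signs \<Rightarrow> bool" where
  "sign_assignment cv D \<epsilon> \<longleftrightarrow>
     (\<forall>v x. v \<subseteq> xings D \<and> x \<in> xings D - v \<longrightarrow> \<epsilon> v x \<in> {1, -1}) \<and>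
     (\<forall>v x y. v \<subseteq> xings D \<and> x \<in> xings D - v \<and> y \<in> xings D - v \<and> x \<noteq> y \<longrightarrow>
        (\<forall>a\<in>exterior (circles D v).
           scale (\<epsilon> v x * \<epsilon> (insert x v) y) (edge D (insert x v) y (edge D v x a)) =
           scale (- (\<epsilon> v y * \<epsilon> (insert y v) x)) (edge D (insert y v) x (edge D v y a))) \<and>
        (\<forall>tail_first. split_merge_face tail_first D v x y \<longrightarrow>
           \<epsilon> v x * \<epsilon> (insert x v) y * \<epsilon> v y * \<epsilon> (insert y v) x =
             (if tail_first = cv then -1 else 1)))"

definition cube :: "bool \<Rightarrow> diagram \<Rightarrow> edge_signs \<Rightarrow> bool" where
  "cube cv D \<epsilon> \<longleftrightarrow> link_diagram D \<and> sign_assignment cv D \<epsilon>"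

text \<open>Chains of all homological degrees together, the degree at \<open>v\<close> being \<open>card v\<close>. Orientations of
  links are not recorded, because they only enter the shift of this degree.\<close>

type_synonym chain = "vertex \<Rightarrow> ext"

definition chains :: "diagram \<Rightarrow> chain set" where
  "chains D =
     {\<psi>. \<forall>v. (v \<subseteq> xings D \<longrightarrow> \<psi> v \<in> exterior (circles D v)) \<and> (\<not> v \<subseteq> xings D \<longrightarrow> \<psi> v = 0)}"

definition differential :: "diagram \<Rightarrow> edge_signs \<Rightarrow> chain \<Rightarrow> chain" where
  "differential D \<epsilon> \<psi> = (\<lambda>w. if w \<subseteq> xings D
     then \<Sum>x\<in>w. scale (\<epsilon> (w - {x}) x) (edge D (w - {x}) x (\<psi> (w - {x}))) else 0)"

definition homology_class :: "diagram \<Rightarrow> edge_signs \<Rightarrow> chain \<Rightarrow> chain set" where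
  "homology_class D \<epsilon> \<psi> = {\<psi> + differential D \<epsilon> \<xi> | \<xi>. \<xi> \<in> chains D}"

definition Kh :: "diagram \<Rightarrow> edge_signs \<Rightarrow> chain set set" where
  "Kh D \<epsilon> = homology_class D \<epsilon> ` {\<psi> \<in> chains D. differential D \<epsilon> \<psi> = 0}"

definition chain_map ::
    "diagram \<Rightarrow> edge_signs \<Rightarrow> diagram \<Rightarrow> edge_signs \<Rightarrow> (chain \<Rightarrow> chain) \<Rightarrow> bool" where
  "chain_map D \<epsilon> D' \<epsilon>' f \<longleftrightarrow>
     (\<forall>\<psi>\<in>chains D. f \<psi> \<in> chains D' \<and> differential D' \<epsilon>' (f \<psi>) = f (differential D \<epsilon> \<psi>))"

text \<open>The map induced on homology by a chain map \<open>f\<close> with target \<open>C(D')\<close>.\<close>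

definition induced :: "diagram \<Rightarrow> edge_signs \<Rightarrow> (chain \<Rightarrow> chain) \<Rightarrow> chain set \<Rightarrow> chain set" where
  "induced D' \<epsilon>' f U = (\<Union>\<psi>\<in>U. homology_class D' \<epsilon>' (f \<psi>))"

text \<open>For an empty diagram \<open>D\<close>, \<open>k \<mapsto> int_class D \<epsilon> k\<close> is the identification of the integers with
  \<open>Kh D \<epsilon>\<close>.\<close>

definition int_class :: "diagram \<Rightarrow> edge_signs \<Rightarrow> int \<Rightarrow> chain set" where
  "int_class D \<epsilon> k = homology_class D \<epsilon> (\<lambda>v w. if v = {} \<and> w = [] then k else 0)"


section \<open>Chain maps of the elementary moves\<close>

text \<open>
  The predicates of this section fix a map up to the signs \<open>\<eta>\<close>, one for each vertex and component;
  that the signs make the map a chain map is required separately.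

  Two closed 1-manifolds may agree outside a set \<open>Z\<close>. Then \<open>follow Z S\<close> takes a component of the
  first one that leaves \<open>Z\<close> to the component of \<open>S\<close> with the same part outside \<open>Z\<close>.
\<close>

definition follow :: "complex set \<Rightarrow> complex set \<Rightarrow> circle \<Rightarrow> circle" where
  "follow Z S a = (THE b. b \<in> components S \<and> b - Z = a - Z)"

definition signs :: "(vertex \<Rightarrow> int) \<Rightarrow> bool" where
  "signs \<eta> \<longleftrightarrow> range \<eta> \<subseteq> {1, -1}"

definition isotopy_map :: "(complex \<Rightarrow> complex) \<Rightarrow> diagram \<Rightarrow> (chain \<Rightarrow> chain) \<Rightarrow> bool" where
  "isotopy_map \<phi> D f \<longleftrightarrow> (\<exists>\<eta>. signs \<eta> \<and> (\<forall>\<psi>\<in>chains D. \<forall>v\<subseteq>xings D.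
     f \<psi> (\<phi> ` v) = scale (\<eta> v) (push (image \<phi>) (circles D v) (\<psi> v))))"

definition redecoration_map ::
    "complex set \<Rightarrow> diagram \<Rightarrow> diagram \<Rightarrow> (chain \<Rightarrow> chain) \<Rightarrow> bool" where
  "redecoration_map Z D D' f \<longleftrightarrow> (\<exists>\<eta>. signs \<eta> \<and> (\<forall>\<psi>\<in>chains D. \<forall>v\<subseteq>xings D.
     f \<psi> v = scale (\<eta> v) (push (follow Z (resolution D' v)) (circles D v) (\<psi> v))))"

subsection \<open>Morse moves\<close>

definition birth_map :: "diagram \<Rightarrow> (chain \<Rightarrow> chain) \<Rightarrow> bool" where
  "birth_map D f \<longleftrightarrow> (\<exists>\<eta>. signs \<eta> \<and> (\<forall>\<psi>\<in>chains D. \<forall>v\<subseteq>xings D.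
     f \<psi> v = scale (\<eta> v) (\<psi> v)))"

definition death_map :: "circle \<Rightarrow> diagram \<Rightarrow> (chain \<Rightarrow> chain) \<Rightarrow> bool" where
  "death_map O' D f \<longleftrightarrow> (\<exists>\<eta>. signs \<eta> \<and> (\<forall>\<psi>\<in>chains D. \<forall>v\<subseteq>xings D.
     f \<psi> v = scale (\<eta> v) (contract O' (\<psi> v))))"

definition saddle_map ::
    "(complex \<Rightarrow> complex) \<Rightarrow> diagram \<Rightarrow> diagram \<Rightarrow> (chain \<Rightarrow> chain) \<Rightarrow> bool" where
  "saddle_map \<beta> D D' f \<longleftrightarrow> (\<exists>\<eta>. signs \<eta> \<and> (\<forall>\<psi>\<in>chains D. \<forall>v\<subseteq>xings D.
     f \<psi> v = scale (\<eta> v) (saddle \<beta> (resolution D v) (resolution D' v) (\<psi> v))))"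

subsection \<open>Reidemeister I\<close>

text \<open>
  \<open>D'\<close> is \<open>D\<close> with a kink added in the disc with chart \<open>\<beta>\<close>, see \<open>R1_straight\<close> and \<open>R1_kink\<close> below.
  The crossing is \<open>\<beta> 0\<close>, the strand of \<open>D\<close> starts at \<open>\<beta> (-1)\<close>, and \<open>\<beta> (1/2)\<close> lies on the extra
  circle \<open>O'\<close>, which appears in the 1-resolution iff \<open>one\<close>.
\<close>

definition R1_add :: "bool \<Rightarrow> (complex \<Rightarrow> complex) \<Rightarrow> diagram \<Rightarrow> diagram \<Rightarrow> (chain \<Rightarrow> chain) \<Rightarrow> bool" where
  "R1_add one \<beta> D D' f \<longleftrightarrow> (\<exists>\<eta>. signs \<eta> \<and> (\<forall>\<psi>\<in>chains D. \<forall>v\<subseteq>xings D.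
     (let w = (if one then insert (\<beta> 0) v else v);
          w' = (if one then v else insert (\<beta> 0) v);
          a = connected_component_set (resolution D' w) (\<beta> (-1));
          O' = connected_component_set (resolution D' w) (\<beta> (1/2));
          y = push (follow (disc \<beta>) (resolution D' w)) (circles D v) (\<psi> v)
      in f \<psi> w = scale (\<eta> v) (if one then y else wedge a y - wedge O' y) \<and> f \<psi> w' = 0)))"

definition R1_remove :: "bool \<Rightarrow> (complex \<Rightarrow> complex) \<Rightarrow> diagram \<Rightarrow> diagram \<Rightarrow> (chain \<Rightarrow> chain) \<Rightarrow> bool" where
  "R1_remove one \<beta> D' D f \<longleftrightarrow> (\<exists>\<eta>. signs \<eta> \<and> (\<forall>\<psi>\<in>chains D'. \<forall>v\<subseteq>xings D.
     (let w = (if one then insert (\<beta> 0) v else v);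
          a = connected_component_set (resolution D v) (\<beta> (-1));
          O' = connected_component_set (resolution D' w) (\<beta> (1/2));
          back = follow (disc \<beta>) (resolution D v)
      in f \<psi> v = scale (\<eta> v)
           (if one then push (\<lambda>b. if b = O' then a else back b) (circles D' w) (\<psi> w)
            else push back (circles D' w - {O'}) (contract O' (\<psi> w))))))"

subsection \<open>Reidemeister II\<close>

text \<open>
  \<open>D'\<close> is \<open>D\<close> with two crossings added in the disc with chart \<open>\<beta>\<close>, see \<open>R2_crossed\<close> below. The
  resolution of \<open>D'\<close> with 1-resolved crossing \<open>R2_id \<beta>\<close> and 0-resolved crossing \<open>R2_loop \<beta>\<close> is
  isotopic to \<open>D\<close>; the opposite one is \<open>D\<^sub>s\<close> with the extra circle through \<open>\<beta> ((\<i> - 1) / 4)\<close>. In the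
  disc, \<open>D\<close> is \<open>res0\<close> and \<open>D\<^sub>s\<close> is \<open>res1\<close>; the saddle from \<open>D\<^sub>s\<close> back to \<open>D\<close> is the one of the
  chart rotated by a quarter turn.
\<close>

definition R2_loop :: "(complex \<Rightarrow> complex) \<Rightarrow> complex" where
  "R2_loop \<beta> = \<beta> (Complex (1/6) (1/6))"

definition R2_id :: "(complex \<Rightarrow> complex) \<Rightarrow> complex" where
  "R2_id \<beta> = \<beta> (Complex (-1/6) (-1/6))"

definition R2_saddled :: "(complex \<Rightarrow> complex) \<Rightarrow> diagram \<Rightarrow> vertex \<Rightarrow> complex set" where
  "R2_saddled \<beta> D v = (resolution D v - disc \<beta>) \<union> \<beta> ` res1"

definition R2_add :: "(complex \<Rightarrow> complex) \<Rightarrow> diagram \<Rightarrow> diagram \<Rightarrow> (chain \<Rightarrow> chain) \<Rightarrow> bool" where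
  "R2_add \<beta> D D' f \<longleftrightarrow> (\<exists>\<eta> \<eta>'. signs \<eta> \<and> signs \<eta>' \<and> (\<forall>\<psi>\<in>chains D. \<forall>v\<subseteq>xings D.
     (let w = insert (R2_id \<beta>) v; w' = insert (R2_loop \<beta>) v; S = R2_saddled \<beta> D v
      in f \<psi> w = scale (\<eta> v)
           (push (follow (disc \<beta>) (resolution D' w)) (circles D v) (\<psi> v)) \<and>
         f \<psi> w' = scale (\<eta>' v)
           (push (follow (disc \<beta>) (resolution D' w')) (components S)
             (saddle \<beta> (resolution D v) S (\<psi> v))) \<and>
         f \<psi> v = 0 \<and> f \<psi> (insert (R2_id \<beta>) w') = 0)))"

definition R2_remove :: "(complex \<Rightarrow> complex) \<Rightarrow> diagram \<Rightarrow> diagram \<Rightarrow> (chain \<Rightarrow> chain) \<Rightarrow> bool" where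
  "R2_remove \<beta> D' D f \<longleftrightarrow> (\<exists>\<eta> \<eta>'. signs \<eta> \<and> signs \<eta>' \<and> (\<forall>\<psi>\<in>chains D'. \<forall>v\<subseteq>xings D.
     (let w = insert (R2_id \<beta>) v; w' = insert (R2_loop \<beta>) v; S = R2_saddled \<beta> D v;
          O' = connected_component_set (resolution D' w') (\<beta> ((\<i> - 1) / 4))
      in f \<psi> v =
           scale (\<eta> v) (push (follow (disc \<beta>) (resolution D v)) (circles D' w) (\<psi> w)) +
           scale (\<eta>' v) (saddle (\<lambda>z. \<beta> (\<i> * z)) S (resolution D v)
             (push (follow (disc \<beta>) S) (circles D' w' - {O'}) (contract O' (\<psi> w')))))))"


section \<open>Local models of the moves\<close>

text \<open>The models are tangle diagrams in the unit disc, in the same format as link diagrams.\<close>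

definition has_tangle :: "(complex \<Rightarrow> complex) \<Rightarrow> diagram \<Rightarrow> diagram \<Rightarrow> bool" where
  "has_tangle \<beta> M D \<longleftrightarrow>
     curve D \<inter> disc \<beta> = \<beta> ` curve M \<and> xings D \<inter> disc \<beta> = \<beta> ` xings M \<and>
     (\<forall>m\<in>xings M. \<exists>\<sigma>\<in>{1, -1}. \<forall>z\<in>cball 0 1. chart D (\<beta> m) z = \<beta> (chart M m (\<sigma> * z)))"

definition agree_outside :: "complex set \<Rightarrow> diagram \<Rightarrow> diagram \<Rightarrow> bool" where
  "agree_outside B D D' \<longleftrightarrow>
     curve D - B = curve D' - B \<and> xings D - B = xings D' - B \<and>
     (\<forall>x\<in>xings D - B. disc (chart D x) \<inter> B = {} \<and> (\<forall>z\<in>cball 0 1. chart D x z = chart D' x z))"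

definition local_change :: "(complex \<Rightarrow> complex) \<Rightarrow> diagram \<Rightarrow> diagram \<Rightarrow> diagram \<Rightarrow> diagram \<Rightarrow> bool" where
  "local_change \<beta> M M' D D' \<longleftrightarrow>
     disc_chart \<beta> \<and> has_tangle \<beta> M D \<and> has_tangle \<beta> M' D' \<and> agree_outside (disc \<beta>) D D'"

definition uncrossed :: "complex set \<Rightarrow> diagram" where
  "uncrossed S = \<lparr>curve = S, xings = {}, chart = (\<lambda>_ z. z)\<rparr>"

definition R1_straight :: diagram where
  "R1_straight = uncrossed (closed_segment (-1) (-\<i>))"

text \<open>The loop occupies the first quadrant, so it is closed up by the 1-resolution iff the
  over-strand is the real axis.\<close>

definition R1_kink :: "bool \<Rightarrow> diagram" where
  "R1_kink one = \<lparr>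
     curve = closed_segment (-1) (1/2) \<union> closed_segment (1/2) (\<i>/2) \<union> closed_segment (\<i>/2) (-\<i>),
     xings = {0}, chart = (\<lambda>_ z. if one then z/4 else \<i> * z/4)\<rparr>"

text \<open>\<open>u\<close> is the direction of the over-strand and \<open>w\<close> that of the under-strand.\<close>

definition linear_chart :: "complex \<Rightarrow> complex \<Rightarrow> complex \<Rightarrow> complex \<Rightarrow> complex" where
  "linear_chart m u w z = m + of_real (Re z) * u + of_real (Im z) * w"

text \<open>The over-strand runs from \<open>1\<close> to \<open>-\<i>\<close>, the under-strand from \<open>\<i>\<close> to \<open>-1\<close>.\<close>

definition R2_crossed :: diagram where
  "R2_crossed = \<lparr>
     curve = closed_segment 1 ((\<i> - 1) / 4) \<union> closed_segment ((\<i> - 1) / 4) (-\<i>) \<union>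
             closed_segment \<i> ((1 - \<i>) / 4) \<union> closed_segment ((1 - \<i>) / 4) (-1),
     xings = {Complex (1/6) (1/6), Complex (-1/6) (-1/6)},
     chart = (\<lambda>m. if m = Complex (1/6) (1/6)
       then linear_chart m (Complex (5/60) (-1/60)) (Complex (-1/60) (5/60))
       else linear_chart m (Complex (1/60) (-5/60)) (Complex (5/60) (-1/60)))\<rparr>"

text \<open>
  The coordinate axes cross at the central crossing \<open>0\<close>; the real axis is the upper one iff
  \<open>real_over\<close>. A third strand connects the boundary points \<open>\<plusminus>(3 + 4\<i>)/5\<close>. It passes below
  and to the right of the central crossing, over both axes if \<open>sliding_over\<close> and under both
  otherwise. The tangle after the move is the image of this one under the rotation by \<open>\<pi>\<close>.
\<close>

definition R3_right :: complex where "R3_right = Complex (7/13) 0"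
definition R3_below :: complex where "R3_below = Complex 0 (-7/11)"

definition R3_tangle :: "bool \<Rightarrow> bool \<Rightarrow> diagram" where
  "R3_tangle real_over sliding_over = \<lparr>
     curve = closed_segment (-1) 1 \<union> closed_segment (-\<i>) \<i> \<union>
             closed_segment (Complex (-3/5) (-4/5)) (Complex (1/2) (-1/2)) \<union>
             closed_segment (Complex (1/2) (-1/2)) (Complex (3/5) (4/5)),
     xings = {0, R3_right, R3_below},
     chart = (\<lambda>m.
       if m = 0 then (\<lambda>z. if real_over then z/10 else \<i> * z/10)
       else if m = R3_right then
         (if sliding_over then linear_chart m (Complex (1/100) (13/100)) (Complex (-1/100) 0)
          else linear_chart m (Complex (1/100) 0) (Complex (1/100) (13/100)))
       else
         (if sliding_over then linear_chart m (Complex (11/100) (3/100)) (Complex 0 (1/100))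
          else linear_chart m (Complex 0 (1/100)) (Complex (-11/100) (-3/100))))\<rparr>"


section \<open>Reidemeister III\<close>

text \<open>Restriction to, and extension by zero from, the vertices at which \<open>c\<close> is 1-resolved
  (\<open>r\<close>) or 0-resolved (\<open>\<not> r\<close>), viewed as vertices of the diagram \<open>resolve D c r\<close>.\<close>

definition part :: "complex \<Rightarrow> bool \<Rightarrow> chain \<Rightarrow> chain" where
  "part c r \<psi> = (\<lambda>v. if c \<in> v then 0 else \<psi> (if r then insert c v else v))"

definition extend :: "complex \<Rightarrow> bool \<Rightarrow> chain \<Rightarrow> chain" where
  "extend c r \<psi> = (\<lambda>w. if (c \<in> w) = r then \<psi> (w - {c}) else 0)"

definition part_signs :: "complex \<Rightarrow> bool \<Rightarrow> edge_signs \<Rightarrow> edge_signs" where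
  "part_signs c r \<epsilon> v = \<epsilon> (if r then insert c v else v)"

text \<open>The map \<open>C(resolve D c False) \<rightarrow> C(resolve D c True)\<close> whose cone is \<open>C(D)\<close>.\<close>

definition connecting :: "diagram \<Rightarrow> edge_signs \<Rightarrow> complex \<Rightarrow> chain \<Rightarrow> chain" where
  "connecting D \<epsilon> c \<psi> = part c True (differential D \<epsilon> (extend c False \<psi>))"

definition homotopy_to_id ::
    "diagram \<Rightarrow> edge_signs \<Rightarrow> (chain \<Rightarrow> chain) \<Rightarrow> (chain \<Rightarrow> chain) \<Rightarrow> bool" where
  "homotopy_to_id D \<epsilon> p E \<longleftrightarrow>
     (\<forall>\<psi>\<in>chains D. E \<psi> \<in> chains D \<and>
        (\<forall>\<xi>\<in>chains D. E (\<psi> + \<xi>) = E \<psi> + E \<xi>) \<and>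
        (\<forall>n. (\<forall>v. \<psi> v \<noteq> 0 \<longrightarrow> card v = n) \<longrightarrow> (\<forall>v. E \<psi> v \<noteq> 0 \<longrightarrow> Suc (card v) = n)) \<and>
        differential D \<epsilon> (E \<psi>) + E (differential D \<epsilon> \<psi>) = \<psi> - p \<psi>)"

text \<open>The identification of the crossings of the two diagrams with resolved central crossing,
  in the resolution where these diagrams agree up to isotopy in the disc.\<close>

definition R3_match :: "(complex \<Rightarrow> complex) \<Rightarrow> complex \<Rightarrow> complex" where
  "R3_match \<beta> x = (if x = \<beta> R3_right then \<beta> (- R3_below)
     else if x = \<beta> R3_below then \<beta> (- R3_right) else x)"

definition R3_identity ::
    "(complex \<Rightarrow> complex) \<Rightarrow> diagram \<Rightarrow> diagram \<Rightarrow> (chain \<Rightarrow> chain) \<Rightarrow> bool" where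
  "R3_identity \<beta> A A' g \<longleftrightarrow>
     (\<forall>\<psi>\<in>chains A. g \<psi> \<in> chains A') \<and>
     (\<exists>\<eta>. signs \<eta> \<and> (\<forall>\<psi>\<in>chains A. \<forall>v\<subseteq>xings A.
        g \<psi> (R3_match \<beta> ` v) = scale (\<eta> v)
          (push (follow (disc \<beta>) (resolution A' (R3_match \<beta> ` v))) (circles A v) (\<psi> v))))"

text \<open>
  The central crossing of \<open>D\<^sub>1\<close> and \<open>D\<^sub>2\<close> is \<open>c = \<beta> 0\<close>. If the real axis is the over-strand, the
  diagrams \<open>A\<^sub>1\<close>, \<open>A\<^sub>2\<close> with 1-resolved \<open>c\<close> agree and those with 0-resolved \<open>c\<close>, denoted \<open>S\<^sub>1\<close>, \<open>S\<^sub>2\<close>,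
  simplify to \<open>D\<^sub>0\<close> by Reidemeister II moves \<open>e\<^sub>1\<close>, \<open>e\<^sub>2\<close> (with reversed moves \<open>i\<^sub>1\<close>, \<open>i\<^sub>2\<close>); otherwise
  the roles of the two resolutions are exchanged.
\<close>

definition R3_map :: "bool \<Rightarrow> bool \<Rightarrow> (complex \<Rightarrow> complex) \<Rightarrow>
    diagram \<Rightarrow> edge_signs \<Rightarrow> diagram \<Rightarrow> edge_signs \<Rightarrow> (chain \<Rightarrow> chain) \<Rightarrow> bool" where
  "R3_map cv real_over \<beta> D\<^sub>1 \<epsilon>\<^sub>1 D\<^sub>2 \<epsilon>\<^sub>2 f \<longleftrightarrow>
     (let c = \<beta> 0; r = real_over;
          A\<^sub>1 = resolve D\<^sub>1 c r; A\<^sub>2 = resolve D\<^sub>2 c r;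
          S\<^sub>1 = resolve D\<^sub>1 c (\<not> r); S\<^sub>2 = resolve D\<^sub>2 c (\<not> r);
          \<sigma>\<^sub>1 = part_signs c (\<not> r) \<epsilon>\<^sub>1; \<sigma>\<^sub>2 = part_signs c (\<not> r) \<epsilon>\<^sub>2
      in \<exists>D\<^sub>0 \<epsilon>\<^sub>0 \<beta>\<^sub>1 \<beta>\<^sub>2 e\<^sub>1 i\<^sub>1 e\<^sub>2 i\<^sub>2 g E (\<tau>::int) (\<tau>'::int).
        cube cv D\<^sub>0 \<epsilon>\<^sub>0 \<and> disc \<beta>\<^sub>1 \<subseteq> disc \<beta> \<and> disc \<beta>\<^sub>2 \<subseteq> disc \<beta> \<and>
        local_change \<beta>\<^sub>1 (uncrossed res0) R2_crossed D\<^sub>0 S\<^sub>1 \<and>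
        local_change \<beta>\<^sub>2 (uncrossed res0) R2_crossed D\<^sub>0 S\<^sub>2 \<and>
        R2_add \<beta>\<^sub>1 D\<^sub>0 S\<^sub>1 e\<^sub>1 \<and> chain_map D\<^sub>0 \<epsilon>\<^sub>0 S\<^sub>1 \<sigma>\<^sub>1 e\<^sub>1 \<and>
        R2_remove \<beta>\<^sub>1 S\<^sub>1 D\<^sub>0 i\<^sub>1 \<and> chain_map S\<^sub>1 \<sigma>\<^sub>1 D\<^sub>0 \<epsilon>\<^sub>0 i\<^sub>1 \<and>
        R2_add \<beta>\<^sub>2 D\<^sub>0 S\<^sub>2 e\<^sub>2 \<and> chain_map D\<^sub>0 \<epsilon>\<^sub>0 S\<^sub>2 \<sigma>\<^sub>2 e\<^sub>2 \<and>
        R2_remove \<beta>\<^sub>2 S\<^sub>2 D\<^sub>0 i\<^sub>2 \<and> chain_map S\<^sub>2 \<sigma>\<^sub>2 D\<^sub>0 \<epsilon>\<^sub>0 i\<^sub>2 \<and>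
        R3_identity \<beta> A\<^sub>1 A\<^sub>2 g \<and> \<tau> \<in> {1, -1} \<and> \<tau>' \<in> {1, -1} \<and>
        (if r then homotopy_to_id S\<^sub>1 \<sigma>\<^sub>1 (e\<^sub>1 \<circ> i\<^sub>1) E else homotopy_to_id S\<^sub>2 \<sigma>\<^sub>2 (e\<^sub>2 \<circ> i\<^sub>2) E) \<and>
        (\<forall>\<psi>\<in>chains D\<^sub>1. f \<psi> =
           extend c r (g (part c r \<psi>)) +
           extend c (\<not> r) (\<lambda>v. scale \<tau> (e\<^sub>2 (i\<^sub>1 (part c (\<not> r) \<psi>)) v)) +
           extend c True (\<lambda>v. scale \<tau>'
             (if r then g (connecting D\<^sub>1 \<epsilon>\<^sub>1 c (E (part c False \<psi>))) v
              else E (connecting D\<^sub>2 \<epsilon>\<^sub>2 c (g (part c False \<psi>))) v))))"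


section \<open>Movies\<close>

text \<open>
  During the time interval from \<open>s\<close> to \<open>t\<close> the link is constant outside the cylinder over the disc
  with chart \<open>\<beta>\<close>. Inside, its diagram is \<open>M\<close> before the time \<open>m\<close> of the move and \<open>M'\<close> after it, up
  to isotopy of the disc rel boundary; the surface has \<open>n\<close> critical points, all at time \<open>m\<close>.
\<close>

definition local_move :: "(complex \<times> complex \<Rightarrow> R4) \<Rightarrow> real \<Rightarrow> real \<Rightarrow> nat \<Rightarrow>
    (complex \<Rightarrow> complex) \<Rightarrow> diagram \<Rightarrow> diagram \<Rightarrow> diagram \<Rightarrow> diagram \<Rightarrow> bool" where
  "local_move G s t n \<beta> M M' D D' \<longleftrightarrow>
     depicts D' (slice G t) \<and> local_change \<beta> M M' D D' \<and>
     (\<forall>\<tau>\<in>{s..t}. slice G \<tau> - disc \<beta> \<times> UNIV = slice G s - disc \<beta> \<times> UNIV) \<and>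
     (\<exists>m. s < m \<and> m < t \<and>
        (\<forall>\<tau>\<in>{s..t} - {m}. \<exists>D'' \<beta>''. link_diagram D'' \<and> depicts D'' (slice G \<tau>) \<and>
           disc_chart \<beta>'' \<and> disc \<beta>'' = disc \<beta> \<and> (\<forall>z\<in>sphere 0 1. \<beta>'' z = \<beta> z) \<and>
           has_tangle \<beta>'' (if \<tau> < m then M else M') D'' \<and>
           agree_outside (disc \<beta>) D D'') \<and>
        (let C = {q \<in> critical_points G. snd (G q) \<in> {s..t}}
         in finite C \<and> card C = n \<and> (\<forall>q\<in>C. snd (G q) = m)))"

inductive move :: "bool \<Rightarrow> (complex \<times> complex \<Rightarrow> R4) \<Rightarrow> real \<Rightarrow> real \<Rightarrow>
    diagram \<Rightarrow> edge_signs \<Rightarrow> diagram \<Rightarrow> edge_signs \<Rightarrow> (chain \<Rightarrow> chain) \<Rightarrow> bool"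
  for cv G where
  redecorate: \<comment> \<open>change of charts (hence of arrows) and of edge signs on a fixed diagram\<close>
    "move cv G s s D \<epsilon> D' \<epsilon>' f"
    if "depicts D' (slice G s)" "curve D' = curve D" "xings D' = xings D"
       "(\<forall>x\<in>xings D. disc (chart D x) \<subseteq> Z x \<and> disc (chart D' x) \<subseteq> Z x)"
       "(\<forall>x\<in>xings D. Z x = disc (chart D x)) \<or> (\<forall>x\<in>xings D. Z x = disc (chart D' x))"
       "redecoration_map (\<Union>x\<in>xings D. Z x) D D' f"
| isotopy:
    "move cv G s t D \<epsilon> (image_diagram (\<phi> t) D) \<epsilon>' f"
    if "s < t" "continuous_on ({s..t} \<times> UNIV) (\<lambda>(\<tau>, z). \<phi> \<tau> z)" "\<phi> s = id"
       "\<forall>\<tau>\<in>{s..t}. (\<exists>\<theta>. homeomorphism UNIV UNIV (\<phi> \<tau>) \<theta>) \<and>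
          depicts (image_diagram (\<phi> \<tau>) D) (slice G \<tau>)"
       "\<forall>q\<in>critical_points G. snd (G q) \<notin> {s..t}"
       "isotopy_map (\<phi> t) D f"
| birth:
    "move cv G s t D \<epsilon> D' \<epsilon>' f"
    if "local_move G s t 1 \<beta> (uncrossed {}) (uncrossed (sphere 0 (1/2))) D D'" "birth_map D f"
| death:
    "move cv G s t D \<epsilon> D' \<epsilon>' f"
    if "local_move G s t 1 \<beta> (uncrossed (sphere 0 (1/2))) (uncrossed {}) D D'"
       "death_map (\<beta> ` sphere 0 (1/2)) D f"
| saddle:
    "move cv G s t D \<epsilon> D' \<epsilon>' f"
    if "local_move G s t 1 \<beta> (uncrossed res0) (uncrossed res1) D D'" "saddle_map \<beta> D D' f"
| R1_add:
    "move cv G s t D \<epsilon> D' \<epsilon>' f"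
    if "local_move G s t 0 \<beta> R1_straight (R1_kink one) D D'" "R1_add one \<beta> D D' f"
| R1_remove:
    "move cv G s t D \<epsilon> D' \<epsilon>' f"
    if "local_move G s t 0 \<beta> (R1_kink one) R1_straight D D'" "R1_remove one \<beta> D D' f"
| R2_add:
    "move cv G s t D \<epsilon> D' \<epsilon>' f"
    if "local_move G s t 0 \<beta> (uncrossed res0) R2_crossed D D'" "R2_add \<beta> D D' f"
| R2_remove:
    "move cv G s t D \<epsilon> D' \<epsilon>' f"
    if "local_move G s t 0 \<beta> R2_crossed (uncrossed res0) D D'" "R2_remove \<beta> D D' f"
| R3:
    "move cv G s t D \<epsilon> D' \<epsilon>' f"
    if "local_move G s t 0 \<beta> (R3_tangle real_over sliding_over)
          (image_diagram uminus (R3_tangle real_over sliding_over)) D D'"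
       "R3_map cv real_over \<beta> D \<epsilon> D' \<epsilon>' f"

text \<open>
  A movie of the surface \<open>G ` torus\<close> from the diagram \<open>D\<^sub>0\<close> at time \<open>0\<close> to the diagram \<open>D\<close> at time
  \<open>t\<close>, together with the composite \<open>F\<close> of the maps induced on homology.
\<close>

inductive movie :: "bool \<Rightarrow> (complex \<times> complex \<Rightarrow> R4) \<Rightarrow> diagram \<Rightarrow> edge_signs \<Rightarrow>
    real \<Rightarrow> diagram \<Rightarrow> edge_signs \<Rightarrow> (chain set \<Rightarrow> chain set) \<Rightarrow> bool"
  for cv G D\<^sub>0 \<epsilon>\<^sub>0 where
  start: "movie cv G D\<^sub>0 \<epsilon>\<^sub>0 0 D\<^sub>0 \<epsilon>\<^sub>0 id"
    if "cube cv D\<^sub>0 \<epsilon>\<^sub>0" "depicts D\<^sub>0 (slice G 0)"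
| step: "movie cv G D\<^sub>0 \<epsilon>\<^sub>0 t D' \<epsilon>' (induced D' \<epsilon>' f \<circ> F)"
    if "movie cv G D\<^sub>0 \<epsilon>\<^sub>0 s D \<epsilon> F" "move cv G s t D \<epsilon> D' \<epsilon>' f"
       "cube cv D' \<epsilon>'" "chain_map D \<epsilon> D' \<epsilon>' f"

text \<open>
  \<open>Kh_map T K\<close>: after an isotopy, \<open>T\<close> becomes a link cobordism in \<open>\<real>\<^sup>3 \<times> (0, 1)\<close> from the empty link
  to itself that has a movie inducing \<open>K\<close> on the odd Khovanov homology of the empty link. It is a
  relation, since \<open>K\<close> is determined by \<open>T\<close> only up to sign (by invariance under isotopy).
\<close>

definition Kh_map :: "(complex \<times> complex \<Rightarrow> R5) \<Rightarrow> (int \<Rightarrow> int) \<Rightarrow> bool" where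
  "Kh_map T K \<longleftrightarrow> (\<exists>H G cv D\<^sub>0 \<epsilon>\<^sub>0 D \<epsilon> F.
     smooth_isotopy H \<and> (\<forall>q\<in>torus. H 0 q = T q) \<and>
     north_pole \<notin> H 1 ` torus \<and> G = stereographic \<circ> H 1 \<and> G ` torus \<subseteq> UNIV \<times> {0<..<1} \<and>
     movie cv G D\<^sub>0 \<epsilon>\<^sub>0 1 D \<epsilon> F \<and>
     (\<forall>k. F (int_class D\<^sub>0 \<epsilon>\<^sub>0 k) = int_class D \<epsilon> (K k)))"

definition Kh_number :: "(complex \<times> complex \<Rightarrow> R5) \<Rightarrow> int \<Rightarrow> bool" where
  "Kh_number T n \<longleftrightarrow> (\<exists>K. Kh_map T K \<and> n = \<bar>K 1\<bar>)"

end

theory Submission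
  imports Defs "HOL-Library.Groups_Big_Fun"
begin

text \<open>
  Every diagram \<open>D\<close> carries an operator on its complex that all cobordism maps respect. Let \<open>V\<close> be
  the free abelian group on the circles of a resolution and let \<open>V \<rightarrow> \<int>\<close> send each circle to 1.
  Contraction with this functional in the last tensor factor, here called \<open>augment\<close>, lowers the
  exterior degree by one. The functional is compatible with identifying circles, so \<open>augment\<close>
  commutes with merges and isotopies; it vanishes on the difference of the two circles produced by
  a split, and contracting on the right while the split multiplies on the left avoids all signs, so
  \<open>augment\<close> commutes with splits; for the same reason it commutes with births and deaths. Hence it
  is a chain endomorphism of the cube (\<open>natural_differential\<close>), and it
  commutes with the maps of all moves but one on the chain level (the lemmas \<open>natural_...\<close>).
  A map of a Reidemeister III move contains an unspecified chain homotopy. There the commutator with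
  \<open>augment\<close> is still a boundary on cycles, because the map is a chain map (\<open>R3_map_augment\<close>).

  A movie of a closed surface starts at the empty diagram, whose complex is \<open>\<int>\<close> in exterior degree
  0, and \<open>augment\<close> kills it. So at every later time the image of an integer is represented by a
  cycle \<open>\<phi>\<close> for which \<open>augment_chain \<phi>\<close> is a boundary. The surface is not empty, so at some step the
  diagram becomes empty again; this step can only be the death of a circle \<open>O'\<close> that is the whole
  diagram (\<open>move_to_empty\<close>). The complex of \<open>O'\<close> is the exterior algebra on one generator, with zero
  differential, hence \<open>augment_chain \<phi> = 0\<close>. But on this algebra \<open>augment\<close> is the contraction with
  the dual of \<open>O'\<close>, that is, the map of the death. So the class becomes 0 and it stays 0 until
  the end of the movie.

  The geometric work consists in following components of resolutions through a local change of the
  diagram. It is mild except for the Reidemeister II maps, which pass through a diagram that is not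
  a vertex of either cube: there the strands of the model tangle are deformed into each other by
  explicit maps (\<open>R2_saddled_circles\<close>).
\<close>

section \<open>Contraction with the augmentation\<close>

text \<open>
  Contraction in the last factor with the functional that sends every circle to 1. The sum runs over all
  circles, so that one operator serves all exterior algebras; on the exterior algebra of a finite set
  it has finitely many nonzero terms.
\<close>
definition augment :: "ext \<Rightarrow> ext" where
  "augment x = (\<lambda>w. Sum_any (\<lambda>a. x (w @ [a])))"

lemma exterior_support: "x \<in> exterior A \<Longrightarrow> x w \<noteq> 0 \<Longrightarrow> set w \<subseteq> A"
  unfolding exterior_def by blast

lemma exterior_distinct: "x \<in> exterior A \<Longrightarrow> x w \<noteq> 0 \<Longrightarrow> distinct w"
  unfolding exterior_def by blast

lemma exterior_swap: "x \<in> exterior A \<Longrightarrow> x (us @ a # b # vs) = - x (us @ b # a # vs)"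
  unfolding exterior_def by blast

text \<open>
  Transpositions bring two equal letters next to each other, where the coefficient equals its own
  negative. Thus vanishing on words with repetitions comes for free once the sign rule is known.
\<close>
lemma alternating_distinct:
  fixes x :: ext
  assumes swap: "\<And>us a b vs. x (us @ a # b # vs) = - x (us @ b # a # vs)"
    and "x w \<noteq> 0"
  shows "distinct w"
proof (rule ccontr)
  have repeated: "x (us @ a # vs @ a # ws) = 0" for us a vs ws
  proof (induction vs arbitrary: us)
    case Nil
    have "x (us @ a # a # ws) = - x (us @ a # a # ws)" by (rule swap)
    then show ?case by simp
  next
    case (Cons b vs)
    have "x (us @ a # b # vs @ a # ws) = - x ((us @ [b]) @ a # vs @ a # ws)"
      using swap[of us a b "vs @ a # ws"] by simp
    then show ?case using Cons.IH[of "us @ [b]"] by simp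
  qed
  assume "\<not> distinct w"
  then obtain us a vs ws where "w = us @ a # vs @ a # ws"
    using not_distinct_decomp[of w] by auto
  then show False using repeated assms(2) by simp
qed

lemma exteriorI:
  assumes "\<And>w. x w \<noteq> 0 \<Longrightarrow> set w \<subseteq> A"
    and "\<And>us a b vs. x (us @ a # b # vs) = - x (us @ b # a # vs)"
  shows "x \<in> exterior A"
  using assms alternating_distinct[of x] unfolding exterior_def by blast

lemma exterior_mono: "A \<subseteq> B \<Longrightarrow> exterior A \<subseteq> exterior B"
  unfolding exterior_def by blast

lemma exterior_zero: "0 \<in> exterior A"
  by (rule exteriorI) auto

lemma exterior_add: "x \<in> exterior A \<Longrightarrow> y \<in> exterior A \<Longrightarrow> x + y \<in> exterior A"
proof (rule exteriorI)
  fix w assume "x \<in> exterior A" "y \<in> exterior A" "(x + y) w \<noteq> 0"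
  then have "x w \<noteq> 0 \<or> y w \<noteq> 0" by auto
  then show "set w \<subseteq> A" using \<open>x \<in> exterior A\<close> \<open>y \<in> exterior A\<close> exterior_support by blast
next
  fix us a b vs assume "x \<in> exterior A" "y \<in> exterior A"
  then show "(x + y) (us @ a # b # vs) = - (x + y) (us @ b # a # vs)"
    using exterior_swap[of x A us a b vs] exterior_swap[of y A us a b vs] by simp
qed

lemma exterior_scale: "x \<in> exterior A \<Longrightarrow> scale k x \<in> exterior A"
proof (rule exteriorI)
  fix w assume "x \<in> exterior A" "scale k x w \<noteq> 0"
  then show "set w \<subseteq> A" using exterior_support[of x A w] by (auto simp: scale_def)
next
  fix us a b vs assume "x \<in> exterior A"
  then show "scale k x (us @ a # b # vs) = - scale k x (us @ b # a # vs)"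
    using exterior_swap[of x A us a b vs] by (simp add: scale_def)
qed

lemma augment_eq_sum:
  assumes "finite A" "x \<in> exterior A"
  shows "augment x w = (\<Sum>a\<in>A. x (w @ [a]))"
  unfolding augment_def using assms(2)
  by (intro Sum_any.expand_superset[OF assms(1)]) (auto dest: exterior_support)

lemma augment_exterior:
  assumes "finite A" "x \<in> exterior A"
  shows "augment x \<in> exterior A"
proof (rule exteriorI)
  fix w assume "augment x w \<noteq> 0"
  then obtain a where "x (w @ [a]) \<noteq> 0"
    unfolding augment_eq_sum[OF assms] by (meson sum.neutral)
  then show "set w \<subseteq> A" using exterior_support[OF assms(2)] by fastforce
next
  fix us a b vs
  have "x ((us @ a # b # vs) @ [c]) = - x ((us @ b # a # vs) @ [c])" for c
    using exterior_swap[OF assms(2), of us a b "vs @ [c]"] by simp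
  then show "augment x (us @ a # b # vs) = - augment x (us @ b # a # vs)"
    unfolding augment_eq_sum[OF assms] by (simp only: sum_negf)
qed

lemma augment_zero [simp]: "augment 0 = 0"
  by (auto simp: augment_def)

lemma augment_add:
  assumes "finite A" "x \<in> exterior A" "y \<in> exterior A"
  shows "augment (x + y) = augment x + augment y"
  using augment_eq_sum[OF assms(1)] assms exterior_add[OF assms(2,3)]
  by (simp add: fun_eq_iff sum.distrib)

lemma augment_scale:
  assumes "finite A" "x \<in> exterior A"
  shows "augment (scale k x) = scale k (augment x)"
  using augment_eq_sum[OF assms(1)] assms exterior_scale[OF assms(2)]
  by (simp add: fun_eq_iff scale_def sum_distrib_left)

section \<open>Maps of exterior algebras that commute with the augmentation\<close>

text \<open>
  The properties that are inherited by composites. All maps of the cube and of the moves are built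
  from such maps, up to the homotopy in Reidemeister III.
\<close>
definition exterior_op :: "circle set \<Rightarrow> circle set \<Rightarrow> (ext \<Rightarrow> ext) \<Rightarrow> bool" where
  "exterior_op A B T \<longleftrightarrow>
     (\<forall>x\<in>exterior A. T x \<in> exterior B \<and> T (augment x) = augment (T x)) \<and>
     (\<forall>x\<in>exterior A. \<forall>y\<in>exterior A. T (x + y) = T x + T y)"

lemma exterior_op_comp:
  assumes "finite A" "exterior_op A B T" "exterior_op B C T'"
  shows "exterior_op A C (\<lambda>x. T' (T x))"
  using assms(2,3) unfolding exterior_op_def by simp

lemma exterior_op_mono:
  assumes "exterior_op A B T" "B \<subseteq> C"
  shows "exterior_op A C T"
  using assms exterior_mono[of B C] unfolding exterior_op_def by blast

lemma exterior_op_scale: "finite A \<Longrightarrow> exterior_op A A (scale k)"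
  unfolding exterior_op_def
  by (auto simp: exterior_scale augment_scale) (simp add: scale_def fun_eq_iff algebra_simps)

text \<open>
  Contraction on the left and on the right do not interfere. No letter repeats, so the contracted
  letter does not occur in the result.
\<close>
lemma exterior_op_contract:
  assumes "finite A"
  shows "exterior_op A (A - {a}) (contract a)"
proof -
  have "contract a x \<in> exterior (A - {a})" if x: "x \<in> exterior A" for x
  proof (rule exteriorI)
    fix w assume "contract a x w \<noteq> 0"
    then have "distinct (a # w)" "set (a # w) \<subseteq> A"
      using exterior_support[OF x] exterior_distinct[OF x] unfolding contract_def by metis+
    then show "set w \<subseteq> A - {a}" by auto
  next
    fix us b c vs
    show "contract a x (us @ b # c # vs) = - contract a x (us @ c # b # vs)"
      using exterior_swap[OF x, of "a # us" b c vs] by (simp add: contract_def)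
  qed
  moreover have "contract a (augment x) = augment (contract a x)" for x
    by (simp add: contract_def augment_def)
  ultimately show ?thesis
    unfolding exterior_op_def by (auto simp: contract_def fun_eq_iff)
qed

lemma finite_words: "finite A \<Longrightarrow> finite {u. set u \<subseteq> A \<and> map h u = w}"
  by (rule finite_subset[OF _ finite_lists_length_eq[of A "length w"]]) auto

text \<open>
  Exchanging two neighbouring letters of a word is matched by exchanging the letters of its lifts
  at the same two positions.
\<close>
lemma exterior_push:
  assumes "finite A" "x \<in> exterior A"
  shows "push h A x \<in> exterior (h ` A)"
proof (rule exteriorI)
  fix w assume "push h A x w \<noteq> 0"
  then obtain u where "set u \<subseteq> A" "map h u = w"
    unfolding push_def by (smt (verit) mem_Collect_eq sum.neutral)
  then show "set w \<subseteq> h ` A" by (metis image_mono set_map)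
next
  fix us vs :: "circle list" and a b
  let ?n = "length us"
  let ?swap = "\<lambda>u. take ?n u @ u ! Suc ?n # u ! ?n # drop (Suc (Suc ?n)) u"
  have split: "\<exists>us' a' b' vs'. u = us' @ a' # b' # vs' \<and> map h us' = us \<and> h a' = a \<and>
      h b' = b \<and> map h vs' = vs" if "map h u = us @ a # b # vs" for u a b
    using that by (auto simp: map_eq_append_conv map_eq_Cons_conv)
  have swap: "?swap (us' @ a' # b' # vs') = us' @ b' # a' # vs'" if "map h us' = us" for us' a' b' vs'
    using that by (auto simp: nth_append)
  have "push h A x (us @ a # b # vs) =
      (\<Sum>u | set u \<subseteq> A \<and> map h u = us @ b # a # vs. - x u)"
    unfolding push_def
  proof (rule sum.reindex_bij_witness[where i = ?swap and j = ?swap])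
    fix u assume u: "u \<in> {u. set u \<subseteq> A \<and> map h u = us @ a # b # vs}"
    then obtain us' a' b' vs' where eq: "u = us' @ a' # b' # vs'" "map h us' = us" "h a' = a"
      "h b' = b" "map h vs' = vs" using split by blast
    show "?swap (?swap u) = u" "?swap u \<in> {u. set u \<subseteq> A \<and> map h u = us @ b # a # vs}"
      "- x (?swap u) = x u"
      using u eq(3-5) exterior_swap[OF assms(2), of us' a' b' vs']
      unfolding eq(1) swap[OF eq(2)] by (auto simp: eq(2))
  next
    fix u assume u: "u \<in> {u. set u \<subseteq> A \<and> map h u = us @ b # a # vs}"
    then obtain us' a' b' vs' where eq: "u = us' @ b' # a' # vs'" "map h us' = us" "h a' = a"
      "h b' = b" "map h vs' = vs" using split by blast
    show "?swap (?swap u) = u" "?swap u \<in> {u. set u \<subseteq> A \<and> map h u = us @ a # b # vs}"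
      using u eq(3-5) unfolding eq(1) swap[OF eq(2)] by (auto simp: eq(2))
  qed
  then show "push h A x (us @ a # b # vs) = - push h A x (us @ b # a # vs)"
    unfolding push_def by (simp only: sum_negf)
qed

text \<open>
  A lift of the word \<open>w @ [b]\<close> is a lift of \<open>w\<close> followed by a letter over \<open>b\<close>, and summing over all
  \<open>b\<close> allows every letter of \<open>A\<close> to be last.
\<close>
lemma augment_push:
  assumes "finite A" "x \<in> exterior A"
  shows "augment (push h A x) = push h A (augment x)"
proof
  fix w
  let ?W = "\<lambda>w. {u. set u \<subseteq> A \<and> map h u = w}"
  have snoc: "map h u = w @ [b] \<longleftrightarrow> u \<noteq> [] \<and> map h (butlast u) = w \<and> h (last u) = b" for u b
    by (cases u rule: rev_cases) auto
  have "augment (push h A x) w = (\<Sum>b\<in>h ` A. \<Sum>u\<in>?W (w @ [b]). x u)"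
    unfolding augment_eq_sum[OF finite_imageI[OF assms(1)] exterior_push[OF assms]]
    by (simp add: push_def)
  also have "\<dots> = (\<Sum>(b, u)\<in>(SIGMA b:h ` A. ?W (w @ [b])). x u)"
    using assms(1) finite_words by (intro sum.Sigma) auto
  also have "\<dots> = (\<Sum>(u, a)\<in>(SIGMA u:?W w. A). x (u @ [a]))"
    by (rule sum.reindex_bij_witness[where j = "\<lambda>(b, u). (butlast u, last u)"
        and i = "\<lambda>(u, a). (h a, u @ [a])"])
      (auto simp: snoc dest: in_set_butlastD)
  also have "\<dots> = (\<Sum>u\<in>?W w. \<Sum>a\<in>A. x (u @ [a]))"
    using assms(1) finite_words by (intro sum.Sigma[symmetric]) auto
  also have "\<dots> = push h A (augment x) w"
    using augment_eq_sum[OF assms] by (simp add: push_def)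
  finally show "augment (push h A x) w = push h A (augment x) w" .
qed

lemma exterior_op_push:
  assumes "finite A" "h ` A \<subseteq> B"
  shows "exterior_op A B (push h A)"
  using exterior_push[OF assms(1)] augment_push[OF assms(1)] exterior_mono[OF assms(2)]
  unfolding exterior_op_def by (auto simp: push_def fun_eq_iff sum.distrib)

text \<open>
  Separates the positions at which the new letter is inserted into those in the first part of a word
  and those in the second part.
\<close>
lemma wedge_append:
  "wedge a x (us @ vs) =
     (\<Sum>i<length us. if us ! i = a then (-1) ^ i * x (take i us @ drop (Suc i) us @ vs) else 0) +
     (\<Sum>i<length vs. if vs ! i = a
        then (-1) ^ (length us + i) * x (us @ take i vs @ drop (Suc i) vs) else 0)"
proof -
  have "{..<length (us @ vs)} = {..<length us} \<union> {length us..<length us + length vs}"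
    by auto
  then have "wedge a x (us @ vs) =
      (\<Sum>i<length us. if (us @ vs) ! i = a
         then (-1) ^ i * x (take i (us @ vs) @ drop (Suc i) (us @ vs)) else 0) +
      (\<Sum>i=length us..<length us + length vs. if (us @ vs) ! i = a
         then (-1) ^ i * x (take i (us @ vs) @ drop (Suc i) (us @ vs)) else 0)"
    unfolding wedge_def by (simp add: sum.union_disjoint ivl_disj_int)
  also have "(\<Sum>i<length us. if (us @ vs) ! i = a
         then (-1) ^ i * x (take i (us @ vs) @ drop (Suc i) (us @ vs)) else 0) =
      (\<Sum>i<length us. if us ! i = a then (-1) ^ i * x (take i us @ drop (Suc i) us @ vs) else 0)"
    by (rule sum.cong) (auto simp: nth_append)
  also have "(\<Sum>i=length us..<length us + length vs. if (us @ vs) ! i = a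
         then (-1) ^ i * x (take i (us @ vs) @ drop (Suc i) (us @ vs)) else 0) =
      (\<Sum>i<length vs. if vs ! i = a
        then (-1) ^ (length us + i) * x (us @ take i vs @ drop (Suc i) vs) else 0)"
    by (rule sum.reindex_bij_witness[where i = "\<lambda>i. length us + i" and j = "\<lambda>i. i - length us"])
      (auto simp: nth_append Suc_diff_le)
  finally show ?thesis .
qed

lemma wedge_snoc: "wedge a x (w @ [b]) =
  wedge a (\<lambda>u. x (u @ [b])) w + (if b = a then (-1) ^ length w * x w else 0)"
  unfolding wedge_append by (simp add: wedge_def cong: if_cong)

lemma exterior_wedge:
  assumes "x \<in> exterior A"
  shows "wedge a x \<in> exterior (insert a A)"
proof (rule exteriorI)
  fix w assume "wedge a x w \<noteq> 0"
  then obtain i where i: "i < length w" "w ! i = a" "x (take i w @ drop (Suc i) w) \<noteq> 0"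
    unfolding wedge_def by (rule sum.not_neutral_contains_not_neutral) (auto split: if_splits)
  have "w = take i w @ a # drop (Suc i) w" using i by (metis id_take_nth_drop)
  then have "set w = insert a (set (take i w @ drop (Suc i) w))"
    by (metis Un_insert_right list.simps(15) set_append)
  then show "set w \<subseteq> insert a A" using exterior_support[OF assms i(3)] by auto
next
  fix us b c vs
  let ?\<sigma> = "\<lambda>w. (\<Sum>i<length us. if us ! i = a
      then (-1) ^ i * x (take i us @ drop (Suc i) us @ w) else 0)"
  let ?\<rho> = "\<lambda>b c. (\<Sum>i<length vs. if vs ! i = a then (-1) ^ (length us + Suc (Suc i)) *
      x (us @ b # c # take i vs @ drop (Suc i) vs) else 0)"
  have expand: "wedge a x (us @ b # c # vs) = ?\<sigma> (b # c # vs) +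
      ((if b = a then (-1) ^ length us * x (us @ c # vs) else 0) +
       ((if c = a then (-1) ^ Suc (length us) * x (us @ b # vs) else 0) + ?\<rho> b c))" for b c
    unfolding wedge_append by (simp add: sum.lessThan_Suc_shift del: sum.lessThan_Suc cong: if_cong)
  have "x (take i us @ drop (Suc i) us @ b # c # vs) = - x (take i us @ drop (Suc i) us @ c # b # vs)"
    for i using exterior_swap[OF assms, of "take i us @ drop (Suc i) us" b c vs] by simp
  then have 1: "?\<sigma> (b # c # vs) = - ?\<sigma> (c # b # vs)"
    unfolding sum_negf[symmetric] by (intro sum.cong) simp_all
  have "x (us @ b # c # take i vs @ drop (Suc i) vs) = - x (us @ c # b # take i vs @ drop (Suc i) vs)"
    for i using exterior_swap[OF assms] by blast
  then have 2: "?\<rho> b c = - ?\<rho> c b"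
    unfolding sum_negf[symmetric] by (intro sum.cong) simp_all
  show "wedge a x (us @ b # c # vs) = - wedge a x (us @ c # b # vs)"
    unfolding expand 1 2 by simp
qed

text \<open>
  The extra term comes from inserting \<open>a\<close> at the last position, where it is contracted to 1. It does
  not depend on \<open>a\<close>, and therefore cancels in the map of a split.
\<close>
lemma augment_wedge:
  assumes "finite A" "x \<in> exterior A"
  shows "augment (wedge a x) = wedge a (augment x) + (\<lambda>w. (-1) ^ length w * x w)"
proof
  fix w
  have x: "x \<in> exterior (insert a A)" using assms exterior_mono[of A "insert a A"] by blast
  have fin: "finite (insert a A)" using assms by simp
  have "augment (wedge a x) w =
      (\<Sum>b\<in>insert a A. wedge a (\<lambda>u. x (u @ [b])) w) +
      (\<Sum>b\<in>insert a A. if b = a then (-1) ^ length w * x w else 0)"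
    unfolding augment_eq_sum[OF fin exterior_wedge[OF assms(2)]] wedge_snoc sum.distrib ..
  also have "(\<Sum>b\<in>insert a A. if b = a then (-1) ^ length w * x w else 0) = (-1) ^ length w * x w"
    using fin by (simp add: sum.delta')
  also have "(\<Sum>b\<in>insert a A. wedge a (\<lambda>u. x (u @ [b])) w) = wedge a (augment x) w"
    unfolding wedge_def augment_eq_sum[OF fin x]
    by (subst sum.swap) (auto intro!: sum.cong simp: sum_distrib_left)
  finally show "augment (wedge a x) w = (wedge a (augment x) + (\<lambda>w. (-1) ^ length w * x w)) w"
    by simp
qed

lemma wedge_add: "wedge a (x + y) = wedge a x + wedge a y"
  unfolding wedge_def fun_eq_iff plus_fun_apply sum.distrib[symmetric]
  by (auto intro!: sum.cong simp: algebra_simps)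

lemma exterior_diff: "x \<in> exterior A \<Longrightarrow> y \<in> exterior A \<Longrightarrow> x - y \<in> exterior A"
proof -
  assume "x \<in> exterior A" "y \<in> exterior A"
  then have "x + scale (-1) y \<in> exterior A" by (intro exterior_add exterior_scale)
  then show ?thesis by (simp add: scale_def fun_diff_def plus_fun_def)
qed

lemma augment_diff:
  assumes "finite A" "x \<in> exterior A" "y \<in> exterior A"
  shows "augment (x - y) = augment x - augment y"
  using augment_eq_sum[OF assms(1)] assms exterior_diff[OF assms(2,3)]
  by (simp add: fun_eq_iff sum_subtractf)

lemma exterior_op_wedge_diff:
  assumes "finite A" "A \<subseteq> B" "a \<in> B" "b \<in> B" "finite B"
  shows "exterior_op A B (\<lambda>x. wedge a x - wedge b x)"
proof -
  have w: "wedge c x \<in> exterior B" if "x \<in> exterior A" "c \<in> B" for x c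
    using exterior_wedge[OF that(1), of c] exterior_mono[of "insert c A" B] that assms by blast
  have "augment (wedge a x - wedge b x) = wedge a (augment x) - wedge b (augment x)"
    if "x \<in> exterior A" for x
    using augment_diff[OF assms(5) w w, OF that assms(3) that assms(4)]
      augment_wedge[OF assms(1) that] by (simp add: fun_eq_iff)
  then show ?thesis unfolding exterior_op_def
    using w assms(3,4) by (auto intro!: exterior_diff simp: wedge_add)
qed

text \<open>
  The target consists of the circles that can occur in the image. They form a subset of the circles of
  \<open>S'\<close> only under a geometric hypothesis, which is separated off into the next lemma.
\<close>
lemma exterior_op_saddle_general:
  assumes "finite (components S)"
    and "t = connected_component_set S' (\<beta> (-1))" "h = connected_component_set S' (\<beta> 1)"
  shows "exterior_op (components S) (insert t (insert h {a \<in> components S. a \<inter> disc \<beta> = {}}))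
    (saddle \<beta> S S')"
proof -
  let ?B = "insert t (insert h {a \<in> components S. a \<inter> disc \<beta> = {}})"
  let ?push = "push (\<lambda>a. if a \<inter> disc \<beta> = {} then a else t) (components S)"
  have fin: "finite ?B" using assms(1) by simp
  have push: "exterior_op (components S) ?B ?push"
    using assms(1) by (intro exterior_op_push) auto
  show ?thesis
  proof (cases "t = h")
    case True
    then have "saddle \<beta> S S' = ?push"
      unfolding saddle_def assms(2,3)[symmetric] by (auto simp: Let_def)
    then show ?thesis using push by simp
  next
    case False
    then have "saddle \<beta> S S' = (\<lambda>x. wedge t (?push x) - wedge h (?push x))"
      unfolding saddle_def assms(2,3)[symmetric] by (auto simp: Let_def)
    moreover have "exterior_op ?B ?B (\<lambda>x. wedge t x - wedge h x)"
      using fin by (intro exterior_op_wedge_diff) auto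
    ultimately show ?thesis
      using exterior_op_comp[OF assms(1) push] by simp
  qed
qed

lemma exterior_op_saddle:
  assumes "finite (components S)"
    and "\<beta> (-1) \<in> S'" "\<beta> 1 \<in> S'"
    and "\<And>a. a \<in> components S \<Longrightarrow> a \<inter> disc \<beta> = {} \<Longrightarrow> a \<in> components S'"
  shows "exterior_op (components S) (components S') (saddle \<beta> S S')"
proof (rule exterior_op_mono[OF exterior_op_saddle_general[OF assms(1) refl refl]])
  show "insert (connected_component_set S' (\<beta> (-1))) (insert (connected_component_set S' (\<beta> 1))
      {a \<in> components S. a \<inter> disc \<beta> = {}}) \<subseteq> components S'"
    using assms(2-4) unfolding components_def by auto
qed

section \<open>The cube of resolutions as a functor\<close>

text \<open>
  Such a component \<open>a\<close> is closed, and the remaining part of \<open>S'\<close> lies in the closed set formed by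
  \<open>Z\<close> and the finitely many other components of \<open>S\<close>. So the component of \<open>S'\<close> containing \<open>a\<close> cannot
  be larger than \<open>a\<close>.
\<close>
lemma component_avoiding_set:
  fixes S S' Z :: "'a::topological_space set"
  assumes "finite (components S)" "\<And>C. C \<in> components S \<Longrightarrow> closed C"
    and "closed Z" "S - Z = S' - Z" "a \<in> components S" "a \<inter> Z = {}"
  shows "a \<in> components S'"
proof -
  obtain p where "p \<in> a" using assms(5) in_components_nonempty by blast
  have "a \<subseteq> S'" using in_components_subset[OF assms(5)] assms(4,6) by blast
  define b where "b = connected_component_set S' p"
  have b: "b \<in> components S'" using \<open>p \<in> a\<close> \<open>a \<subseteq> S'\<close> unfolding b_def components_def by blast
  have "a \<subseteq> b"
    unfolding b_def using \<open>p \<in> a\<close> in_components_connected[OF assms(5)] \<open>a \<subseteq> S'\<close>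
    by (rule connected_component_maximal)
  define R where "R = \<Union>(components S - {a}) \<union> Z"
  have "closed R" unfolding R_def using assms(1-3) by (intro closed_Un closed_Union) auto
  moreover have "b \<subseteq> a \<union> R"
    using in_components_subset[OF b] assms(4) Union_components[of S] unfolding R_def by blast
  moreover have "a \<inter> R = {}"
    using assms(6) components_nonoverlap[OF assms(5)] unfolding R_def by blast
  ultimately have "a \<inter> b = {} \<or> R \<inter> b = {}"
    using in_components_connected[OF b] assms(2)[OF assms(5)]
    by (intro connected_closedD) auto
  then have "R \<inter> b = {}" using \<open>a \<subseteq> b\<close> \<open>p \<in> a\<close> by blast
  then have "b = a" using \<open>b \<subseteq> a \<union> R\<close> \<open>a \<subseteq> b\<close> by blast
  then show ?thesis using b by simp
qed

lemma closed_circle: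
  assumes "closed_1_manifold S" "C \<in> components S"
  shows "closed C"
proof -
  have "C homeomorphic (sphere 0 1 :: complex set)"
    using assms unfolding closed_1_manifold_def by blast
  then have "compact C" using homeomorphic_compactness compact_sphere by metis
  then show ?thesis by (rule compact_imp_closed)
qed

lemma circle_avoiding_set:
  "closed_1_manifold S \<Longrightarrow> closed Z \<Longrightarrow> S - Z = S' - Z \<Longrightarrow> a \<in> components S \<Longrightarrow> a \<inter> Z = {} \<Longrightarrow>
     a \<in> components S'"
  by (rule component_avoiding_set) (auto simp: closed_circle closed_1_manifold_def)

lemma closed_disc: "disc_chart \<beta> \<Longrightarrow> closed (disc \<beta>)"
  unfolding disc_chart_def
  by (intro compact_imp_closed compact_continuous_image) auto

lemma res0_subset: "res0 \<subseteq> cball 0 1"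
  and res1_subset: "res1 \<subseteq> cball 0 1"
  unfolding res0_def res1_def by (intro Un_least closed_segment_subset; simp)+

lemma link_diagram_resolution:
  "link_diagram D \<Longrightarrow> v \<subseteq> xings D \<Longrightarrow> closed_1_manifold (resolution D v)"
  unfolding link_diagram_def by blast

lemma finite_circles: "link_diagram D \<Longrightarrow> v \<subseteq> xings D \<Longrightarrow> finite (circles D v)"
  using link_diagram_resolution unfolding closed_1_manifold_def by blast

lemma finite_xings: "link_diagram D \<Longrightarrow> finite (xings D)"
  unfolding link_diagram_def by blast

lemma exterior_op_edge:
  assumes "link_diagram D" "v \<subseteq> xings D" "x \<in> xings D"
  shows "exterior_op (circles D v) (circles D (insert x v)) (edge D v x)"
  unfolding edge_def
proof (rule exterior_op_saddle)
  show "finite (circles D v)" using assms by (auto intro: finite_circles)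
  have "chart D x ` res1 \<subseteq> resolution D (insert x v)"
    using assms(3) unfolding resolution_def by fastforce
  moreover have "-1 \<in> res1" "1 \<in> res1" unfolding res1_def by auto
  ultimately show "chart D x (-1) \<in> resolution D (insert x v)" "chart D x 1 \<in> resolution D (insert x v)"
    by blast+
  have disjoint: "disc (chart D y) \<inter> disc (chart D x) = {}" if "y \<in> xings D" "y \<noteq> x" for y
    using assms(1,3) that unfolding link_diagram_def by blast
  have sub: "chart D y ` (if b then res1 else res0) \<subseteq> disc (chart D y)" for y b
    using res0_subset res1_subset by auto
  let ?arcs = "\<lambda>v y. chart D y ` (if y \<in> v then res1 else res0)"
  have off: "resolution D v - disc (chart D x) =
      ((curve D - (\<Union>x\<in>xings D. disc (chart D x))) - disc (chart D x)) \<union>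
      (\<Union>y\<in>xings D - {x}. ?arcs v y)" for v
    unfolding resolution_def using sub[of x "x \<in> v"] sub disjoint assms(3) by blast
  have "(\<Union>y\<in>xings D - {x}. ?arcs v y) = (\<Union>y\<in>xings D - {x}. ?arcs (insert x v) y)"
    by (intro SUP_cong) auto
  then have "resolution D v - disc (chart D x) = resolution D (insert x v) - disc (chart D x)"
    unfolding off by simp
  moreover have "disc_chart (chart D x)" using assms unfolding link_diagram_def by blast
  ultimately show "a \<in> circles D (insert x v)" if "a \<in> circles D v" "a \<inter> disc (chart D x) = {}" for a
    using circle_avoiding_set[OF link_diagram_resolution closed_disc] assms that by blast
qed

definition augment_chain :: "chain \<Rightarrow> chain" where
  "augment_chain \<psi> = (\<lambda>v. augment (\<psi> v))"

lemma chains_exterior: "\<psi> \<in> chains D \<Longrightarrow> v \<subseteq> xings D \<Longrightarrow> \<psi> v \<in> exterior (circles D v)"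
  and chains_outside: "\<psi> \<in> chains D \<Longrightarrow> \<not> v \<subseteq> xings D \<Longrightarrow> \<psi> v = 0"
  unfolding chains_def by blast+

lemma chainsI:
  "(\<And>v. v \<subseteq> xings D \<Longrightarrow> \<psi> v \<in> exterior (circles D v)) \<Longrightarrow> (\<And>v. \<not> v \<subseteq> xings D \<Longrightarrow> \<psi> v = 0) \<Longrightarrow>
     \<psi> \<in> chains D"
  unfolding chains_def by blast

lemma chains_zero: "0 \<in> chains D"
  by (rule chainsI) (auto simp: exterior_zero)

lemma chains_add: "\<psi> \<in> chains D \<Longrightarrow> \<xi> \<in> chains D \<Longrightarrow> \<psi> + \<xi> \<in> chains D"
  by (rule chainsI) (auto simp: exterior_add chains_exterior chains_outside)

lemma chains_diff: "\<psi> \<in> chains D \<Longrightarrow> \<xi> \<in> chains D \<Longrightarrow> \<psi> - \<xi> \<in> chains D"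
  by (rule chainsI) (auto simp: exterior_diff chains_exterior chains_outside)

lemma chains_scale: "\<psi> \<in> chains D \<Longrightarrow> (\<lambda>v. scale k (\<psi> v)) \<in> chains D"
  by (rule chainsI) (auto simp: exterior_scale chains_exterior chains_outside, auto simp: scale_def)

lemma chains_augment: "link_diagram D \<Longrightarrow> \<psi> \<in> chains D \<Longrightarrow> augment_chain \<psi> \<in> chains D"
  unfolding augment_chain_def
  by (rule chainsI) (metis finite_circles chains_exterior augment_exterior, metis chains_outside augment_zero)

lemma augment_chain_zero [simp]: "augment_chain 0 = 0"
  by (auto simp: augment_chain_def fun_eq_iff[of _ 0])

lemma augment_chain_add:
  assumes "link_diagram D" "\<psi> \<in> chains D" "\<xi> \<in> chains D"
  shows "augment_chain (\<psi> + \<xi>) = augment_chain \<psi> + augment_chain \<xi>"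
proof
  fix v show "augment_chain (\<psi> + \<xi>) v = (augment_chain \<psi> + augment_chain \<xi>) v"
  proof (cases "v \<subseteq> xings D")
    case True
    then show ?thesis
      using assms augment_add[OF finite_circles chains_exterior chains_exterior, of D v]
      by (simp add: augment_chain_def)
  next
    case False
    have "\<psi> v = 0" "\<xi> v = 0" by (rule chains_outside[OF assms(2) False] chains_outside[OF assms(3) False])+
    then show ?thesis
      by (simp only: augment_chain_def plus_fun_apply augment_zero add_0)
  qed
qed

text \<open>
  One component of a map between cubes: it takes a chain to an element of the exterior algebra at a
  fixed vertex of the target.
\<close>
definition chain_op :: "diagram \<Rightarrow> circle set \<Rightarrow> (chain \<Rightarrow> ext) \<Rightarrow> bool" where
  "chain_op D B T \<longleftrightarrow>
     (\<forall>\<psi>\<in>chains D. T \<psi> \<in> exterior B \<and> T (augment_chain \<psi>) = augment (T \<psi>)) \<and>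
     (\<forall>\<psi>\<in>chains D. \<forall>\<xi>\<in>chains D. T (\<psi> + \<xi>) = T \<psi> + T \<xi>)"

lemma chain_op_vertex:
  "exterior_op (circles D v) B T \<Longrightarrow> v \<subseteq> xings D \<Longrightarrow> chain_op D B (\<lambda>\<psi>. T (\<psi> v))"
  unfolding chain_op_def exterior_op_def augment_chain_def by (simp add: chains_exterior)

lemma chain_op_zero: "chain_op D B (\<lambda>_. 0)"
  unfolding chain_op_def by (simp add: exterior_zero)

lemma chain_op_add:
  assumes "finite B" "chain_op D B T" "chain_op D B T'"
  shows "chain_op D B (\<lambda>\<psi>. T \<psi> + T' \<psi>)"
  using assms(2,3) augment_add[OF assms(1)] unfolding chain_op_def
  by (simp add: exterior_add algebra_simps)

lemma chain_op_sum:
  assumes "finite B" "\<And>i. i \<in> I \<Longrightarrow> chain_op D B (T i)"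
  shows "chain_op D B (\<lambda>\<psi>. \<Sum>i\<in>I. T i \<psi>)"
  using assms(2)
proof (induction I rule: infinite_finite_induct)
  case (insert i I)
  have "(\<Sum>j\<in>insert i I. T j \<psi>) = T i \<psi> + (\<Sum>j\<in>I. T j \<psi>)" for \<psi>
    using insert by (intro sum.insert)
  moreover have "chain_op D B (\<lambda>\<psi>. T i \<psi> + (\<Sum>j\<in>I. T j \<psi>))"
    using insert by (intro chain_op_add[OF assms(1)]) auto
  ultimately show ?case by presburger
qed (simp_all add: chain_op_zero)

text \<open>
  The maps that induce a homomorphism compatible with \<open>augment_chain\<close> on the chain level. Being a chain
  map is not part of the notion, so that the differential and the maps in a mapping cone are included.
\<close>
definition natural :: "diagram \<Rightarrow> diagram \<Rightarrow> (chain \<Rightarrow> chain) \<Rightarrow> bool" where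
  "natural D D' f \<longleftrightarrow>
     (\<forall>\<psi>\<in>chains D. f \<psi> \<in> chains D' \<and> f (augment_chain \<psi>) = augment_chain (f \<psi>)) \<and>
     (\<forall>\<psi>\<in>chains D. \<forall>\<xi>\<in>chains D. f (\<psi> + \<xi>) = f \<psi> + f \<xi>)"

lemma naturalI:
  assumes "link_diagram D" "\<And>\<psi>. \<psi> \<in> chains D \<Longrightarrow> f \<psi> \<in> chains D'"
    and "\<And>w. w \<subseteq> xings D' \<Longrightarrow> \<exists>B T. chain_op D B T \<and> (\<forall>\<psi>\<in>chains D. f \<psi> w = T \<psi>)"
  shows "natural D D' f"
proof -
  have "f (augment_chain \<psi>) w = augment_chain (f \<psi>) w" if "\<psi> \<in> chains D" for \<psi> w
  proof (cases "w \<subseteq> xings D'")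
    case True
    then show ?thesis using assms(3)[OF True] chains_augment[OF assms(1) that] that
      unfolding chain_op_def by (auto simp: augment_chain_def[of "f \<psi>"])
  next
    case False
    show ?thesis
      unfolding augment_chain_def[of "f \<psi>"] chains_outside[OF assms(2)[OF that] False]
        chains_outside[OF assms(2)[OF chains_augment[OF assms(1) that]] False] by simp
  qed
  moreover have "f (\<psi> + \<xi>) w = (f \<psi> + f \<xi>) w" if "\<psi> \<in> chains D" "\<xi> \<in> chains D" for \<psi> \<xi> w
  proof (cases "w \<subseteq> xings D'")
    case True
    then show ?thesis using assms(3)[OF True] chains_add[OF that] that
      unfolding chain_op_def by auto
  next
    case False
    then show ?thesis using chains_outside[OF assms(2)] chains_add[OF that] that by simp
  qed
  ultimately show ?thesis unfolding natural_def using assms(2) by blast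
qed

lemma natural_chains: "natural D D' f \<Longrightarrow> \<psi> \<in> chains D \<Longrightarrow> f \<psi> \<in> chains D'"
  and natural_augment: "natural D D' f \<Longrightarrow> \<psi> \<in> chains D \<Longrightarrow> f (augment_chain \<psi>) = augment_chain (f \<psi>)"
  and natural_add: "natural D D' f \<Longrightarrow> \<psi> \<in> chains D \<Longrightarrow> \<xi> \<in> chains D \<Longrightarrow> f (\<psi> + \<xi>) = f \<psi> + f \<xi>"
  unfolding natural_def by blast+

text \<open>
  The components of the differential are signed sums of saddle maps, and saddle maps commute with the
  augmentation strictly, so the signs of the edges can be carried along.
\<close>
lemma natural_differential:
  assumes "link_diagram D"
  shows "natural D D (differential D \<epsilon>)"
proof -
  let ?T = "\<lambda>w x \<psi>. scale (\<epsilon> (w - {x}) x) (edge D (w - {x}) x (\<psi> (w - {x})))"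
  have op: "chain_op D (circles D w) (\<lambda>\<psi>. \<Sum>x\<in>w. ?T w x \<psi>)" if w: "w \<subseteq> xings D" for w
  proof (rule chain_op_sum)
    show "finite (circles D w)" using assms w by (rule finite_circles)
    fix x assume x: "x \<in> w"
    have v: "w - {x} \<subseteq> xings D" and eq: "insert x (w - {x}) = w" using w x by auto
    have "exterior_op (circles D (w - {x})) (circles D w) (edge D (w - {x}) x)"
      using exterior_op_edge[OF assms v, of x] w x unfolding eq by blast
    then show "chain_op D (circles D w) (?T w x)"
      using finite_circles[OF assms] w v
      by (intro chain_op_vertex[OF exterior_op_comp[OF _ _ exterior_op_scale]])
  qed
  show ?thesis
  proof (rule naturalI[OF assms])
    fix \<psi> assume \<psi>: "\<psi> \<in> chains D"
    show "differential D \<epsilon> \<psi> \<in> chains D"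
    proof (rule chainsI)
      fix w assume "w \<subseteq> xings D"
      then show "differential D \<epsilon> \<psi> w \<in> exterior (circles D w)"
        using op[of w] \<psi> unfolding chain_op_def differential_def by simp
    qed (simp add: differential_def)
  next
    fix w assume "w \<subseteq> xings D"
    then show "\<exists>B T. chain_op D B T \<and> (\<forall>\<psi>\<in>chains D. differential D \<epsilon> \<psi> w = T \<psi>)"
      using op[of w] unfolding differential_def by auto
  qed
qed

section \<open>Local changes of diagrams and the maps of simple moves\<close>

lemma UN_off:
  assumes "\<And>x. x \<in> X - Z \<Longrightarrow> A x \<inter> Z = {}" "\<And>x. x \<in> X \<inter> Z \<Longrightarrow> A x \<subseteq> Z"
  shows "(\<Union>x\<in>X. A x) - Z = (\<Union>x\<in>X - Z. A x)"
  using assms by blast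

text \<open>
  Outside \<open>Z\<close> a resolution is determined by the part of the diagram outside \<open>Z\<close>, provided that the
  disc of every crossing lies on one side.
\<close>
lemma resolution_off:
  assumes "\<And>x. x \<in> xings D - Z \<Longrightarrow> disc (chart D x) \<inter> Z = {}"
    and "\<And>x. x \<in> xings D \<inter> Z \<Longrightarrow> disc (chart D x) \<subseteq> Z"
  shows "resolution D v - Z = (curve D - Z - (\<Union>x\<in>xings D - Z. disc (chart D x))) \<union>
    (\<Union>x\<in>xings D - Z. chart D x ` (if x \<in> v then res1 else res0))"
proof -
  let ?arcs = "\<lambda>x. chart D x ` (if x \<in> v then res1 else res0)"
  have arcs: "?arcs x \<subseteq> disc (chart D x)" for x
    using res0_subset res1_subset by auto
  have "(\<Union>x\<in>xings D. ?arcs x) - Z = (\<Union>x\<in>xings D - Z. ?arcs x)"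
  proof (rule UN_off)
    show "?arcs x \<inter> Z = {}" if "x \<in> xings D - Z" for x using assms(1)[OF that] arcs by blast
    show "?arcs x \<subseteq> Z" if "x \<in> xings D \<inter> Z" for x using assms(2)[OF that] arcs by blast
  qed
  moreover have "(\<Union>x\<in>xings D. disc (chart D x)) - Z = (\<Union>x\<in>xings D - Z. disc (chart D x))"
    by (rule UN_off) (rule assms; assumption)+
  moreover have "(C - U) \<union> V - Z = (C - Z - (U - Z)) \<union> (V - Z)" for C U V :: "complex set"
    by blast
  ultimately show ?thesis unfolding resolution_def by simp
qed

lemma agree_outside_far:
  "agree_outside B D D' \<Longrightarrow> x \<in> xings D - B \<Longrightarrow> disc (chart D x) \<inter> B = {}"
  unfolding agree_outside_def by (elim conjE) (drule bspec, assumption, elim conjE)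

lemma agree_outside_curve: "agree_outside B D D' \<Longrightarrow> curve D - B = curve D' - B"
  and agree_outside_xings: "agree_outside B D D' \<Longrightarrow> xings D - B = xings D' - B"
  unfolding agree_outside_def by simp_all

lemma agree_outside_sym:
  assumes "agree_outside B D D'"
  shows "agree_outside B D' D"
proof -
  have xings: "xings D' - B = xings D - B" using assms unfolding agree_outside_def by simp
  have "disc (chart D' x) \<inter> B = {} \<and> (\<forall>z\<in>cball 0 1. chart D' x z = chart D x z)"
    if "x \<in> xings D - B" for x
  proof -
    have *: "disc (chart D x) \<inter> B = {}" "\<And>z. z \<in> cball 0 1 \<Longrightarrow> chart D x z = chart D' x z"
      using assms that unfolding agree_outside_def by blast+
    have "disc (chart D' x) = disc (chart D x)" using *(2) by (intro image_cong) auto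
    then have "disc (chart D' x) \<inter> B = {}" using *(1) by (rule ssubst[where P = "\<lambda>Y. Y \<inter> B = {}"])
    then show ?thesis using *(2)[symmetric] by (intro conjI ballI)
  qed
  then have "\<forall>x\<in>xings D' - B. disc (chart D' x) \<inter> B = {} \<and>
      (\<forall>z\<in>cball 0 1. chart D' x z = chart D x z)"
    unfolding xings by (intro ballI)
  moreover have "curve D' - B = curve D - B" using assms unfolding agree_outside_def by simp
  ultimately show ?thesis unfolding agree_outside_def using xings by (intro conjI)
qed

lemma resolution_agree_outside:
  assumes "agree_outside Z D D'"
    and "\<And>x. x \<in> xings D \<inter> Z \<Longrightarrow> disc (chart D x) \<subseteq> Z"
    and "\<And>x. x \<in> xings D' \<inter> Z \<Longrightarrow> disc (chart D' x) \<subseteq> Z"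
    and "v - Z = v' - Z"
  shows "resolution D v - Z = resolution D' v' - Z"
proof -
  have agree: "curve D - Z = curve D' - Z" "xings D - Z = xings D' - Z"
    using assms(1) unfolding agree_outside_def by auto
  have charts: "chart D x ` S = chart D' x ` S" if "x \<in> xings D' - Z" "S \<subseteq> cball 0 1" for x S
    using assms(1) that unfolding agree_outside_def by (intro image_cong) auto
  have "resolution D v - Z = (curve D - Z - (\<Union>x\<in>xings D - Z. disc (chart D x))) \<union>
    (\<Union>x\<in>xings D - Z. chart D x ` (if x \<in> v then res1 else res0))"
    by (intro resolution_off agree_outside_far[OF assms(1)] assms(2))
  also have "\<dots> = (curve D' - Z - (\<Union>x\<in>xings D' - Z. disc (chart D' x))) \<union>
    (\<Union>x\<in>xings D' - Z. chart D' x ` (if x \<in> v' then res1 else res0))"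
  proof -
    have "(\<Union>x\<in>xings D' - Z. disc (chart D x)) = (\<Union>x\<in>xings D' - Z. disc (chart D' x))"
      by (intro SUP_cong refl charts) auto
    moreover have "(\<Union>x\<in>xings D' - Z. chart D x ` (if x \<in> v then res1 else res0)) =
        (\<Union>x\<in>xings D' - Z. chart D' x ` (if x \<in> v' then res1 else res0))"
    proof (intro SUP_cong refl)
      fix x assume x: "x \<in> xings D' - Z"
      have "x \<in> v \<longleftrightarrow> x \<in> v'" using assms(4) x by blast
      then show "chart D x ` (if x \<in> v then res1 else res0) =
          chart D' x ` (if x \<in> v' then res1 else res0)"
        using charts[OF x] res0_subset res1_subset by simp
    qed
    ultimately show ?thesis unfolding agree by simp
  qed
  also have "\<dots> = resolution D' v' - Z"
    by (intro resolution_off[symmetric] agree_outside_far[OF agree_outside_sym[OF assms(1)]] assms(3))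
  finally show ?thesis .
qed

lemma has_tangle_curve: "has_tangle \<beta> M D \<Longrightarrow> curve D \<inter> disc \<beta> = \<beta> ` curve M"
  and has_tangle_xings: "has_tangle \<beta> M D \<Longrightarrow> xings D \<inter> disc \<beta> = \<beta> ` xings M"
  unfolding has_tangle_def by (elim conjE, assumption)+

lemma resolution_uncrossed:
  assumes "has_tangle \<beta> (uncrossed S) D" "agree_outside (disc \<beta>) D D'"
  shows "resolution D v \<inter> disc \<beta> = \<beta> ` S"
proof -
  have "curve D \<inter> disc \<beta> = \<beta> ` S" "xings D \<inter> disc \<beta> = {}"
    using has_tangle_curve[OF assms(1)] has_tangle_xings[OF assms(1)] by (simp_all add: uncrossed_def)
  then have far: "disc (chart D x) \<inter> disc \<beta> = {}" if "x \<in> xings D" for x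
    using agree_outside_far[OF assms(2)] that \<open>xings D \<inter> disc \<beta> = {}\<close> by blast
  have "chart D x ` (if x \<in> v then res1 else res0) \<subseteq> disc (chart D x)" for x
    using res0_subset res1_subset by auto
  then have "(\<Union>x\<in>xings D. chart D x ` (if x \<in> v then res1 else res0)) \<inter> disc \<beta> = {}"
    using far by blast
  moreover have "(\<Union>x\<in>xings D. disc (chart D x)) \<inter> disc \<beta> = {}" using far by blast
  moreover have "(C - U \<union> V) \<inter> Z = C \<inter> Z" if "V \<inter> Z = {}" "U \<inter> Z = {}" for C U V Z :: "complex set"
    using that by blast
  ultimately show ?thesis
    unfolding resolution_def using \<open>curve D \<inter> disc \<beta> = \<beta> ` S\<close> by simp
qed

lemma xings_uncrossed: "has_tangle \<beta> (uncrossed S) D \<Longrightarrow> xings D \<inter> disc \<beta> = {}"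
  by (drule has_tangle_xings) (simp add: uncrossed_def)

lemma exterior_op_scaled:
  "finite A \<Longrightarrow> finite B \<Longrightarrow> exterior_op A B T \<Longrightarrow> exterior_op A B (\<lambda>x. scale k (T x))"
  by (rule exterior_op_comp[OF _ _ exterior_op_scale])

lemma exterior_op_scaled_push:
  "finite A \<Longrightarrow> exterior_op A (h ` A) (\<lambda>x. scale k (push h A x))"
  by (intro exterior_op_scaled exterior_op_push) auto

lemma natural_redecoration:
  assumes "link_diagram D" "\<And>\<psi>. \<psi> \<in> chains D \<Longrightarrow> f \<psi> \<in> chains D'"
    and "xings D' = xings D" "redecoration_map Z D D' f"
  shows "natural D D' f"
proof (rule naturalI[OF assms(1,2)])
  obtain \<eta> where f: "f \<psi> v = scale (\<eta> v) (push (follow Z (resolution D' v)) (circles D v) (\<psi> v))"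
    if "\<psi> \<in> chains D" "v \<subseteq> xings D" for \<psi> v
    using assms(4) unfolding redecoration_map_def by blast
  fix v assume "v \<subseteq> xings D'"
  then have v: "v \<subseteq> xings D" using assms(3) by simp
  show "\<exists>B T. chain_op D B T \<and> (\<forall>\<psi>\<in>chains D. f \<psi> v = T \<psi>)"
    using f v chain_op_vertex[OF exterior_op_scaled_push[OF finite_circles[OF assms(1) v]] v] by blast
qed

lemma natural_isotopy:
  assumes "link_diagram D" "\<And>\<psi>. \<psi> \<in> chains D \<Longrightarrow> f \<psi> \<in> chains (image_diagram \<phi> D)"
    and "isotopy_map \<phi> D f"
  shows "natural D (image_diagram \<phi> D) f"
proof (rule naturalI[OF assms(1,2)])
  obtain \<eta> where f: "f \<psi> (\<phi> ` v) = scale (\<eta> v) (push (image \<phi>) (circles D v) (\<psi> v))"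
    if "\<psi> \<in> chains D" "v \<subseteq> xings D" for \<psi> v
    using assms(3) unfolding isotopy_map_def by blast
  fix w assume "w \<subseteq> xings (image_diagram \<phi> D)"
  then obtain v where v: "v \<subseteq> xings D" "w = \<phi> ` v"
    unfolding image_diagram_def by (auto elim: subset_imageE)
  show "\<exists>B T. chain_op D B T \<and> (\<forall>\<psi>\<in>chains D. f \<psi> w = T \<psi>)"
    unfolding v(2) using f v(1)
      chain_op_vertex[OF exterior_op_scaled_push[OF finite_circles[OF assms(1) v(1)]] v(1)] by blast
qed

lemma natural_birth:
  assumes "link_diagram D" "\<And>\<psi>. \<psi> \<in> chains D \<Longrightarrow> f \<psi> \<in> chains D'"
    and "xings D' = xings D" "birth_map D f"
  shows "natural D D' f"
proof (rule naturalI[OF assms(1,2)])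
  obtain \<eta> where f: "f \<psi> v = scale (\<eta> v) (\<psi> v)" if "\<psi> \<in> chains D" "v \<subseteq> xings D" for \<psi> v
    using assms(4) unfolding birth_map_def by blast
  fix v assume "v \<subseteq> xings D'"
  then have v: "v \<subseteq> xings D" using assms(3) by simp
  show "\<exists>B T. chain_op D B T \<and> (\<forall>\<psi>\<in>chains D. f \<psi> v = T \<psi>)"
    using f v chain_op_vertex[OF exterior_op_scale[OF finite_circles[OF assms(1) v]] v] by blast
qed

lemma natural_death:
  assumes "link_diagram D" "\<And>\<psi>. \<psi> \<in> chains D \<Longrightarrow> f \<psi> \<in> chains D'"
    and "xings D' = xings D" "death_map O' D f"
  shows "natural D D' f"
proof (rule naturalI[OF assms(1,2)])
  obtain \<eta> where f: "f \<psi> v = scale (\<eta> v) (contract O' (\<psi> v))"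
    if "\<psi> \<in> chains D" "v \<subseteq> xings D" for \<psi> v
    using assms(4) unfolding death_map_def by blast
  fix v assume "v \<subseteq> xings D'"
  then have v: "v \<subseteq> xings D" using assms(3) by simp
  have fin: "finite (circles D v)" using finite_circles[OF assms(1) v] .
  show "\<exists>B T. chain_op D B T \<and> (\<forall>\<psi>\<in>chains D. f \<psi> v = T \<psi>)"
    using f v chain_op_vertex[OF exterior_op_scaled[OF fin finite_Diff[OF fin]
        exterior_op_contract[OF fin]] v] by blast
qed

lemma natural_saddle:
  assumes "link_diagram D" "link_diagram D'" "\<And>\<psi>. \<psi> \<in> chains D \<Longrightarrow> f \<psi> \<in> chains D'"
    and "local_change \<beta> (uncrossed res0) (uncrossed res1) D D'" "saddle_map \<beta> D D' f"
  shows "natural D D' f"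
proof (rule naturalI[OF assms(1,3)])
  let ?Z = "disc \<beta>"
  have lc: "disc_chart \<beta>" "has_tangle \<beta> (uncrossed res0) D" "has_tangle \<beta> (uncrossed res1) D'"
    "agree_outside ?Z D D'"
    using assms(4) unfolding local_change_def by auto
  have empty: "xings D \<inter> ?Z = {}" "xings D' \<inter> ?Z = {}"
    using xings_uncrossed lc(2,3) by auto
  then have eq: "xings D' = xings D" using lc(4) unfolding agree_outside_def by blast
  obtain \<eta> where f: "f \<psi> v = scale (\<eta> v) (saddle \<beta> (resolution D v) (resolution D' v) (\<psi> v))"
    if "\<psi> \<in> chains D" "v \<subseteq> xings D" for \<psi> v
    using assms(5) unfolding saddle_map_def by blast
  fix v assume "v \<subseteq> xings D'"
  then have v: "v \<subseteq> xings D" "v \<subseteq> xings D'" using eq by simp_all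
  have fin: "finite (circles D v)" "finite (circles D' v)" using finite_circles assms(1,2) v by auto
  have "exterior_op (circles D v) (circles D' v) (saddle \<beta> (resolution D v) (resolution D' v))"
  proof (rule exterior_op_saddle[OF fin(1)])
    have "\<beta> ` res1 \<subseteq> resolution D' v"
      using resolution_uncrossed[OF lc(3) agree_outside_sym[OF lc(4)]] by blast
    then show "\<beta> (-1) \<in> resolution D' v" "\<beta> 1 \<in> resolution D' v"
      unfolding res1_def by auto
    have "resolution D v - ?Z = resolution D' v - ?Z"
      using empty by (intro resolution_agree_outside lc(4)) auto
    then show "a \<in> circles D' v" if "a \<in> circles D v" "a \<inter> ?Z = {}" for a
      using circle_avoiding_set[OF link_diagram_resolution[OF assms(1) v(1)] closed_disc[OF lc(1)]]
        that by blast
  qed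
  then show "\<exists>B T. chain_op D B T \<and> (\<forall>\<psi>\<in>chains D. f \<psi> v = T \<psi>)"
    using f v chain_op_vertex[OF exterior_op_scaled[OF fin] v(1)] by blast
qed

lemma R1_crossing:
  assumes "local_change \<beta> R1_straight (R1_kink one) D D' \<or> local_change \<beta> (R1_kink one) R1_straight D' D"
  shows "xings D' = insert (\<beta> 0) (xings D)" "\<beta> 0 \<notin> xings D"
proof -
  have "has_tangle \<beta> R1_straight D" "has_tangle \<beta> (R1_kink one) D'" "agree_outside (disc \<beta>) D D'"
    using assms agree_outside_sym unfolding local_change_def by blast+
  then have "xings D \<inter> disc \<beta> = {}" "xings D' \<inter> disc \<beta> = {\<beta> 0}"
    "xings D - disc \<beta> = xings D' - disc \<beta>"
    using has_tangle_xings[of \<beta> R1_straight D] has_tangle_xings[of \<beta> "R1_kink one" D']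
    by (simp_all add: R1_straight_def R1_kink_def uncrossed_def agree_outside_def)
  moreover have "\<beta> 0 \<in> disc \<beta>" by simp
  moreover have "X' = insert p X \<and> p \<notin> X"
    if "X \<inter> Z = {}" "X' \<inter> Z = {p}" "X - Z = X' - Z" "p \<in> Z" for X X' Z and p :: complex
    using that by blast
  ultimately show "xings D' = insert (\<beta> 0) (xings D)" "\<beta> 0 \<notin> xings D" by meson+
qed

text \<open>
  Each vertex of the larger cube arises from a vertex of the smaller one by resolving the new crossing
  in one of the two ways, and the map has a nonzero component for only one of them.
\<close>
lemma natural_R1_add:
  assumes "link_diagram D" "\<And>\<psi>. \<psi> \<in> chains D \<Longrightarrow> f \<psi> \<in> chains D'"
    and "local_change \<beta> R1_straight (R1_kink one) D D'" "R1_add one \<beta> D D' f"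
  shows "natural D D' f"
proof (rule naturalI[OF assms(1,2)])
  note xings = R1_crossing[OF disjI1[OF assms(3)]]
  define w where "w v = (if one then insert (\<beta> 0) v else v)" for v
  define w' where "w' v = (if one then v else insert (\<beta> 0) v)" for v
  define y where "y v = push (follow (disc \<beta>) (resolution D' (w v))) (circles D v)" for v
  define a where "a v = connected_component_set (resolution D' (w v)) (\<beta> (-1))" for v
  define O' where "O' v = connected_component_set (resolution D' (w v)) (\<beta> (1/2))" for v
  obtain \<eta> where "\<forall>\<psi>\<in>chains D. \<forall>v\<subseteq>xings D.
      f \<psi> (w v) = scale (\<eta> v) (if one then y v (\<psi> v)
        else wedge (a v) (y v (\<psi> v)) - wedge (O' v) (y v (\<psi> v))) \<and> f \<psi> (w' v) = 0"
    using assms(4)[unfolded R1_add_def Let_def, folded w_def w'_def, folded y_def a_def O'_def]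
    by (elim exE conjE) (rule that)
  then have f: "f \<psi> (w v) = scale (\<eta> v) (if one then y v (\<psi> v)
      else wedge (a v) (y v (\<psi> v)) - wedge (O' v) (y v (\<psi> v)))" "f \<psi> (w' v) = 0"
    if "\<psi> \<in> chains D" "v \<subseteq> xings D" for \<psi> v
    using that by blast+
  fix u assume "u \<subseteq> xings D'"
  then have v: "u - {\<beta> 0} \<subseteq> xings D" using xings by blast
  have "u = w (u - {\<beta> 0}) \<or> u = w' (u - {\<beta> 0})" unfolding w_def w'_def by auto
  then obtain v where v: "v \<subseteq> xings D" "u = w v \<or> u = w' v" using v by blast
  have fin: "finite (circles D v)" using finite_circles[OF assms(1) v(1)] .
  let ?B = "follow (disc \<beta>) (resolution D' (w v)) ` circles D v"
  have push: "exterior_op (circles D v) ?B (y v)"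
    unfolding y_def using fin by (intro exterior_op_push) auto
  have "exterior_op ?B (insert (a v) (insert (O' v) ?B)) (\<lambda>x. wedge (a v) x - wedge (O' v) x)"
    using fin by (intro exterior_op_wedge_diff) auto
  note split = exterior_op_comp[OF fin push this]
  from v(2) show "\<exists>B T. chain_op D B T \<and> (\<forall>\<psi>\<in>chains D. f \<psi> u = T \<psi>)"
  proof
    assume u: "u = w v"
    have "chain_op D (insert (a v) (insert (O' v) ?B))
        (\<lambda>\<psi>. scale (\<eta> v) (wedge (a v) (y v (\<psi> v)) - wedge (O' v) (y v (\<psi> v))))"
      using fin by (intro chain_op_vertex[OF exterior_op_scaled[OF fin _ split] v(1)]) auto
    moreover have "chain_op D ?B (\<lambda>\<psi>. scale (\<eta> v) (y v (\<psi> v)))"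
      using fin by (intro chain_op_vertex[OF exterior_op_scaled[OF fin _ push] v(1)]) auto
    ultimately show ?thesis using f(1)[OF _ v(1)] u by (cases one) auto
  next
    assume "u = w' v"
    then show ?thesis using f(2)[OF _ v(1)] chain_op_zero by blast
  qed
qed

lemma natural_R1_remove:
  assumes "link_diagram D'" "\<And>\<psi>. \<psi> \<in> chains D' \<Longrightarrow> f \<psi> \<in> chains D"
    and "local_change \<beta> (R1_kink one) R1_straight D' D" "R1_remove one \<beta> D' D f"
  shows "natural D' D f"
proof (rule naturalI[OF assms(1,2)])
  note xings = R1_crossing[OF disjI2[OF assms(3)]]
  define w where "w v = (if one then insert (\<beta> 0) v else v)" for v
  define a where "a v = connected_component_set (resolution D v) (\<beta> (-1))" for v
  define O' where "O' v = connected_component_set (resolution D' (w v)) (\<beta> (1/2))" for v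
  define old where "old v = follow (disc \<beta>) (resolution D v)" for v
  obtain \<eta> where f: "\<forall>\<psi>\<in>chains D'. \<forall>v\<subseteq>xings D. f \<psi> v = scale (\<eta> v)
      (if one then push (\<lambda>b. if b = O' v then a v else old v b) (circles D' (w v)) (\<psi> (w v))
       else push (old v) (circles D' (w v) - {O' v}) (contract (O' v) (\<psi> (w v))))"
    using assms(4)[unfolded R1_remove_def Let_def, folded w_def, folded a_def O'_def old_def]
    by (elim exE conjE) (rule that)
  fix v assume v: "v \<subseteq> xings D"
  then have w: "w v \<subseteq> xings D'" unfolding w_def xings by auto
  have fin: "finite (circles D' (w v))" using finite_circles[OF assms(1) w] .
  note contract = exterior_op_contract[OF fin, of "O' v"]
  have "exterior_op (circles D' (w v) - {O' v}) (old v ` (circles D' (w v) - {O' v}))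
      (\<lambda>x. scale (\<eta> v) (push (old v) (circles D' (w v) - {O' v}) x))"
    using fin by (intro exterior_op_scaled_push) auto
  note zero = chain_op_vertex[OF exterior_op_comp[OF fin contract this] w]
  note one = chain_op_vertex[OF exterior_op_scaled_push[OF fin] w,
    of "\<lambda>b. if b = O' v then a v else old v b" "\<eta> v"]
  show "\<exists>B T. chain_op D' B T \<and> (\<forall>\<psi>\<in>chains D'. f \<psi> v = T \<psi>)"
    using f v zero one
    by (cases one) auto
qed

section \<open>Components under the replacement of a tangle\<close>

text \<open>
  A continuous map between the tangles that fixes their endpoints on the boundary of the disc extends by
  the identity. Two closed pieces are glued here: the part in the closed disc, and the complement of
  the open disc. That the image of the open disc is open is invariance of domain.
\<close>
lemma tangle_map_extends:
  assumes "disc_chart \<beta>" "P \<subseteq> cball 0 1" "P' \<subseteq> cball 0 1"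
    and "continuous_on P \<rho>" "\<rho> ` P \<subseteq> P'" "\<And>z. z \<in> P \<Longrightarrow> cmod z = 1 \<Longrightarrow> \<rho> z = z"
    and "S \<inter> disc \<beta> = \<beta> ` P" "\<beta> ` P' \<subseteq> S'" "S - disc \<beta> \<subseteq> S'"
  obtains r where "continuous_on S r" "r ` S \<subseteq> S'" "\<And>z. z \<in> S - disc \<beta> \<Longrightarrow> r z = z"
proof -
  have \<beta>: "continuous_on (cball 0 1) \<beta>" "inj_on \<beta> (cball 0 1)"
    using assms(1) unfolding disc_chart_def by auto
  obtain \<gamma> where \<gamma>: "homeomorphism (cball 0 1) (disc \<beta>) \<beta> \<gamma>"
    using homeomorphism_compact[OF compact_cball \<beta>(1) refl \<beta>(2)] by blast
  then have inv: "\<gamma> (\<beta> z) = z" if "z \<in> cball 0 1" for z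
    using that by (rule homeomorphism_apply1)
  define r where "r = (\<lambda>z. if z \<in> disc \<beta> then \<beta> (\<rho> (\<gamma> z)) else z)"
  \<comment> \<open>Hence the two pieces only meet in points of the boundary circle, where \<open>\<rho>\<close> is the identity.\<close>
  have open_image: "open (\<beta> ` ball 0 1)"
    using \<beta> by (intro invariance_of_domain)
      (auto intro: continuous_on_subset[of "cball 0 1"] inj_on_subset[of _ "cball 0 1"])
  have sub: "\<beta> ` ball 0 1 \<subseteq> disc \<beta>" by auto
  have union: "(S \<inter> disc \<beta>) \<union> (S - \<beta> ` ball 0 1) = S" using sub by blast
  have "continuous_on ((S \<inter> disc \<beta>) \<union> (S - \<beta> ` ball 0 1)) r"
    unfolding r_def
  proof (rule continuous_on_cases_local)
    show "closedin (top_of_set ((S \<inter> disc \<beta>) \<union> (S - \<beta> ` ball 0 1))) (S \<inter> disc \<beta>)"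
      unfolding union using closed_disc[OF assms(1)] by (rule closedin_closed_Int)
    have "S - \<beta> ` ball 0 1 = S \<inter> - \<beta> ` ball 0 1" by blast
    then show "closedin (top_of_set ((S \<inter> disc \<beta>) \<union> (S - \<beta> ` ball 0 1))) (S - \<beta> ` ball 0 1)"
      unfolding union using open_image by (simp add: closedin_closed_Int closed_Compl)
    have "continuous_on (S \<inter> disc \<beta>) \<gamma>"
      using homeomorphism_cont2[OF \<gamma>] by (rule continuous_on_subset) blast
    moreover have "\<gamma> ` (S \<inter> disc \<beta>) \<subseteq> P"
      unfolding assms(7) using inv assms(2) by auto
    moreover from this have "(\<lambda>z. \<rho> (\<gamma> z)) ` (S \<inter> disc \<beta>) \<subseteq> cball 0 1"
      using assms(3,5) by blast
    ultimately show "continuous_on (S \<inter> disc \<beta>) (\<lambda>z. \<beta> (\<rho> (\<gamma> z)))"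
      by (intro continuous_on_compose2[OF \<beta>(1)] continuous_on_compose2[OF assms(4)])
    show "continuous_on (S - \<beta> ` ball 0 1) (\<lambda>z. z)" by (rule continuous_on_id)
    fix x assume "x \<in> S \<inter> disc \<beta> \<and> x \<notin> disc \<beta> \<or> x \<in> S - \<beta> ` ball 0 1 \<and> x \<in> disc \<beta>"
    then have "x \<in> S - \<beta> ` ball 0 1" "x \<in> \<beta> ` P" using assms(7) by blast+
    then obtain z where z: "z \<in> P" "x = \<beta> z" by blast
    then have "cmod z \<le> 1" "z \<notin> ball 0 1" using assms(2) \<open>x \<in> S - \<beta> ` ball 0 1\<close> by auto
    then have "cmod z = 1" by simp
    then show "\<beta> (\<rho> (\<gamma> x)) = x" using z inv[of z] assms(6)[of z] by simp
  qed
  then have "continuous_on S r" unfolding union .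
  moreover have "r ` S \<subseteq> S'"
  proof
    fix y assume "y \<in> r ` S"
    then obtain x where x: "x \<in> S" "y = r x" by blast
    show "y \<in> S'"
    proof (cases "x \<in> disc \<beta>")
      case True
      then obtain z where "z \<in> P" "x = \<beta> z" using x(1) assms(7) by blast
      then have "y = \<beta> (\<rho> z)" "\<rho> z \<in> P'" using x(2) True inv[of z] assms(2,5) unfolding r_def by auto
      then show ?thesis using assms(8) by blast
    next
      case False
      then show ?thesis using x assms(9) unfolding r_def by auto
    qed
  qed
  ultimately show ?thesis using that unfolding r_def by auto
qed

text \<open>
  Maps in both directions that are the identity off \<open>Z\<close> carry a component into a component, and so match
  the components with the same part outside \<open>Z\<close>.
\<close>
lemma component_transfer:
  assumes "continuous_on S r" "r ` S \<subseteq> S'" "\<And>z. z \<in> S - Z \<Longrightarrow> r z = z"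
    and "continuous_on S' r'" "r' ` S' \<subseteq> S" "\<And>z. z \<in> S' - Z \<Longrightarrow> r' z = z"
    and "a \<in> components S'" "a - Z \<noteq> {}"
  shows "\<exists>b\<in>components S. b - Z = a - Z"
proof -
  obtain p where p: "p \<in> a" "p \<notin> Z" using assms(8) by blast
  have a: "a \<subseteq> S'" "connected a"
    using assms(7) in_components_subset in_components_connected by blast+
  then have "r' p = p" using assms(6) p by blast
  then have "p \<in> S" using assms(5) a(1) p(1) by force
  define b where "b = connected_component_set S p"
  have b: "b \<in> components S" "b \<subseteq> S" "connected b" "p \<in> b"
    unfolding b_def components_def using \<open>p \<in> S\<close> by (auto simp: connected_component_subset)
  have "connected (r' ` a)" "p \<in> r' ` a" "r' ` a \<subseteq> S"
    using connected_continuous_image[OF continuous_on_subset[OF assms(4) a(1)] a(2)]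
      \<open>r' p = p\<close> p(1) assms(5) a(1) by (auto intro: rev_image_eqI)
  then have 1: "r' ` a \<subseteq> b" unfolding b_def by (intro connected_component_maximal)
  have "r p = p" using assms(3) \<open>p \<in> S\<close> p(2) by blast
  then have "p \<in> r ` b" using b(4) by (metis imageI)
  then have "connected (r ` b)" "r ` b \<subseteq> S'" "a \<inter> r ` b \<noteq> {}"
    using connected_continuous_image[OF continuous_on_subset[OF assms(1) b(2)] b(3)]
      assms(2) b(2) p(1) by blast+
  then have 2: "r ` b \<subseteq> a" using components_maximal[OF assms(7)] by blast
  have "x \<in> b" if "x \<in> a - Z" for x using 1 assms(6)[of x] a(1) that by force
  moreover have "x \<in> a" if "x \<in> b - Z" for x using 2 assms(3)[of x] b(2) that by force
  ultimately show ?thesis using b(1) by blast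
qed

lemma component_eq_connected_component:
  assumes "b \<in> components S" "p \<in> b"
  shows "b = connected_component_set S p"
  using assms connected_component_eq[of p S] unfolding components_def by blast

text \<open>
  A component of \<open>S\<close> that leaves \<open>Z\<close> is determined by a point outside \<open>Z\<close>, which can be chosen in
  terms of the matching component of \<open>S'\<close>. The other components meet one of two connected sets.
\<close>
lemma finite_components_transfer:
  assumes "finite (components S')"
    and "\<And>b. b \<in> components S \<Longrightarrow> b - Z \<noteq> {} \<Longrightarrow> \<exists>a\<in>components S'. a - Z = b - Z"
    and "S \<inter> Z \<subseteq> P \<union> Q" "P \<subseteq> S" "Q \<subseteq> S" "connected P" "connected Q"
  shows "finite (components S)"
proof -
  define pick where "pick a = (SOME p. p \<in> a - Z)" for a
  have "components S \<subseteq> {b \<in> components S. b \<inter> P \<noteq> {}} \<union> {b \<in> components S. b \<inter> Q \<noteq> {}} \<union>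
      (\<lambda>a. connected_component_set S (pick a)) ` components S'"
  proof
    fix b assume b: "b \<in> components S"
    then obtain x where x: "x \<in> b" "x \<in> S" using in_components_nonempty in_components_subset by blast
    show "b \<in> {b \<in> components S. b \<inter> P \<noteq> {}} \<union> {b \<in> components S. b \<inter> Q \<noteq> {}} \<union>
      (\<lambda>a. connected_component_set S (pick a)) ` components S'"
    proof (cases "x \<in> Z")
      case True
      then show ?thesis using x b assms(3) by blast
    next
      case False
      then obtain a where a: "a \<in> components S'" "a - Z = b - Z" using assms(2)[OF b] x by blast
      then have "pick a \<in> b - Z" unfolding pick_def using x(1) False by (metis DiffI someI)
      then have "b = connected_component_set S (pick a)"
        using component_eq_connected_component[OF b] by blast
      then show ?thesis using a(1) by blast
    qed
  qed
  moreover have "finite {b \<in> components S. b \<inter> P \<noteq> {}}" if P: "P \<subseteq> S" "connected P" for P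
  proof -
    have "b = c" if bc: "b \<in> components S" "c \<in> components S" "b \<inter> P \<noteq> {}" "c \<inter> P \<noteq> {}" for b c
    proof -
      have "P \<subseteq> b" "P \<subseteq> c" using components_maximal bc P by blast+
      then have "b \<inter> c \<noteq> {}" using bc(3) by blast
      then show ?thesis using components_eq bc(1,2) by blast
    qed
    then have "\<forall>b\<in>{b \<in> components S. b \<inter> P \<noteq> {}}. \<forall>c\<in>{b \<in> components S. b \<inter> P \<noteq> {}}. b = c"
      by simp
    then show ?thesis by (metis (no_types, lifting) finite.simps is_singletonI' is_singleton_def)
  qed
  moreover have "finite ((\<lambda>a. connected_component_set S (pick a)) ` components S')"
    using assms(1) by (rule finite_imageI)
  ultimately show ?thesis using assms(4-7) by (meson finite_UnI finite_subset)
qed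

text \<open>
  A nonempty part outside \<open>Z\<close> determines a component, which makes the description in \<open>follow\<close> proper.
\<close>
lemma follow_component:
  assumes "b \<in> components S" "b - Z = a - Z" "a - Z \<noteq> {}"
  shows "follow Z S a \<in> components S"
proof -
  have "\<exists>!b. b \<in> components S \<and> b - Z = a - Z"
  proof (rule ex1I)
    show "b \<in> components S \<and> b - Z = a - Z" using assms by blast
    fix c assume c: "c \<in> components S \<and> c - Z = a - Z"
    then have "c \<inter> b \<noteq> {}" using assms by blast
    then show "c = b" using components_eq c assms(1) by blast
  qed
  from theI'[OF this] show ?thesis unfolding follow_def by blast
qed

text \<open>
  The image of \<open>h\<close> would be a compact interval homeomorphic to a circle, but the circle is not
  contractible.
\<close>
lemma not_homeomorphic_circle:
  fixes a :: "complex set" and h :: "complex \<Rightarrow> real"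
  assumes "a homeomorphic (sphere 0 1 :: complex set)" "connected a" "continuous_on a h" "inj_on h a"
  shows False
proof -
  have "compact a" using homeomorphic_compactness[OF assms(1)] by simp
  then have "a homeomorphic h ` a" using homeomorphic_compact assms(3,4) by blast
  moreover have "convex (h ` a)"
    using connected_continuous_image[OF assms(3,2)] is_interval_connected_1 is_interval_convex_1 by metis
  ultimately have "contractible (sphere 0 1 :: complex set)"
    using homeomorphic_contractible_eq assms(1) convex_imp_contractible by metis
  then show False by (simp add: contractible_sphere)
qed

section \<open>The tangle of a Reidemeister II move\<close>

text \<open>
  The tangle of the move is symmetric in the diagonal and the antidiagonal. In the coordinates
  \<open>Re z + Im z\<close> and \<open>Re z - Im z\<close> each arc of its resolution is a graph over the second one.
\<close>
definition coord_sum :: "complex \<Rightarrow> real" where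
  "coord_sum z = Re z + Im z"

definition coord_diff :: "complex \<Rightarrow> real" where
  "coord_diff z = Re z - Im z"

definition coord_point :: "real \<Rightarrow> real \<Rightarrow> complex" where
  "coord_point s d = Complex ((s + d) / 2) ((s - d) / 2)"

lemma coord_point_simps [simp]:
  "coord_sum (coord_point s d) = s" "coord_diff (coord_point s d) = d"
  unfolding coord_sum_def coord_diff_def coord_point_def by (auto simp: field_simps)

lemma coord_point_eqI: "coord_sum z = s \<Longrightarrow> coord_diff z = d \<Longrightarrow> coord_point s d = z"
  unfolding coord_sum_def coord_diff_def coord_point_def by (auto simp: complex_eq_iff)

lemma coord_norm: "(coord_sum z)\<^sup>2 + (coord_diff z)\<^sup>2 = 2 * (cmod z)\<^sup>2"
  unfolding coord_sum_def coord_diff_def cmod_power2 by (simp add: power2_eq_square algebra_simps)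

lemma closed_segment_antidiagonal:
  assumes "Re a + Im a = Re b + Im b" "Re b \<le> Re a"
  shows "closed_segment a b = {z. Re z + Im z = Re a + Im a \<and> Re b \<le> Re z \<and> Re z \<le> Re a}"
proof
  show "closed_segment a b \<subseteq> {z. Re z + Im z = Re a + Im a \<and> Re b \<le> Re z \<and> Re z \<le> Re a}"
  proof
    fix z assume "z \<in> closed_segment a b"
    then obtain u where u: "0 \<le> u" "u \<le> 1" "z = (1 - u) *\<^sub>R a + u *\<^sub>R b"
      unfolding closed_segment_def by blast
    have "0 \<le> u * (Re a - Re b)" "0 \<le> (1 - u) * (Re a - Re b)" using u assms(2) by simp_all
    moreover have "Re z = (1 - u) * Re a + u * Re b" "Im z = (1 - u) * Im a + u * Im b"
      using u(3) by simp_all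
    moreover have "Im b = Re a + Im a - Re b" using assms(1) by simp
    ultimately show "z \<in> {z. Re z + Im z = Re a + Im a \<and> Re b \<le> Re z \<and> Re z \<le> Re a}"
      by (simp add: algebra_simps)
  qed
  show "{z. Re z + Im z = Re a + Im a \<and> Re b \<le> Re z \<and> Re z \<le> Re a} \<subseteq> closed_segment a b"
  proof
    fix z assume z: "z \<in> {z. Re z + Im z = Re a + Im a \<and> Re b \<le> Re z \<and> Re z \<le> Re a}"
    show "z \<in> closed_segment a b"
    proof (cases "Re a = Re b")
      case True
      then have "z = a" using z assms by (auto simp: complex_eq_iff)
      then show ?thesis by simp
    next
      case False
      define u where "u = (Re a - Re z) / (Re a - Re b)"
      have "u * (Re a - Re b) = Re a - Re z" unfolding u_def using False by simp
      moreover have "Im b = Re a + Im a - Re b" "Im z = Re a + Im a - Re z" using assms(1) z by simp_all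
      moreover have "Im b = Im a + (Re a - Re b)" using assms(1) by simp
      then have "u * Im b = u * Im a + u * (Re a - Re b)" by (simp only: distrib_left)
      ultimately have "Re z = (1 - u) * Re a + u * Re b" "Im z = (1 - u) * Im a + u * Im b"
        by (simp_all add: algebra_simps)
      then have "z = (1 - u) *\<^sub>R a + u *\<^sub>R b" by (simp add: complex_eq_iff)
      moreover have "0 \<le> u" "u \<le> 1" unfolding u_def using z False assms(2) by (auto simp: field_simps)
      ultimately show ?thesis unfolding closed_segment_def by blast
    qed
  qed
qed

lemma res1_coords: "res1 = {z. \<bar>coord_sum z\<bar> = 1 \<and> \<bar>coord_diff z\<bar> \<le> 1}"
proof -
  have "closed_segment 1 \<i> = {z. Re z + Im z = 1 \<and> 0 \<le> Re z \<and> Re z \<le> 1}"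
    by (subst closed_segment_antidiagonal) auto
  moreover have "closed_segment (-1) (-\<i>) = {z. Re z + Im z = -1 \<and> -1 \<le> Re z \<and> Re z \<le> 0}"
    by (subst closed_segment_commute, subst closed_segment_antidiagonal) auto
  ultimately show ?thesis unfolding res1_def coord_sum_def coord_diff_def by auto
qed

text \<open>
  A linear change of coordinates after which the strands of \<open>R2_crossed\<close> are horizontal and vertical and
  the discs of its two crossings are round of radius 1, with centres \<open>grid_crossing\<close> and
  \<open>- grid_crossing\<close>.
\<close>
definition grid :: "complex \<Rightarrow> complex" where
  "grid = linear_chart 0 (Complex (5/60) (-1/60)) (Complex (-1/60) (5/60))"

lemma Re_grid: "Re (grid z) = 1/12 * Re z - 1/60 * Im z"
  and Im_grid: "Im (grid z) = 1/12 * Im z - 1/60 * Re z"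
  unfolding grid_def linear_chart_def by auto

lemma coord_sum_grid: "coord_sum (grid z) = coord_sum z / 15"
  unfolding coord_sum_def Re_grid Im_grid by argo

lemma coord_diff_grid: "coord_diff (grid z) = coord_diff z / 10"
  unfolding coord_diff_def Re_grid Im_grid by argo

lemma linear_grid: "linear grid"
  by (rule linearI) (auto simp: complex_eq_iff Re_grid Im_grid field_simps)

lemma inj_grid: "inj grid"
proof (rule injI)
  fix x y assume "grid x = grid y"
  then have "1/12 * Re x - 1/60 * Im x = 1/12 * Re y - 1/60 * Im y"
    "1/12 * Im x - 1/60 * Re x = 1/12 * Im y - 1/60 * Re y"
    using Re_grid Im_grid by metis+
  then have "Re x = Re y \<and> Im x = Im y" by linarith
  then show "x = y" by (simp add: complex_eq_iff)
qed

lemma surj_grid: "surj grid"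
  using inj_grid linear_grid by (simp add: linear_injective_imp_surjective)

abbreviation grid_crossing :: complex where
  "grid_crossing \<equiv> Complex (5/2) (5/2)"

lemma grid_segment: "grid a = a' \<Longrightarrow> grid b = b' \<Longrightarrow> grid ` closed_segment a b = closed_segment a' b'"
  using closed_segment_linear_image[OF linear_grid, of a b] by simp

definition grid_curve :: "complex set" where
  "grid_curve = {z. Im z = 5/2 \<and> -5/2 \<le> Re z \<and> Re z \<le> 25/2} \<union>
     {z. Re z = -5/2 \<and> -25/2 \<le> Im z \<and> Im z \<le> 5/2} \<union>
     {z. Re z = 5/2 \<and> -5/2 \<le> Im z \<and> Im z \<le> 25/2} \<union>
     {z. Im z = -5/2 \<and> -25/2 \<le> Re z \<and> Re z \<le> 5/2}"

lemma curve_R2_crossed: "curve R2_crossed = grid ` grid_curve"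
proof -
  have "closed_segment (Complex (25/2) (5/2)) (Complex (-5/2) (5/2)) =
      {z. Im z = 5/2 \<and> -5/2 \<le> Re z \<and> Re z \<le> 25/2}"
    by (subst closed_segment_same_Im) (auto simp: closed_segment_eq_real_ivl)
  moreover have "closed_segment (Complex (-5/2) (5/2)) (Complex (-5/2) (-25/2)) =
      {z. Re z = -5/2 \<and> -25/2 \<le> Im z \<and> Im z \<le> 5/2}"
    by (subst closed_segment_same_Re) (auto simp: closed_segment_eq_real_ivl)
  moreover have "closed_segment (Complex (5/2) (25/2)) (Complex (5/2) (-5/2)) =
      {z. Re z = 5/2 \<and> -5/2 \<le> Im z \<and> Im z \<le> 25/2}"
    by (subst closed_segment_same_Re) (auto simp: closed_segment_eq_real_ivl)
  moreover have "closed_segment (Complex (5/2) (-5/2)) (Complex (-25/2) (-5/2)) =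
      {z. Im z = -5/2 \<and> -25/2 \<le> Re z \<and> Re z \<le> 5/2}"
    by (subst closed_segment_same_Im) (auto simp: closed_segment_eq_real_ivl)
  moreover have "grid ` closed_segment (Complex (25/2) (5/2)) (Complex (-5/2) (5/2)) =
      closed_segment 1 ((\<i> - 1) / 4)"
    "grid ` closed_segment (Complex (-5/2) (5/2)) (Complex (-5/2) (-25/2)) =
      closed_segment ((\<i> - 1) / 4) (-\<i>)"
    "grid ` closed_segment (Complex (5/2) (25/2)) (Complex (5/2) (-5/2)) =
      closed_segment \<i> ((1 - \<i>) / 4)"
    "grid ` closed_segment (Complex (5/2) (-5/2)) (Complex (-25/2) (-5/2)) =
      closed_segment ((1 - \<i>) / 4) (-1)"
    by (intro grid_segment; simp add: complex_eq_iff Re_grid Im_grid)+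
  ultimately show ?thesis unfolding R2_crossed_def grid_curve_def by (simp add: image_Un)
qed

abbreviation R2_upper :: complex where "R2_upper \<equiv> Complex (1/6) (1/6)"
abbreviation R2_lower :: complex where "R2_lower \<equiv> Complex (-1/6) (-1/6)"

lemma chart_R2_crossed:
  "chart R2_crossed R2_upper z = grid (grid_crossing + z)"
  "chart R2_crossed R2_lower z = grid (- grid_crossing - \<i> * z)"
  unfolding R2_crossed_def linear_chart_def by (auto simp: complex_eq_iff Re_grid Im_grid) argo+

text \<open>
  The part connected to the boundary of the tangle in which the crossing \<open>R2_loop\<close> is 1-resolved and
  \<open>R2_id\<close> is 0-resolved: two arcs, which run along the strands and cut the corner at the crossing.
\<close>
definition grid_arcs :: "complex set" where
  "grid_arcs = {z. \<bar>coord_sum z\<bar> = max 6 (5 + \<bar>coord_diff z\<bar>) \<and> \<bar>coord_diff z\<bar> \<le> 10}"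

text \<open>
  The small circle of the same resolution: the square between the crossings with two corners cut off.
\<close>
definition grid_loop :: "complex set" where
  "grid_loop =
     closed_segment (Complex (3/2) (5/2)) (Complex (-5/2) (5/2)) \<union>
     closed_segment (Complex (-5/2) (5/2)) (Complex (-5/2) (-3/2)) \<union>
     closed_segment (Complex (-3/2) (-5/2)) (Complex (-5/2) (-3/2)) \<union>
     closed_segment (Complex (-3/2) (-5/2)) (Complex (5/2) (-5/2)) \<union>
     closed_segment (Complex (5/2) (-5/2)) (Complex (5/2) (3/2)) \<union>
     closed_segment (Complex (5/2) (3/2)) (Complex (3/2) (5/2))"

lemma connected_grid_loop: "connected grid_loop"
  unfolding grid_loop_def
  by (intro connected_Un connected_segment)
    (auto simp: disjoint_iff intro: ends_in_segment)

lemma grid_loop_coords: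
  "grid_loop = {z. Im z = 5/2 \<and> -5/2 \<le> Re z \<and> Re z \<le> 3/2} \<union>
     {z. Re z = -5/2 \<and> -3/2 \<le> Im z \<and> Im z \<le> 5/2} \<union>
     {z. Re z + Im z = -4 \<and> -5/2 \<le> Re z \<and> Re z \<le> -3/2} \<union>
     {z. Im z = -5/2 \<and> -3/2 \<le> Re z \<and> Re z \<le> 5/2} \<union>
     {z. Re z = 5/2 \<and> -5/2 \<le> Im z \<and> Im z \<le> 3/2} \<union>
     {z. Re z + Im z = 4 \<and> 3/2 \<le> Re z \<and> Re z \<le> 5/2}"
proof -
  have "closed_segment (Complex (3/2) (5/2)) (Complex (-5/2) (5/2)) =
      {z. Im z = 5/2 \<and> -5/2 \<le> Re z \<and> Re z \<le> 3/2}"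
    "closed_segment (Complex (-3/2) (-5/2)) (Complex (5/2) (-5/2)) =
      {z. Im z = -5/2 \<and> -3/2 \<le> Re z \<and> Re z \<le> 5/2}"
    by (subst closed_segment_same_Im; auto simp: closed_segment_eq_real_ivl)+
  moreover have "closed_segment (Complex (-5/2) (5/2)) (Complex (-5/2) (-3/2)) =
      {z. Re z = -5/2 \<and> -3/2 \<le> Im z \<and> Im z \<le> 5/2}"
    "closed_segment (Complex (5/2) (-5/2)) (Complex (5/2) (3/2)) =
      {z. Re z = 5/2 \<and> -5/2 \<le> Im z \<and> Im z \<le> 3/2}"
    by (subst closed_segment_same_Re; auto simp: closed_segment_eq_real_ivl)+
  moreover have "closed_segment (Complex (-3/2) (-5/2)) (Complex (-5/2) (-3/2)) =
      {z. Re z + Im z = -4 \<and> -5/2 \<le> Re z \<and> Re z \<le> -3/2}"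
    "closed_segment (Complex (5/2) (3/2)) (Complex (3/2) (5/2)) =
      {z. Re z + Im z = 4 \<and> 3/2 \<le> Re z \<and> Re z \<le> 5/2}"
    by (subst closed_segment_antidiagonal; auto)+
  ultimately show ?thesis unfolding grid_loop_def by simp
qed

text \<open>
  This is the equality between the resolved tangle and its description by arcs and loop, point by point:
  the left side lists the four lines of the tangle outside the discs of the crossings, followed by the
  arcs of the resolution in these discs.
\<close>
lemma grid_arith:
  fixes p q :: real
  shows "((q = 5/2 \<and> -5/2 \<le> p \<and> p \<le> 25/2 \<and> \<bar>p - 5/2\<bar> > 1) \<or>
     (p = -5/2 \<and> -25/2 \<le> q \<and> q \<le> 5/2 \<and> \<bar>q + 5/2\<bar> > 1) \<or>
     (p = 5/2 \<and> -5/2 \<le> q \<and> q \<le> 25/2 \<and> \<bar>q - 5/2\<bar> > 1) \<or>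
     (q = -5/2 \<and> -25/2 \<le> p \<and> p \<le> 5/2 \<and> \<bar>p + 5/2\<bar> > 1)) \<or>
     (\<bar>p + q - 5\<bar> = 1 \<and> \<bar>p - q\<bar> \<le> 1) \<or> (\<bar>p + q + 5\<bar> = 1 \<and> \<bar>p - q\<bar> \<le> 1) \<longleftrightarrow>
    (\<bar>p + q\<bar> = max 6 (5 + \<bar>p - q\<bar>) \<and> \<bar>p - q\<bar> \<le> 10) \<or>
    (q = 5/2 \<and> -5/2 \<le> p \<and> p \<le> 3/2) \<or> (p = -5/2 \<and> -3/2 \<le> q \<and> q \<le> 5/2) \<or>
    (p + q = -4 \<and> -5/2 \<le> p \<and> p \<le> -3/2) \<or> (q = -5/2 \<and> -3/2 \<le> p \<and> p \<le> 5/2) \<or>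
    (p = 5/2 \<and> -5/2 \<le> q \<and> q \<le> 3/2) \<or> (p + q = 4 \<and> 3/2 \<le> p \<and> p \<le> 5/2)"
  (is "?L \<longleftrightarrow> ?R")
proof
  assume ?L then show ?R by (elim disjE conjE) (auto simp: max_def abs_if split: if_splits)
next
  assume ?R then show ?L by (elim disjE conjE) (auto simp: max_def abs_if split: if_splits)
qed

text \<open>
  On each line, one of the discs cuts out an interval and the other disc is too far away to meet it.
\<close>
lemma grid_curve_off:
  "z \<in> grid_curve - cball grid_crossing 1 - cball (- grid_crossing) 1 \<longleftrightarrow>
     (Im z = 5/2 \<and> -5/2 \<le> Re z \<and> Re z \<le> 25/2 \<and> \<bar>Re z - 5/2\<bar> > 1) \<or>
     (Re z = -5/2 \<and> -25/2 \<le> Im z \<and> Im z \<le> 5/2 \<and> \<bar>Im z + 5/2\<bar> > 1) \<or>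
     (Re z = 5/2 \<and> -5/2 \<le> Im z \<and> Im z \<le> 25/2 \<and> \<bar>Im z - 5/2\<bar> > 1) \<or>
     (Im z = -5/2 \<and> -25/2 \<le> Re z \<and> Re z \<le> 5/2 \<and> \<bar>Re z + 5/2\<bar> > 1)"
proof -
  have upper: "cmod (z - grid_crossing) \<ge> \<bar>Re z - 5/2\<bar>" "cmod (z - grid_crossing) \<ge> \<bar>Im z - 5/2\<bar>"
    using abs_Re_le_cmod[of "z - grid_crossing"] abs_Im_le_cmod[of "z - grid_crossing"] by simp_all
  have lower: "cmod (z + grid_crossing) \<ge> \<bar>Re z + 5/2\<bar>" "cmod (z + grid_crossing) \<ge> \<bar>Im z + 5/2\<bar>"
    using abs_Re_le_cmod[of "z + grid_crossing"] abs_Im_le_cmod[of "z + grid_crossing"] by simp_all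
  have eqs: "Im z = 5/2 \<Longrightarrow> cmod (z - grid_crossing) = \<bar>Re z - 5/2\<bar>"
    "Re z = 5/2 \<Longrightarrow> cmod (z - grid_crossing) = \<bar>Im z - 5/2\<bar>"
    "Im z = -5/2 \<Longrightarrow> cmod (z + grid_crossing) = \<bar>Re z + 5/2\<bar>"
    "Re z = -5/2 \<Longrightarrow> cmod (z + grid_crossing) = \<bar>Im z + 5/2\<bar>"
    by (simp_all add: cmod_eq_Re cmod_eq_Im)
  have mem: "z \<in> cball grid_crossing 1 \<longleftrightarrow> cmod (z - grid_crossing) \<le> 1"
    "z \<in> cball (- grid_crossing) 1 \<longleftrightarrow> cmod (z + grid_crossing) \<le> 1"
    by (simp_all add: dist_norm norm_minus_commute)
  have "Im z = 5/2 \<Longrightarrow> \<not> cmod (z - grid_crossing) \<le> 1 \<and> \<not> cmod (z + grid_crossing) \<le> 1 \<longleftrightarrow> \<bar>Re z - 5/2\<bar> > 1"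
    "Re z = 5/2 \<Longrightarrow> \<not> cmod (z - grid_crossing) \<le> 1 \<and> \<not> cmod (z + grid_crossing) \<le> 1 \<longleftrightarrow> \<bar>Im z - 5/2\<bar> > 1"
    "Im z = -5/2 \<Longrightarrow> \<not> cmod (z - grid_crossing) \<le> 1 \<and> \<not> cmod (z + grid_crossing) \<le> 1 \<longleftrightarrow> \<bar>Re z + 5/2\<bar> > 1"
    "Re z = -5/2 \<Longrightarrow> \<not> cmod (z - grid_crossing) \<le> 1 \<and> \<not> cmod (z + grid_crossing) \<le> 1 \<longleftrightarrow> \<bar>Im z + 5/2\<bar> > 1"
    using upper lower eqs by auto
  then show ?thesis
    unfolding Diff_iff mem grid_curve_def Un_iff mem_Collect_eq by meson
qed

lemma rotate_res0: "(\<lambda>z. - \<i> * z) ` res0 = res1"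
proof -
  have lin: "linear (\<lambda>z. - \<i> * z)" by (intro linearI) (auto simp: algebra_simps)
  have "(\<lambda>z. - \<i> * z) ` res0 = closed_segment (-\<i>) (-1) \<union> closed_segment 1 \<i>"
    unfolding res0_def image_Un closed_segment_linear_image[OF lin, symmetric] by simp
  then show ?thesis unfolding res1_def by (metis Un_commute closed_segment_commute)
qed

lemma R2_resolved_tangle:
  "curve R2_crossed - chart R2_crossed R2_upper ` cball 0 1 - chart R2_crossed R2_lower ` cball 0 1 \<union>
     chart R2_crossed R2_upper ` res1 \<union> chart R2_crossed R2_lower ` res0 =
   grid ` (grid_arcs \<union> grid_loop)"
proof -
  have upper: "chart R2_crossed R2_upper ` A = grid ` ((+) grid_crossing ` A)" for A
    unfolding image_image chart_R2_crossed ..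
  have lower: "chart R2_crossed R2_lower ` A = grid ` ((+) (- grid_crossing) ` (\<lambda>z. - \<i> * z) ` A)" for A
    unfolding image_image chart_R2_crossed by simp
  have rot: "(\<lambda>z. - \<i> * z) ` cball 0 1 = cball 0 1"
  proof
    show "cball 0 1 \<subseteq> (\<lambda>z. - \<i> * z) ` cball 0 1"
    proof
      fix z :: complex assume "z \<in> cball 0 1"
      then have "z = - \<i> * (\<i> * z)" "\<i> * z \<in> cball 0 1" by (auto simp: norm_mult)
      then show "z \<in> (\<lambda>z. - \<i> * z) ` cball 0 1" by blast
    qed
  qed (auto simp: norm_mult)
  have shift: "(+) c ` A = {z. z - c \<in> A}" for c :: complex and A
    by (auto simp: image_iff) (metis add.commute diff_add_cancel)
  have "z \<in> grid_curve - cball grid_crossing 1 - cball (- grid_crossing) 1 \<union>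
      (+) grid_crossing ` res1 \<union> (+) (- grid_crossing) ` res1 \<longleftrightarrow> z \<in> grid_arcs \<union> grid_loop" for z
    unfolding Un_iff grid_curve_off shift res1_coords grid_arcs_def grid_loop_coords mem_Collect_eq
    using grid_arith[of "Im z" "Re z"]
    by (simp add: coord_sum_def coord_diff_def algebra_simps)
  then have "grid_curve - cball grid_crossing 1 - cball (- grid_crossing) 1 \<union>
      (+) grid_crossing ` res1 \<union> (+) (- grid_crossing) ` res1 = grid_arcs \<union> grid_loop"
    by blast
  moreover have "(+) c ` cball 0 1 = cball c 1" for c :: complex
    using image_add_cball[of c 0 1] by simp
  ultimately show ?thesis
    unfolding upper lower curve_R2_crossed rot rotate_res0
    by (metis (no_types, lifting) image_Un image_set_diff inj_grid)
qed

lemma grid_in_cball: "\<bar>coord_sum z\<bar> \<le> 15 \<Longrightarrow> \<bar>coord_diff z\<bar> \<le> 10 \<Longrightarrow> grid z \<in> cball 0 1"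
proof -
  assume "\<bar>coord_sum z\<bar> \<le> 15" "\<bar>coord_diff z\<bar> \<le> 10"
  then have "\<bar>coord_sum (grid z)\<bar> \<le> 1" "\<bar>coord_diff (grid z)\<bar> \<le> 1"
    unfolding coord_sum_grid coord_diff_grid by auto
  then have "(coord_sum (grid z))\<^sup>2 \<le> 1" "(coord_diff (grid z))\<^sup>2 \<le> 1"
    by (simp_all add: abs_square_le_1)
  then have "(cmod (grid z))\<^sup>2 \<le> 1" using coord_norm[of "grid z"] by linarith
  then show ?thesis by (simp add: abs_square_le_1)
qed

lemma mem_grid_arcs: "x \<in> grid ` grid_arcs \<longleftrightarrow>
  \<bar>coord_sum x\<bar> = max (2/5) (1/3 + 2/3 * \<bar>coord_diff x\<bar>) \<and> \<bar>coord_diff x\<bar> \<le> 1"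
proof -
  obtain z where x: "x = grid z" using surj_grid by blast
  then have "x \<in> grid ` grid_arcs \<longleftrightarrow> z \<in> grid_arcs" using inj_grid by (auto dest: injD)
  moreover have "max (2/5) (1/3 + 2/3 * \<bar>d / 10\<bar>) = max 6 (5 + \<bar>d\<bar>) / 15" for d :: real
    unfolding abs_divide max_def by (simp add: field_simps)
  ultimately show ?thesis unfolding x grid_arcs_def mem_Collect_eq coord_sum_grid coord_diff_grid
    by (simp add: abs_divide)
qed

lemma grid_loop_bounds:
  assumes "x \<in> grid ` grid_loop"
  shows "\<bar>coord_sum x\<bar> \<le> 4/15" "\<bar>coord_diff x\<bar> \<le> 1/2"
proof -
  obtain z where z: "x = grid z" "z \<in> grid_loop" using assms by blast
  from z(2) have "\<bar>coord_sum z\<bar> \<le> 4" "\<bar>coord_diff z\<bar> \<le> 5"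
    unfolding grid_loop_coords coord_sum_def coord_diff_def by auto
  then show "\<bar>coord_sum x\<bar> \<le> 4/15" "\<bar>coord_diff x\<bar> \<le> 1/2"
    unfolding z(1) coord_sum_grid coord_diff_grid by simp_all
qed

abbreviation R2_strands :: "complex set" where
  "R2_strands \<equiv> grid ` (grid_arcs \<union> grid_loop)"

lemma R2_strands_subset: "R2_strands \<subseteq> cball 0 1"
proof
  fix x assume "x \<in> R2_strands"
  then obtain z where z: "x = grid z" "z \<in> grid_arcs \<or> z \<in> grid_loop" by blast
  have "\<bar>coord_sum z\<bar> \<le> 15 \<and> \<bar>coord_diff z\<bar> \<le> 10"
    using z(2)
  proof
    assume "z \<in> grid_arcs" then show ?thesis unfolding grid_arcs_def by auto
  next
    assume "z \<in> grid_loop"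
    then show ?thesis unfolding grid_loop_coords coord_sum_def coord_diff_def by auto
  qed
  then show "x \<in> cball 0 1" unfolding z(1) by (blast intro: grid_in_cball)
qed

lemma R2_crossed_subset:
  "curve R2_crossed \<subseteq> cball 0 1"
  "chart R2_crossed R2_upper ` cball 0 1 \<subseteq> cball 0 1"
  "chart R2_crossed R2_lower ` cball 0 1 \<subseteq> cball 0 1"
proof -
  show "curve R2_crossed \<subseteq> cball 0 1"
    unfolding curve_R2_crossed
  proof (rule image_subsetI, rule grid_in_cball)
    fix z assume "z \<in> grid_curve"
    then show "\<bar>coord_sum z\<bar> \<le> 15" "\<bar>coord_diff z\<bar> \<le> 10"
      unfolding grid_curve_def coord_sum_def coord_diff_def by auto
  qed
  have bounds: "\<bar>Re z\<bar> \<le> 1" "\<bar>Im z\<bar> \<le> 1" if "z \<in> cball 0 1" for z :: complex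
    using that abs_Re_le_cmod[of z] abs_Im_le_cmod[of z] by auto
  show "chart R2_crossed R2_upper ` cball 0 1 \<subseteq> cball 0 1"
  proof (rule image_subsetI, unfold chart_R2_crossed, rule grid_in_cball)
    fix z :: complex assume "z \<in> cball 0 1"
    then show "\<bar>coord_sum (grid_crossing + z)\<bar> \<le> 15" "\<bar>coord_diff (grid_crossing + z)\<bar> \<le> 10"
      using bounds[of z] unfolding coord_sum_def coord_diff_def plus_complex.sel complex.sel by argo+
  qed
  show "chart R2_crossed R2_lower ` cball 0 1 \<subseteq> cball 0 1"
  proof (rule image_subsetI, unfold chart_R2_crossed, rule grid_in_cball)
    fix z :: complex assume "z \<in> cball 0 1"
    moreover have "Re (- grid_crossing - \<i> * z) = -5/2 + Im z" "Im (- grid_crossing - \<i> * z) = -5/2 - Re z"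
      by simp_all
    ultimately show "\<bar>coord_sum (- grid_crossing - \<i> * z)\<bar> \<le> 15"
      "\<bar>coord_diff (- grid_crossing - \<i> * z)\<bar> \<le> 10"
      using bounds[of z] unfolding coord_sum_def coord_diff_def by argo+
  qed
qed

text \<open>
  Moves the strands to \<open>res1\<close>, keeping \<open>coord_diff\<close>. The value of \<open>coord_sum\<close> is at least 2/5 on the first
  arc, at most -2/5 on the second one, and at least -4/15 on the loop, so the cut-off linear function
  is 1, -1 and 1 there: the loop is carried to the first arc, which keeps the map continuous everywhere.
\<close>
definition R2_straighten :: "complex \<Rightarrow> complex" where
  "R2_straighten z = coord_point (max (-1) (min 1 (15 * coord_sum z + 5))) (coord_diff z)"

text \<open>
  Moves \<open>res1\<close> to the arcs of the resolved tangle, keeping \<open>coord_diff\<close>; compare \<open>mem_grid_arcs\<close>.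
\<close>
definition R2_bend :: "complex \<Rightarrow> complex" where
  "R2_bend z = coord_point (coord_sum z * max (2/5) (1/3 + 2/3 * \<bar>coord_diff z\<bar>)) (coord_diff z)"

lemma continuous_R2_straighten: "continuous_on A R2_straighten"
  and continuous_R2_bend: "continuous_on A R2_bend"
  unfolding R2_straighten_def R2_bend_def coord_point_def coord_sum_def coord_diff_def Complex_eq
  by (intro continuous_intros continuous_on_max continuous_on_min; simp)+

lemma R2_straighten_strands: "R2_straighten ` R2_strands \<subseteq> res1"
proof
  fix y assume "y \<in> R2_straighten ` R2_strands"
  then obtain x where x: "y = R2_straighten x" "x \<in> grid ` grid_arcs \<or> x \<in> grid ` grid_loop"
    by blast
  from x(2) have "\<bar>max (-1) (min 1 (15 * coord_sum x + 5))\<bar> = 1 \<and> \<bar>coord_diff x\<bar> \<le> 1"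
  proof
    assume "x \<in> grid ` grid_arcs"
    then have "\<bar>coord_sum x\<bar> \<ge> 2/5" "\<bar>coord_diff x\<bar> \<le> 1" unfolding mem_grid_arcs by auto
    then show ?thesis by (auto simp: abs_if max_def min_def split: if_splits)
  next
    assume "x \<in> grid ` grid_loop"
    then show ?thesis using grid_loop_bounds[of x] by (auto simp: abs_if max_def min_def split: if_splits)
  qed
  then show "y \<in> res1" unfolding x(1) res1_coords R2_straighten_def by simp
qed

lemma R2_bend_res1: "R2_bend ` res1 \<subseteq> grid ` grid_arcs"
proof
  fix y assume "y \<in> R2_bend ` res1"
  then obtain x where x: "y = R2_bend x" "\<bar>coord_sum x\<bar> = 1" "\<bar>coord_diff x\<bar> \<le> 1"
    unfolding res1_coords by blast
  have "\<bar>coord_sum x * max (2/5) (1/3 + 2/3 * \<bar>coord_diff x\<bar>)\<bar> =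
      max (2/5) (1/3 + 2/3 * \<bar>coord_diff x\<bar>)"
    unfolding abs_mult x(2) by simp
  then show "y \<in> grid ` grid_arcs" unfolding x(1) mem_grid_arcs R2_bend_def using x(3) by simp
qed

text \<open>
  In these coordinates the unit circle has the equation \<open>s\<^sup>2 + d\<^sup>2 = 2\<close>.
\<close>
lemma coord_sphere:
  assumes "cmod z = 1" "\<bar>coord_sum z\<bar> \<le> 1" "\<bar>coord_diff z\<bar> \<le> 1"
  shows "\<bar>coord_sum z\<bar> = 1" "\<bar>coord_diff z\<bar> = 1"
proof -
  have "(coord_sum z)\<^sup>2 \<le> 1" "(coord_diff z)\<^sup>2 \<le> 1" using assms(2,3) by (simp_all add: abs_square_le_1)
  then have "(coord_sum z)\<^sup>2 = 1" "(coord_diff z)\<^sup>2 = 1" using coord_norm[of z] assms(1) by simp_all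
  then show "\<bar>coord_sum z\<bar> = 1" "\<bar>coord_diff z\<bar> = 1" by (simp_all add: abs_square_eq_1)
qed

lemma R2_bend_sphere: "z \<in> res1 \<Longrightarrow> cmod z = 1 \<Longrightarrow> R2_bend z = z"
  using coord_sphere(2)[of z] unfolding res1_coords R2_bend_def by (intro coord_point_eqI) auto

lemma R2_straighten_sphere:
  assumes "z \<in> R2_strands" "cmod z = 1"
  shows "R2_straighten z = z"
proof -
  have le: "\<bar>coord_sum z\<bar> \<le> 1 \<and> \<bar>coord_diff z\<bar> \<le> 1"
    using assms(1) grid_loop_bounds[of z] mem_grid_arcs[of z] unfolding image_Un by auto
  then have "\<bar>coord_sum z\<bar> = 1" using coord_sphere(1) assms(2) by blast
  then have "max (-1) (min 1 (15 * coord_sum z + 5)) = coord_sum z"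
    by (auto simp: abs_if split: if_splits)
  then show ?thesis unfolding R2_straighten_def by (intro coord_point_eqI) simp_all
qed

lemma has_tangle_chart:
  "has_tangle \<beta> M D \<Longrightarrow> m \<in> xings M \<Longrightarrow>
     \<exists>\<sigma>\<in>{1, -1}. \<forall>z\<in>cball 0 1. chart D (\<beta> m) z = \<beta> (chart M m (\<sigma> * z))"
  unfolding has_tangle_def by (elim conjE) (erule(1) bspec)

text \<open>
  The discs of the two crossings are the images of those of the model, and the discs of all other crossings
  miss the disc of the move. So the resolved diagram is the image of the resolved model. The sign that
  a chart may differ by is absorbed by the symmetry of the disc and of the two resolutions.
\<close>
lemma R2_strands_resolution:
  assumes lc: "disc_chart \<beta>" "has_tangle \<beta> R2_crossed D'" "agree_outside (disc \<beta>) D' D"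
    and v: "v \<inter> disc \<beta> = {}"
  shows "resolution D' (insert (R2_loop \<beta>) v) \<inter> disc \<beta> = \<beta> ` R2_strands"
proof -
  let ?Z = "disc \<beta>"
  let ?w = "insert (R2_loop \<beta>) v"
  have inj: "inj_on \<beta> (cball 0 1)" using lc(1) unfolding disc_chart_def by blast
  have m: "R2_upper \<in> cball 0 1" "R2_lower \<in> cball 0 1"
    by (simp_all add: norm_complex_def real_sqrt_le_1_iff power2_eq_square)
  have ne: "\<beta> R2_upper \<noteq> \<beta> R2_lower"
    using inj_onD[OF inj _ m] by auto
  have xings: "xings D' \<inter> ?Z = {\<beta> R2_upper, \<beta> R2_lower}"
    using has_tangle_xings[OF lc(2)] by (simp add: R2_crossed_def)
  have chart: "chart D' (\<beta> m) ` A = \<beta> ` chart R2_crossed m ` A"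
    if "m \<in> {R2_upper, R2_lower}" "A \<subseteq> cball 0 1" "uminus ` A = A" for m A
  proof -
    have "m \<in> xings R2_crossed" using that(1) unfolding R2_crossed_def by simp
    with lc(2) have "\<exists>\<sigma>\<in>{1, -1}. \<forall>z\<in>cball 0 1.
        chart D' (\<beta> m) z = \<beta> (chart R2_crossed m (\<sigma> * z))"
      by (rule has_tangle_chart)
    then obtain \<sigma> :: complex where \<sigma>: "\<sigma> \<in> {1, -1}"
      "\<And>z. z \<in> cball 0 1 \<Longrightarrow> chart D' (\<beta> m) z = \<beta> (chart R2_crossed m (\<sigma> * z))"
      by (elim bexE) simp
    have eq: "(\<lambda>z. \<sigma> * z) ` A = A" using \<sigma>(1) that(3) by auto
    have "chart D' (\<beta> m) ` A = (\<lambda>z. \<beta> (chart R2_crossed m (\<sigma> * z))) ` A"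
      using \<sigma>(2) that(2) by (intro image_cong) auto
    also have "\<dots> = \<beta> ` chart R2_crossed m ` (\<lambda>z. \<sigma> * z) ` A" unfolding image_image ..
    finally show ?thesis unfolding eq .
  qed
  have sym: "uminus ` res0 = res0" "uminus ` res1 = res1" "uminus ` cball 0 1 = (cball 0 1 :: complex set)"
  proof -
    have lin: "linear (uminus :: complex \<Rightarrow> complex)" by (intro linearI) simp_all
    have "uminus ` res0 = closed_segment (-1) \<i> \<union> closed_segment (-\<i>) 1"
      unfolding res0_def image_Un closed_segment_linear_image[OF lin, symmetric] by simp
    then show "uminus ` res0 = res0"
      unfolding res0_def by (metis Un_commute closed_segment_commute)
    have "uminus ` res1 = closed_segment (-1) (-\<i>) \<union> closed_segment 1 \<i>"
      unfolding res1_def image_Un closed_segment_linear_image[OF lin, symmetric] by simp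
    then show "uminus ` res1 = res1"
      unfolding res1_def by (rule trans) (rule Un_commute)
    show "uminus ` cball 0 1 = (cball 0 1 :: complex set)"
    proof
      show "cball 0 1 \<subseteq> uminus ` (cball 0 1 :: complex set)"
      proof
        fix z :: complex assume "z \<in> cball 0 1"
        then show "z \<in> uminus ` cball 0 1" by (intro image_eqI[of _ _ "- z"]) auto
      qed
    qed auto
  qed
  let ?arcs = "\<lambda>x. chart D' x ` (if x \<in> ?w then res1 else res0)"
  have far: "disc (chart D' x) \<inter> ?Z = {}" if "x \<in> xings D' - ?Z" for x
    using agree_outside_far[OF lc(3) that] .
  have arcs: "?arcs x \<subseteq> disc (chart D' x)" for x using res0_subset res1_subset by auto
  have split: "(\<Union>x\<in>xings D'. A x) \<inter> ?Z = (A (\<beta> R2_upper) \<inter> ?Z) \<union> (A (\<beta> R2_lower) \<inter> ?Z)"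
    if "\<And>x. x \<in> xings D' - ?Z \<Longrightarrow> A x \<inter> ?Z = {}" for A
  proof -
    have "xings D' = {\<beta> R2_upper, \<beta> R2_lower} \<union> (xings D' - ?Z)"
      unfolding xings[symmetric] by (rule Int_Diff_Un[symmetric])
    moreover have "(\<Union>x\<in>{p, q} \<union> X. A x) = A p \<union> A q \<union> (\<Union>x\<in>X. A x)" for p q X by auto
    ultimately have "(\<Union>x\<in>xings D'. A x) = A (\<beta> R2_upper) \<union> A (\<beta> R2_lower) \<union> (\<Union>x\<in>xings D' - ?Z. A x)"
      by metis
    moreover have "(\<Union>x\<in>xings D' - ?Z. A x) \<inter> ?Z = {}" using that by blast
    ultimately show ?thesis by blast
  qed
  have upper: "disc (chart D' (\<beta> R2_upper)) = \<beta> ` chart R2_crossed R2_upper ` cball 0 1"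
    and lower: "disc (chart D' (\<beta> R2_lower)) = \<beta> ` chart R2_crossed R2_lower ` cball 0 1"
    using chart sym(3) by simp_all
  have "\<beta> R2_lower \<notin> ?w"
    using v m(2) ne unfolding R2_loop_def by auto
  then have arcs_eq: "?arcs (\<beta> R2_upper) = \<beta> ` chart R2_crossed R2_upper ` res1"
    "?arcs (\<beta> R2_lower) = \<beta> ` chart R2_crossed R2_lower ` res0"
    using chart[OF _ res1_subset sym(2)] chart[OF _ res0_subset sym(1)] by (simp_all add: R2_loop_def)
  have discs: "(\<Union>x\<in>xings D'. disc (chart D' x)) \<inter> ?Z =
      \<beta> ` chart R2_crossed R2_upper ` cball 0 1 \<union> \<beta> ` chart R2_crossed R2_lower ` cball 0 1"
    using split[of "\<lambda>x. disc (chart D' x)", OF far] image_mono[OF R2_crossed_subset(2), of \<beta>]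
      image_mono[OF R2_crossed_subset(3), of \<beta>]
    unfolding upper lower by (simp only: Int_absorb2)
  have "?arcs x \<inter> ?Z = {}" if "x \<in> xings D' - ?Z" for x using far[OF that] arcs[of x] by blast
  from split[of ?arcs, OF this]
  have arcs_Z: "(\<Union>x\<in>xings D'. ?arcs x) \<inter> ?Z =
      \<beta> ` chart R2_crossed R2_upper ` res1 \<union> \<beta> ` chart R2_crossed R2_lower ` res0"
    using subset_trans[OF arcs[of "\<beta> R2_upper", unfolded arcs_eq upper] image_mono[OF R2_crossed_subset(2)]]
      subset_trans[OF arcs[of "\<beta> R2_lower", unfolded arcs_eq lower] image_mono[OF R2_crossed_subset(3)]]
    unfolding arcs_eq by (simp only: Int_absorb2)
  have "(C - U \<union> V) \<inter> Z = (C \<inter> Z - (U \<inter> Z)) \<union> (V \<inter> Z)" for C U V Z :: "complex set" by blast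
  then have "resolution D' ?w \<inter> ?Z = (curve D' \<inter> ?Z - (\<Union>x\<in>xings D'. disc (chart D' x)) \<inter> ?Z) \<union>
      (\<Union>x\<in>xings D'. ?arcs x) \<inter> ?Z"
    unfolding resolution_def by blast
  also have "\<dots> = \<beta> ` (curve R2_crossed - (chart R2_crossed R2_upper ` cball 0 1 \<union>
      chart R2_crossed R2_lower ` cball 0 1)) \<union>
      (\<beta> ` chart R2_crossed R2_upper ` res1 \<union> \<beta> ` chart R2_crossed R2_lower ` res0)"
  proof -
    let ?U = "chart R2_crossed R2_upper ` cball 0 1 \<union> chart R2_crossed R2_lower ` cball 0 1"
    have "curve R2_crossed - ?U \<subseteq> cball 0 1" using R2_crossed_subset(1) by blast
    moreover have "?U \<subseteq> cball 0 1" using R2_crossed_subset(2,3) by (rule Un_least)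
    ultimately have "\<beta> ` (curve R2_crossed - ?U) = \<beta> ` curve R2_crossed - \<beta> ` ?U"
      by (rule inj_on_image_set_diff[OF inj])
    then show ?thesis unfolding discs arcs_Z has_tangle_curve[OF lc(2)] by (simp only: image_Un)
  qed
  also have "\<dots> = \<beta> ` R2_strands"
    unfolding R2_resolved_tangle[symmetric] image_Un[symmetric] Un_assoc Diff_eq Int_assoc by (simp add: Compl_Un)
  finally show ?thesis .
qed

lemma R2_xings:
  assumes "disc_chart \<beta>" "has_tangle \<beta> (uncrossed res0) D" "has_tangle \<beta> R2_crossed D'"
    and "agree_outside (disc \<beta>) D D'"
  shows "xings D' = insert (R2_loop \<beta>) (insert (R2_id \<beta>) (xings D))"
    and "R2_loop \<beta> \<noteq> R2_id \<beta>" "R2_loop \<beta> \<notin> xings D" "R2_id \<beta> \<notin> xings D"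
proof -
  have m: "R2_upper \<in> cball 0 1" "R2_lower \<in> cball 0 1"
    by (simp_all add: norm_complex_def real_sqrt_le_1_iff power2_eq_square)
  then have in_disc: "R2_loop \<beta> \<in> disc \<beta>" "R2_id \<beta> \<in> disc \<beta>"
    unfolding R2_loop_def R2_id_def by blast+
  have empty: "xings D \<inter> disc \<beta> = {}" using xings_uncrossed[OF assms(2)] .
  have two: "xings D' \<inter> disc \<beta> = {R2_loop \<beta>, R2_id \<beta>}"
    using has_tangle_xings[OF assms(3)] by (simp add: R2_crossed_def R2_loop_def R2_id_def)
  have "inj_on \<beta> (cball 0 1)" using assms(1) unfolding disc_chart_def by blast
  then show "R2_loop \<beta> \<noteq> R2_id \<beta>"
    using inj_onD[OF _ _ m] unfolding R2_loop_def R2_id_def by auto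
  show "R2_loop \<beta> \<notin> xings D" "R2_id \<beta> \<notin> xings D" using in_disc empty by blast+
  have "X' = insert a (insert b X)" if "X \<inter> Z = {}" "X' \<inter> Z = {a, b}" "X - Z = X' - Z"
    for X X' Z :: "complex set" and a b using that by blast
  then show "xings D' = insert (R2_loop \<beta>) (insert (R2_id \<beta>) (xings D))"
    using empty two agree_outside_xings[OF assms(4)] by meson
qed

lemma R2_discs:
  assumes "has_tangle \<beta> R2_crossed D'" "x \<in> xings D' \<inter> disc \<beta>"
  shows "disc (chart D' x) \<subseteq> disc \<beta>"
proof -
  obtain m where m: "m \<in> xings R2_crossed" "x = \<beta> m"
    using assms(2) unfolding has_tangle_xings[OF assms(1)] by blast
  have "\<exists>\<sigma>\<in>{1, -1}. \<forall>z\<in>cball 0 1. chart D' (\<beta> m) z = \<beta> (chart R2_crossed m (\<sigma> * z))"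
    using assms(1) m(1) by (rule has_tangle_chart)
  then obtain \<sigma> :: complex where \<sigma>: "\<sigma> \<in> {1, -1}"
    "\<And>z. z \<in> cball 0 1 \<Longrightarrow> chart D' (\<beta> m) z = \<beta> (chart R2_crossed m (\<sigma> * z))"
    by (elim bexE) simp
  have "m = R2_upper \<or> m = R2_lower" using m(1) unfolding R2_crossed_def by simp
  then have "chart R2_crossed m (\<sigma> * z) \<in> cball 0 1" if "z \<in> cball 0 1" for z
    using R2_crossed_subset(2,3) that \<sigma>(1) by (auto simp: image_subset_iff norm_mult)
  then show ?thesis unfolding m(2) using \<sigma>(2) by auto
qed

text \<open>
  The diagram \<open>R2_saddled \<beta> D v\<close> need not be a resolution of \<open>D\<close> or \<open>D'\<close>, so it is not known beforehand that it
  has finitely many components. It arises from the resolution \<open>S'\<close> of \<open>D'\<close> by straightening the strands and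
  dropping the loop. A circle of \<open>S'\<close> other than the loop has to leave the disc: otherwise it would
  be contained in one of the two arcs, on which \<open>coord_diff\<close> is injective.
\<close>
lemma R2_saddled_circles:
  assumes "link_diagram D" "link_diagram D'" "local_change \<beta> (uncrossed res0) R2_crossed D D'"
    and v: "v \<subseteq> xings D"
  defines "S' \<equiv> resolution D' (insert (R2_loop \<beta>) v)"
  defines "O' \<equiv> connected_component_set S' (\<beta> ((\<i> - 1) / 4))"
  shows "finite (components (R2_saddled \<beta> D v))"
    and "\<And>a. a \<in> components S' \<Longrightarrow> a \<noteq> O' \<Longrightarrow>
      follow (disc \<beta>) (R2_saddled \<beta> D v) a \<in> components (R2_saddled \<beta> D v)"
proof -
  let ?Z = "disc \<beta>"
  define S where "S = R2_saddled \<beta> D v"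
  have lc: "disc_chart \<beta>" "has_tangle \<beta> (uncrossed res0) D" "has_tangle \<beta> R2_crossed D'"
    "agree_outside ?Z D D'"
    using assms(3) unfolding local_change_def by blast+
  have \<beta>: "continuous_on (cball 0 1) \<beta>" "inj_on \<beta> (cball 0 1)"
    using lc(1) unfolding disc_chart_def by blast+
  have empty: "xings D \<inter> ?Z = {}" using xings_uncrossed[OF lc(2)] .
  have S'_in: "S' \<inter> ?Z = \<beta> ` R2_strands"
  proof -
    have "v \<inter> ?Z = {}" using v empty by blast
    then show ?thesis
      unfolding S'_def by (rule R2_strands_resolution[OF lc(1,3) agree_outside_sym[OF lc(4)]])
  qed
  have "\<beta> ` res1 \<subseteq> ?Z" using res1_subset by blast
  moreover have "(R - Z \<union> B) \<inter> Z = B" "(R - Z \<union> B) - Z = R - Z" if "B \<subseteq> Z" for R Z B :: "complex set"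
    using that by blast+
  ultimately have S_in: "S \<inter> ?Z = \<beta> ` res1" and S_off: "S - ?Z = resolution D v - ?Z"
    unfolding S_def R2_saddled_def by simp_all
  have "R2_loop \<beta> \<in> ?Z"
    unfolding R2_loop_def by (simp add: norm_complex_def real_sqrt_le_1_iff power2_eq_square)
  then have "v - ?Z = insert (R2_loop \<beta>) v - ?Z" by blast
  then have off: "S - ?Z = S' - ?Z"
    unfolding S_off S'_def using empty R2_discs[OF lc(3)]
    by (intro resolution_agree_outside lc(4)) blast+
  have arcs_sub: "grid ` grid_arcs \<subseteq> R2_strands" by blast
  obtain r where r: "continuous_on S r" "r ` S \<subseteq> S'" "\<And>z. z \<in> S - ?Z \<Longrightarrow> r z = z"
  proof (rule tangle_map_extends[OF lc(1) res1_subset R2_strands_subset continuous_R2_bend])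
    show "R2_bend ` res1 \<subseteq> R2_strands" using R2_bend_res1 arcs_sub by blast
    show "\<beta> ` R2_strands \<subseteq> S'" using S'_in by blast
    show "S - ?Z \<subseteq> S'" using off by blast
  qed (use R2_bend_sphere S_in in auto)
  obtain r' where r': "continuous_on S' r'" "r' ` S' \<subseteq> S" "\<And>z. z \<in> S' - ?Z \<Longrightarrow> r' z = z"
  proof (rule tangle_map_extends[OF lc(1) R2_strands_subset res1_subset continuous_R2_straighten
        R2_straighten_strands])
    show "\<beta> ` res1 \<subseteq> S" using S_in by blast
    show "S' - ?Z \<subseteq> S" using off by blast
  qed (use R2_straighten_sphere S'_in in auto)
  have S'_manifold: "closed_1_manifold S'"
    unfolding S'_def
    using R2_xings(1)[OF lc] v by (intro link_diagram_resolution[OF assms(2)]) blast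
  then have fin: "finite (components S')" unfolding closed_1_manifold_def by blast
  show "finite (components (R2_saddled \<beta> D v))"
    unfolding S_def[symmetric]
  proof (rule finite_components_transfer[OF fin])
    show "\<exists>a\<in>components S'. a - ?Z = b - ?Z" if "b \<in> components S" "b - ?Z \<noteq> {}" for b
      using component_transfer[OF r' r that] .
    show "S \<inter> ?Z \<subseteq> \<beta> ` closed_segment 1 \<i> \<union> \<beta> ` closed_segment (-1) (-\<i>)"
      unfolding S_in res1_def by blast
    have "closed_segment 1 \<i> \<subseteq> res1" "closed_segment (-1) (-\<i>) \<subseteq> res1"
      unfolding res1_def by auto
    then show "\<beta> ` closed_segment 1 \<i> \<subseteq> S" "\<beta> ` closed_segment (-1) (-\<i>) \<subseteq> S"
      "connected (\<beta> ` closed_segment 1 \<i>)" "connected (\<beta> ` closed_segment (-1) (-\<i>))"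
      using S_in res1_subset
      by (blast intro: connected_continuous_image continuous_on_subset[OF \<beta>(1)] connected_segment)+
  qed
  obtain \<gamma> where \<gamma>: "homeomorphism (cball 0 1) ?Z \<beta> \<gamma>"
    using homeomorphism_compact[OF compact_cball \<beta>(1) refl \<beta>(2)] by blast
  fix a assume a: "a \<in> components S'" "a \<noteq> O'"
  have a_conn: "connected a" "a \<subseteq> S'"
    using in_components_connected[OF a(1)] in_components_subset[OF a(1)] by auto
  have "a - ?Z \<noteq> {}"
  proof
    assume "a - ?Z = {}"
    then have sub: "a \<subseteq> ?Z" by blast
    have loop: "connected (\<beta> ` grid ` grid_loop)" "\<beta> ` grid ` grid_loop \<subseteq> S'"
    proof -
      have "connected (grid ` grid_loop)"
        using connected_grid_loop linear_continuous_on linear_grid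
        by (blast intro: connected_continuous_image linear_continuous_on linear_conv_bounded_linear[THEN iffD1])
      then show "connected (\<beta> ` grid ` grid_loop)"
        using R2_strands_subset
        by (intro connected_continuous_image[OF continuous_on_subset[OF \<beta>(1)]]) auto
      show "\<beta> ` grid ` grid_loop \<subseteq> S'" using S'_in by blast
    qed
    have "Complex (-5/2) (5/2) \<in> grid_loop" unfolding grid_loop_coords by simp
    moreover have "grid (Complex (-5/2) (5/2)) = (\<i> - 1) / 4" by (simp add: complex_eq_iff Re_grid Im_grid)
    ultimately have "\<beta> ((\<i> - 1) / 4) \<in> \<beta> ` grid ` grid_loop" by (metis imageI)
    then have "\<beta> ` grid ` grid_loop \<subseteq> O'" "\<beta> ((\<i> - 1) / 4) \<in> S'"
      using connected_component_maximal[OF _ loop] loop(2) unfolding O'_def by blast+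
    moreover have "O' \<in> components S'"
      using \<open>\<beta> ((\<i> - 1) / 4) \<in> S'\<close> unfolding O'_def components_def by blast
    ultimately have "\<beta> ` grid ` grid_loop \<subseteq> O'" "O' \<in> components S'" by blast+
    then have disj: "a \<inter> \<beta> ` grid ` grid_loop = {}" using components_nonoverlap[OF a(1), of O'] a(2) by blast
    have \<gamma>_arcs: "\<gamma> x \<in> grid ` grid_arcs" if "x \<in> a" for x
    proof -
      have "x \<in> S' \<inter> ?Z" using that sub a_conn(2) by blast
      then obtain z where z: "x = \<beta> z" "z \<in> R2_strands" unfolding S'_in by (rule imageE)
      then have "\<gamma> x = z"
        using homeomorphism_apply1[OF \<gamma> subsetD[OF R2_strands_subset z(2)]] by simp
      moreover have "z \<notin> grid ` grid_loop"
      proof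
        assume "z \<in> grid ` grid_loop"
        then have "x \<in> \<beta> ` grid ` grid_loop" unfolding z(1) by (rule imageI)
        then show False using that disj by blast
      qed
      ultimately show ?thesis using z(2) unfolding image_Un by simp
    qed
    have \<gamma>_cont: "continuous_on a \<gamma>"
      using homeomorphism_cont2[OF \<gamma>] sub by (rule continuous_on_subset)
    have cont: "continuous_on a (\<lambda>x. coord_sum (\<gamma> x))" "continuous_on a (\<lambda>x. coord_diff (\<gamma> x))"
      unfolding coord_sum_def coord_diff_def by (intro continuous_intros \<gamma>_cont)+
    have "is_interval ((\<lambda>x. coord_sum (\<gamma> x)) ` a)"
      using connected_continuous_image[OF cont(1) a_conn(1)] is_interval_connected_1 by blast
    moreover have nonzero: "coord_sum (\<gamma> x) \<noteq> 0" if "x \<in> a" for x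
      using \<gamma>_arcs[OF that] unfolding mem_grid_arcs by auto
    \<comment> \<open>A connected subset of the two arcs lies in one of them, since \<open>coord_sum\<close> does not vanish there.\<close>
    ultimately have same_sign: "0 < coord_sum (\<gamma> x) \<longleftrightarrow> 0 < coord_sum (\<gamma> y)" if "x \<in> a" "y \<in> a" for x y
      using that unfolding is_interval_1 by (smt (verit, best) imageE imageI)
    have "inj_on (\<lambda>x. coord_diff (\<gamma> x)) a"
    proof (rule inj_onI)
      fix x y assume xy: "x \<in> a" "y \<in> a" "coord_diff (\<gamma> x) = coord_diff (\<gamma> y)"
      then have "\<bar>coord_sum (\<gamma> x)\<bar> = \<bar>coord_sum (\<gamma> y)\<bar>"
        using \<gamma>_arcs unfolding mem_grid_arcs by metis
      then have "coord_sum (\<gamma> x) = coord_sum (\<gamma> y)" using same_sign[OF xy(1,2)] nonzero xy(1,2) by (smt (verit))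
      then have "\<gamma> x = \<gamma> y" using xy(3) coord_point_eqI by metis
      then show "x = y" using homeomorphism_apply2[OF \<gamma>] xy(1,2) sub by (metis subsetD)
    qed
    then show False
      using not_homeomorphic_circle[OF _ a_conn(1) cont(2)] S'_manifold a(1)
      unfolding closed_1_manifold_def by blast
  qed
  obtain b where "b \<in> components S" "b - ?Z = a - ?Z"
    using component_transfer[OF r r' a(1) \<open>a - ?Z \<noteq> {}\<close>] by (rule bexE)
  then show "follow ?Z (R2_saddled \<beta> D v) a \<in> components (R2_saddled \<beta> D v)"
    unfolding S_def[symmetric] using \<open>a - ?Z \<noteq> {}\<close> by (rule follow_component)
qed

text \<open>
  The component that passes through the saddled diagram is a composite of a saddle map and a pushforward
  on the circles of that diagram. It commutes with the augmentation because the saddle map ends in the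
  exterior algebra on these circles, and they are finite in number.
\<close>
lemma natural_R2_add:
  assumes "link_diagram D" "link_diagram D'" "\<And>\<psi>. \<psi> \<in> chains D \<Longrightarrow> f \<psi> \<in> chains D'"
    and "local_change \<beta> (uncrossed res0) R2_crossed D D'" "R2_add \<beta> D D' f"
  shows "natural D D' f"
proof (rule naturalI[OF assms(1,3)])
  have lc: "disc_chart \<beta>" "has_tangle \<beta> (uncrossed res0) D" "has_tangle \<beta> R2_crossed D'"
    "agree_outside (disc \<beta>) D D'"
    using assms(4) unfolding local_change_def by blast+
  note xings = R2_xings[OF lc]
  define w where "w v = insert (R2_id \<beta>) v" for v
  define w' where "w' v = insert (R2_loop \<beta>) v" for v
  define S where "S v = R2_saddled \<beta> D v" for v
  obtain \<eta> \<eta>' where f: "\<forall>\<psi>\<in>chains D. \<forall>v\<subseteq>xings D.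
      f \<psi> (w v) = scale (\<eta> v) (push (follow (disc \<beta>) (resolution D' (w v))) (circles D v) (\<psi> v)) \<and>
      f \<psi> (w' v) = scale (\<eta>' v) (push (follow (disc \<beta>) (resolution D' (w' v))) (components (S v))
        (saddle \<beta> (resolution D v) (S v) (\<psi> v))) \<and>
      f \<psi> v = 0 \<and> f \<psi> (w (w' v)) = 0"
    using assms(5)[unfolded R2_add_def Let_def, folded w_def w'_def S_def]
    by (elim exE conjE) (rule that)
  fix u assume u: "u \<subseteq> xings D'"
  define v where "v = u - {R2_loop \<beta>, R2_id \<beta>}"
  have v: "v \<subseteq> xings D" using u unfolding v_def xings(1) by blast
  have fin: "finite (circles D v)" using finite_circles[OF assms(1) v] .
  have fin_S: "finite (components (S v))" unfolding S_def by (rule R2_saddled_circles[OF assms(1,2,4) v])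
  have cases: "u = w v \<or> u = w' v \<or> u = v \<or> u = w (w' v)"
    unfolding v_def w_def w'_def by blast
  have "exterior_op (circles D v) (components (S v)) (saddle \<beta> (resolution D v) (S v))"
  proof (rule exterior_op_saddle[OF fin])
    show "\<beta> (-1) \<in> S v" "\<beta> 1 \<in> S v" unfolding S_def R2_saddled_def res1_def by auto
    have "\<beta> ` res1 \<subseteq> disc \<beta>" using res1_subset by blast
    then have "resolution D v - disc \<beta> = S v - disc \<beta>" unfolding S_def R2_saddled_def by blast
    then show "a \<in> components (S v)" if "a \<in> circles D v" "a \<inter> disc \<beta> = {}" for a
      using circle_avoiding_set[OF link_diagram_resolution[OF assms(1) v] closed_disc[OF lc(1)]] that
      by blast
  qed
  note saddled = chain_op_vertex[OF exterior_op_comp[OF fin this exterior_op_scaled_push[OF fin_S]] v]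
  note kept = chain_op_vertex[OF exterior_op_scaled_push[OF fin] v]
  from cases show "\<exists>B T. chain_op D B T \<and> (\<forall>\<psi>\<in>chains D. f \<psi> u = T \<psi>)"
  proof (elim disjE)
    assume "u = w v" then show ?thesis using f v kept by blast
  next
    assume "u = w' v" then show ?thesis using f v saddled by blast
  next
    assume "u = v" then show ?thesis using f v chain_op_zero by blast
  next
    assume "u = w (w' v)" then show ?thesis using f v chain_op_zero by blast
  qed
qed

lemma natural_R2_remove:
  assumes "link_diagram D" "link_diagram D'" "\<And>\<psi>. \<psi> \<in> chains D' \<Longrightarrow> f \<psi> \<in> chains D"
    and "local_change \<beta> (uncrossed res0) R2_crossed D D'" "R2_remove \<beta> D' D f"
  shows "natural D' D f"
proof (rule naturalI[OF assms(2,3)])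
  have lc: "disc_chart \<beta>" "has_tangle \<beta> (uncrossed res0) D" "has_tangle \<beta> R2_crossed D'"
    "agree_outside (disc \<beta>) D D'"
    using assms(4) unfolding local_change_def by blast+
  note xings = R2_xings[OF lc]
  define w where "w v = insert (R2_id \<beta>) v" for v
  define w' where "w' v = insert (R2_loop \<beta>) v" for v
  define S where "S v = R2_saddled \<beta> D v" for v
  define O' where "O' v = connected_component_set (resolution D' (w' v)) (\<beta> ((\<i> - 1) / 4))" for v
  obtain \<eta> \<eta>' where f: "\<forall>\<psi>\<in>chains D'. \<forall>v\<subseteq>xings D. f \<psi> v =
      scale (\<eta> v) (push (follow (disc \<beta>) (resolution D v)) (circles D' (w v)) (\<psi> (w v))) +
      scale (\<eta>' v) (saddle (\<lambda>z. \<beta> (\<i> * z)) (S v) (resolution D v)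
        (push (follow (disc \<beta>) (S v)) (circles D' (w' v) - {O' v}) (contract (O' v) (\<psi> (w' v)))))"
    using assms(5)[unfolded R2_remove_def Let_def, folded w_def w'_def S_def, folded O'_def]
    by (elim exE conjE) (rule that)
  fix v assume v: "v \<subseteq> xings D"
  then have w: "w v \<subseteq> xings D'" "w' v \<subseteq> xings D'" unfolding w_def w'_def xings(1) by blast+
  note fin = finite_circles[OF assms(2) w(1)] finite_circles[OF assms(2) w(2)]
  have fin_S: "finite (components (S v))"
    and into_S: "follow (disc \<beta>) (S v) ` (circles D' (w' v) - {O' v}) \<subseteq> components (S v)"
    using R2_saddled_circles[OF assms(1,2,4) v] unfolding S_def O'_def w'_def by auto
  have "exterior_op (circles D' (w' v) - {O' v}) (components (S v))
      (push (follow (disc \<beta>) (S v)) (circles D' (w' v) - {O' v}))"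
    using fin(2) into_S by (intro exterior_op_push) auto
  note contracted = exterior_op_comp[OF fin(2) exterior_op_contract[OF fin(2)] this]
  define B where "B = insert (connected_component_set (resolution D v) (\<beta> (\<i> * -1)))
    (insert (connected_component_set (resolution D v) (\<beta> (\<i> * 1)))
      {a \<in> components (S v). a \<inter> disc (\<lambda>z. \<beta> (\<i> * z)) = {}})"
  have "exterior_op (components (S v)) B (saddle (\<lambda>z. \<beta> (\<i> * z)) (S v) (resolution D v))"
    unfolding B_def by (rule exterior_op_saddle_general[OF fin_S refl refl])
  note saddled = exterior_op_comp[OF fin(2) contracted this]
  define C where "C = follow (disc \<beta>) (resolution D v) ` circles D' (w v)"
  have fin_BC: "finite (B \<union> C)" unfolding B_def C_def using fin(1) fin_S by simp
  have "chain_op D' (B \<union> C) (\<lambda>\<psi>.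
      scale (\<eta> v) (push (follow (disc \<beta>) (resolution D v)) (circles D' (w v)) (\<psi> (w v))) +
      scale (\<eta>' v) (saddle (\<lambda>z. \<beta> (\<i> * z)) (S v) (resolution D v)
        (push (follow (disc \<beta>) (S v)) (circles D' (w' v) - {O' v}) (contract (O' v) (\<psi> (w' v))))))"
  proof (rule chain_op_add[OF fin_BC])
    have "exterior_op (circles D' (w v)) (B \<union> C)
        (push (follow (disc \<beta>) (resolution D v)) (circles D' (w v)))"
      unfolding C_def by (intro exterior_op_push[OF fin(1)]) blast
    from chain_op_vertex[OF exterior_op_scaled[OF fin(1) fin_BC this] w(1)]
    show "chain_op D' (B \<union> C) (\<lambda>\<psi>. scale (\<eta> v)
        (push (follow (disc \<beta>) (resolution D v)) (circles D' (w v)) (\<psi> (w v))))" .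
    from chain_op_vertex[OF exterior_op_scaled[OF fin(2) fin_BC exterior_op_mono[OF saddled Un_upper1]] w(2)]
    show "chain_op D' (B \<union> C) (\<lambda>\<psi>. scale (\<eta>' v) (saddle (\<lambda>z. \<beta> (\<i> * z)) (S v) (resolution D v)
        (push (follow (disc \<beta>) (S v)) (circles D' (w' v) - {O' v}) (contract (O' v) (\<psi> (w' v))))))" .
  qed
  then show "\<exists>B T. chain_op D' B T \<and> (\<forall>\<psi>\<in>chains D'. f \<psi> v = T \<psi>)" using f v by blast
qed

section \<open>The complex as a mapping cone\<close>

lemma natural_comp: "natural D D' f \<Longrightarrow> natural D' D'' g \<Longrightarrow> natural D D'' (\<lambda>\<psi>. g (f \<psi>))"
  unfolding natural_def by simp

lemma additive_zero:
  fixes f :: "chain \<Rightarrow> chain"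
  assumes "\<And>\<psi> \<xi>. \<psi> \<in> chains D \<Longrightarrow> \<xi> \<in> chains D \<Longrightarrow> f (\<psi> + \<xi>) = f \<psi> + f \<xi>"
  shows "f 0 = 0"
  using assms[OF chains_zero chains_zero] by simp

lemma additive_diff:
  fixes f :: "chain \<Rightarrow> chain"
  assumes "\<And>\<psi> \<xi>. \<psi> \<in> chains D \<Longrightarrow> \<xi> \<in> chains D \<Longrightarrow> f (\<psi> + \<xi>) = f \<psi> + f \<xi>"
    and "\<psi> \<in> chains D" "\<xi> \<in> chains D"
  shows "f (\<psi> - \<xi>) = f \<psi> - f \<xi>"
  using assms(1)[OF chains_diff[OF assms(2,3)] assms(3)] by (simp add: algebra_simps)

lemma natural_zero: "natural D D' f \<Longrightarrow> f 0 = 0"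
  using additive_zero natural_add by blast

lemma natural_diff:
  "natural D D' f \<Longrightarrow> \<psi> \<in> chains D \<Longrightarrow> \<xi> \<in> chains D \<Longrightarrow> f (\<psi> - \<xi>) = f \<psi> - f \<xi>"
  using additive_diff natural_add by blast

lemma augment_chain_diff:
  assumes "link_diagram D" "\<psi> \<in> chains D" "\<xi> \<in> chains D"
  shows "augment_chain (\<psi> - \<xi>) = augment_chain \<psi> - augment_chain \<xi>"
  using additive_diff augment_chain_add[OF assms(1)] assms(2,3) by blast

definition scale_chain :: "int \<Rightarrow> chain \<Rightarrow> chain" where
  "scale_chain k \<psi> = (\<lambda>v. scale k (\<psi> v))"

lemma natural_scale_chain: "link_diagram D \<Longrightarrow> natural D D (scale_chain k)"
proof (rule naturalI)
  fix v assume "link_diagram D" "v \<subseteq> xings D"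
  then show "\<exists>B T. chain_op D B T \<and> (\<forall>\<psi>\<in>chains D. scale_chain k \<psi> v = T \<psi>)"
    using chain_op_vertex[OF exterior_op_scale[OF finite_circles]] unfolding scale_chain_def by blast
qed (auto simp: scale_chain_def chains_scale)

lemma scale_zero: "scale k 0 = 0"
  by (simp add: scale_def fun_eq_iff)

lemma scale_add: "scale k (x + y) = scale k x + scale k y"
  by (simp add: scale_def fun_eq_iff algebra_simps)

lemma scale_commute: "scale k (scale l x) = scale l (scale k x)"
  by (simp add: scale_def fun_eq_iff)

lemma push_scale: "push h A (scale k x) = scale k (push h A x)"
  by (simp add: push_def scale_def fun_eq_iff sum_distrib_left)

lemma wedge_scale: "wedge a (scale k x) = scale k (wedge a x)"
  by (auto simp: wedge_def scale_def fun_eq_iff sum_distrib_left intro!: sum.cong)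

lemma saddle_scale: "saddle \<beta> S S' (scale k x) = scale k (saddle \<beta> S S' x)"
  unfolding saddle_def Let_def push_scale wedge_scale
  by (auto simp: scale_def fun_eq_iff algebra_simps)

lemma edge_zero: "edge D v x 0 = 0"
  using saddle_scale[of _ _ _ 0 0] unfolding edge_def by (simp add: scale_def zero_fun_def)

lemma differential_scale: "differential D \<epsilon> (scale_chain k \<psi>) = scale_chain k (differential D \<epsilon> \<psi>)"
proof
  fix w
  have "scale k (\<Sum>x\<in>A. y x) = (\<Sum>x\<in>A. scale k (y x))" for A :: "complex set" and y
  proof (induction A rule: infinite_finite_induct)
    case (insert x A)
    then show ?case by (metis scale_add sum.insert)
  next
    case (infinite A)
    then show ?case by (metis scale_zero sum.infinite)
  next
    case empty
    show ?case by (metis scale_zero sum.empty)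
  qed
  then show "differential D \<epsilon> (scale_chain k \<psi>) w = scale_chain k (differential D \<epsilon> \<psi>) w"
    unfolding differential_def scale_chain_def edge_def saddle_scale
    by (simp add: scale_zero scale_commute[of k])
qed

text \<open>
  This makes the cube of \<open>D\<close> the union of two faces, the cubes of the diagrams with resolved crossing.
\<close>
lemma resolution_resolve:
  assumes "link_diagram D" "c \<in> xings D" "c \<notin> v"
  shows "resolution (resolve D c r) v = resolution D (if r then insert c v else v)"
proof -
  let ?w = "if r then insert c v else v"
  let ?arcs = "\<lambda>v x. chart D x ` (if x \<in> v then res1 else res0)"
  have disjoint: "disc (chart D x) \<inter> disc (chart D c) = {}" if "x \<in> xings D - {c}" for x
    using assms(1,2) that unfolding link_diagram_def by blast
  have arcs: "?arcs v x \<subseteq> disc (chart D x)" for x v using res0_subset res1_subset by auto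
  have res: "(if r then res1 else res0) = (if c \<in> ?w then res1 else res0)" using assms(3) by auto
  have "(\<Union>x\<in>xings D - {c}. disc (chart D x)) \<inter> chart D c ` (if r then res1 else res0) = {}"
    using disjoint arcs[of c ?w] unfolding res by blast
  moreover have "(C - Z \<union> R) - U \<union> V = (C - Z - U) \<union> (R \<union> V)" if "U \<inter> R = {}"
    for C Z R U V :: "complex set" using that by blast
  ultimately have "resolution (resolve D c r) v =
      (curve D - disc (chart D c) - (\<Union>x\<in>xings D - {c}. disc (chart D x))) \<union>
      (?arcs ?w c \<union> (\<Union>x\<in>xings D - {c}. ?arcs v x))"
    unfolding resolution_def resolve_def diagram.simps res by meson
  also have "(\<Union>x\<in>xings D - {c}. ?arcs v x) = (\<Union>x\<in>xings D - {c}. ?arcs ?w x)"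
    by (intro SUP_cong) auto
  also have "?arcs ?w c \<union> (\<Union>x\<in>xings D - {c}. ?arcs ?w x) = (\<Union>x\<in>insert c (xings D - {c}). ?arcs ?w x)"
    unfolding UN_insert ..
  also have "curve D - disc (chart D c) - (\<Union>x\<in>xings D - {c}. disc (chart D x)) =
      curve D - (\<Union>x\<in>insert c (xings D - {c}). disc (chart D x))"
    unfolding UN_insert by blast
  also have "insert c (xings D - {c}) = xings D" using assms(2) by blast
  finally show ?thesis unfolding resolution_def .
qed

lemma xings_resolve [simp]: "xings (resolve D c r) = xings D - {c}"
  and chart_resolve [simp]: "chart (resolve D c r) = chart D"
  by (simp_all add: resolve_def)

lemma link_diagram_resolve:
  assumes "link_diagram D" "c \<in> xings D"
  shows "link_diagram (resolve D c r)"
  unfolding link_diagram_def xings_resolve chart_resolve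
proof (intro conjI ballI allI impI)
  have D: "finite (xings D)"
    "\<And>x. x \<in> xings D \<Longrightarrow> disc_chart (chart D x) \<and> chart D x 0 = x \<and>
       curve D \<inter> disc (chart D x) = chart D x ` cross"
    "\<And>x y. x \<in> xings D \<Longrightarrow> y \<in> xings D \<Longrightarrow> x \<noteq> y \<Longrightarrow> disc (chart D x) \<inter> disc (chart D y) = {}"
    using assms(1) unfolding link_diagram_def by blast+
  show "finite (xings D - {c})" using D(1) by simp
  fix x assume x: "x \<in> xings D - {c}"
  then show "disc_chart (chart D x)" "chart D x 0 = x" using D(2) by blast+
  show "disc (chart D x) \<inter> disc (chart D y) = {}" if "y \<in> xings D - {c}" "x \<noteq> y" for y
    using D(3) x that by blast
  have off: "disc (chart D c) \<inter> disc (chart D x) = {}" using D(3)[of c x] assms(2) x by blast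
  moreover have "chart D c ` (if r then res1 else res0) \<subseteq> disc (chart D c)"
    using res0_subset res1_subset by auto
  moreover have "(C - U \<union> V) \<inter> W = C \<inter> W" if "U \<inter> W = {}" "V \<subseteq> U" for C U V W :: "complex set"
    using that by blast
  ultimately have "curve (resolve D c r) \<inter> disc (chart D x) = curve D \<inter> disc (chart D x)"
    unfolding resolve_def diagram.simps by meson
  then show "curve (resolve D c r) \<inter> disc (chart D x) = chart D x ` cross" using D(2) x by simp
next
  fix v assume v: "v \<subseteq> xings D - {c}"
  then have "c \<notin> v" "(if r then insert c v else v) \<subseteq> xings D" using assms(2) by auto
  then show "closed_1_manifold (resolution (resolve D c r) v)"
    using resolution_resolve[OF assms] link_diagram_resolution[OF assms(1)] by simp
qed

lemma edge_resolve:
  assumes "link_diagram D" "c \<in> xings D" "c \<notin> v" "x \<noteq> c"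
  shows "edge (resolve D c r) v x = edge D (if r then insert c v else v) x"
  using assms resolution_resolve[OF assms(1,2), of v r] resolution_resolve[OF assms(1,2), of "insert x v" r]
  unfolding edge_def by (simp add: insert_commute)

lemma natural_part:
  assumes "link_diagram D" "c \<in> xings D"
  shows "natural D (resolve D c r) (part c r)"
  unfolding natural_def
proof (intro conjI ballI)
  fix \<psi> assume \<psi>: "\<psi> \<in> chains D"
  show "part c r \<psi> \<in> chains (resolve D c r)"
  proof (rule chainsI)
    fix v assume v: "v \<subseteq> xings (resolve D c r)"
    then have "c \<notin> v" "(if r then insert c v else v) \<subseteq> xings D" using assms(2) by auto
    then show "part c r \<psi> v \<in> exterior (circles (resolve D c r) v)"
      using resolution_resolve[OF assms] chains_exterior[OF \<psi>] by (simp add: part_def)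
  next
    fix v assume v: "\<not> v \<subseteq> xings (resolve D c r)"
    show "part c r \<psi> v = 0"
    proof (cases "c \<in> v")
      case False
      then have "\<not> (if r then insert c v else v) \<subseteq> xings D" using v by auto
      then have "\<psi> (if r then insert c v else v) = 0" by (rule chains_outside[OF \<psi>])
      then show ?thesis unfolding part_def by simp
    qed (simp add: part_def)
  qed
  show "part c r (augment_chain \<psi>) = augment_chain (part c r \<psi>)"
  proof
    fix v show "part c r (augment_chain \<psi>) v = augment_chain (part c r \<psi>) v"
      unfolding part_def augment_chain_def by (cases "c \<in> v") simp_all
  qed
qed (simp add: part_def fun_eq_iff)

lemma natural_extend:
  assumes "link_diagram D" "c \<in> xings D"
  shows "natural (resolve D c r) D (extend c r)"
  unfolding natural_def
proof (intro conjI ballI)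
  fix \<psi> assume \<psi>: "\<psi> \<in> chains (resolve D c r)"
  show "extend c r \<psi> \<in> chains D"
  proof (rule chainsI)
    fix w assume w: "w \<subseteq> xings D"
    show "extend c r \<psi> w \<in> exterior (circles D w)"
    proof (cases "(c \<in> w) = r")
      case True
      have "w - {c} \<subseteq> xings (resolve D c r)" using w by auto
      then have "\<psi> (w - {c}) \<in> exterior (circles (resolve D c r) (w - {c}))" by (rule chains_exterior[OF \<psi>])
      moreover have "(if r then insert c (w - {c}) else w - {c}) = w" using True by auto
      ultimately show ?thesis
        using resolution_resolve[OF assms, of "w - {c}" r] True by (simp add: extend_def)
    qed (simp add: extend_def exterior_zero)
  next
    fix w assume "\<not> w \<subseteq> xings D"
    then have "\<not> w - {c} \<subseteq> xings (resolve D c r)" using assms(2) by auto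
    then have "\<psi> (w - {c}) = 0" by (rule chains_outside[OF \<psi>])
    then show "extend c r \<psi> w = 0" unfolding extend_def by simp
  qed
  show "extend c r (augment_chain \<psi>) = augment_chain (extend c r \<psi>)"
  proof
    fix v show "extend c r (augment_chain \<psi>) v = augment_chain (extend c r \<psi>) v"
      unfolding extend_def augment_chain_def by (cases "(c \<in> v) = r") simp_all
  qed
qed (simp add: extend_def fun_eq_iff)

lemma part_extend:
  assumes "\<psi> \<in> chains (resolve D c r)"
  shows "part c r (extend c r \<psi>) = \<psi>" "part c (\<not> r) (extend c r \<psi>) = 0"
proof -
  have "\<psi> v = 0" if "c \<in> v" for v using chains_outside[OF assms, of v] that by auto
  then show "part c r (extend c r \<psi>) = \<psi>"
    unfolding part_def extend_def by (intro ext) (auto simp: insert_Diff_if)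
  show "part c (\<not> r) (extend c r \<psi>) = 0"
    unfolding part_def extend_def by (intro ext) auto
qed

lemma extend_part: "extend c True (part c True \<psi>) + extend c False (part c False \<psi>) = \<psi>"
proof
  fix w
  show "(extend c True (part c True \<psi>) + extend c False (part c False \<psi>)) w = \<psi> w"
    unfolding extend_def part_def by (cases "c \<in> w") (simp_all add: insert_absorb)
qed

text \<open>
  Setting \<open>c\<close> to 0 gives the quotient complex of the cone, so the restriction is a chain map.
\<close>
lemma part_False_differential:
  assumes "link_diagram D" "c \<in> xings D"
  shows "part c False (differential D \<epsilon> \<psi>) =
    differential (resolve D c False) (part_signs c False \<epsilon>) (part c False \<psi>)"
proof
  fix v
  show "part c False (differential D \<epsilon> \<psi>) v =
    differential (resolve D c False) (part_signs c False \<epsilon>) (part c False \<psi>) v"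
  proof (cases "c \<in> v")
    case True
    then have "\<not> v \<subseteq> xings D - {c}" by blast
    then show ?thesis using True by (simp add: part_def differential_def)
  next
    case False
    then have "v \<subseteq> xings D - {c} \<longleftrightarrow> v \<subseteq> xings D" by blast
    moreover have "edge (resolve D c False) (v - {x}) x = edge D (v - {x}) x" if "x \<in> v" for x
      using edge_resolve[OF assms, of "v - {x}" x False] False that by auto
    ultimately show ?thesis using False
      by (auto simp: part_def differential_def part_signs_def intro!: sum.cong)
  qed
qed

text \<open>
  Setting \<open>c\<close> to 1 gives the subcomplex of the cone. An edge in the direction \<open>c\<close> starts at a vertex where
  the extended chain is zero.
\<close>
lemma part_True_differential:
  assumes "link_diagram D" "c \<in> xings D" "\<xi> \<in> chains (resolve D c True)"
  shows "part c True (differential D \<epsilon> (extend c True \<xi>)) =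
    differential (resolve D c True) (part_signs c True \<epsilon>) \<xi>"
proof
  fix v
  let ?A = "resolve D c True"
  show "part c True (differential D \<epsilon> (extend c True \<xi>)) v =
    differential ?A (part_signs c True \<epsilon>) \<xi> v"
  proof (cases "v \<subseteq> xings D - {c}")
    case False
    then have "c \<in> v \<or> \<not> insert c v \<subseteq> xings D" by blast
    then show ?thesis using False by (auto simp: part_def differential_def)
  next
    case True
    then have v: "c \<notin> v" "insert c v \<subseteq> xings D" "finite v"
      using assms(2) finite_xings[OF assms(1)] finite_subset by auto
    let ?T = "\<lambda>x. scale (\<epsilon> (insert c v - {x}) x)
        (edge D (insert c v - {x}) x (extend c True \<xi> (insert c v - {x})))"
    have "part c True (differential D \<epsilon> (extend c True \<xi>)) v = (\<Sum>x\<in>insert c v. ?T x)"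
      using v by (simp add: part_def differential_def)
    also have "\<dots> = ?T c + (\<Sum>x\<in>v. ?T x)" by (rule sum.insert[OF v(3,1)])
    also have "extend c True \<xi> (insert c v - {c}) = 0" by (simp add: extend_def)
    then have "?T c = 0" by (simp only: edge_zero scale_zero)
    also have "0 + (\<Sum>x\<in>v. ?T x) = (\<Sum>x\<in>v. ?T x)" by (rule add_0)
    also have "\<dots> = (\<Sum>x\<in>v. scale (part_signs c True \<epsilon> (v - {x}) x) (edge ?A (v - {x}) x (\<xi> (v - {x}))))"
    proof (rule sum.cong[OF refl])
      fix x assume x: "x \<in> v"
      then have "x \<noteq> c" using v(1) by blast
      then have eq: "insert c v - {x} = insert c (v - {x})" by auto
      have "c \<notin> v - {x}" using v(1) by blast
      then show "?T x = scale (part_signs c True \<epsilon> (v - {x}) x) (edge ?A (v - {x}) x (\<xi> (v - {x})))"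
        using edge_resolve[OF assms(1,2), of "v - {x}" x True] \<open>x \<noteq> c\<close>
        unfolding eq by (simp add: extend_def part_signs_def)
    qed
    also have "\<dots> = differential ?A (part_signs c True \<epsilon>) \<xi> v"
      using True by (simp add: differential_def)
    finally show ?thesis .
  qed
qed

section \<open>Reidemeister III\<close>

lemma natural_connecting:
  "link_diagram D \<Longrightarrow> c \<in> xings D \<Longrightarrow> natural (resolve D c False) (resolve D c True) (connecting D \<epsilon> c)"
  unfolding connecting_def
  by (intro natural_comp[OF natural_comp[OF natural_extend natural_differential] natural_part])

lemma differential_extend_False:
  assumes "link_diagram D" "c \<in> xings D" "\<omega> \<in> chains (resolve D c False)"
  shows "differential D \<epsilon> (extend c False \<omega>) =
    extend c True (connecting D \<epsilon> c \<omega>) +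
    extend c False (differential (resolve D c False) (part_signs c False \<epsilon>) \<omega>)"
  using extend_part[of c "differential D \<epsilon> (extend c False \<omega>)"]
  unfolding part_False_differential[OF assms(1,2)] part_extend(1)[OF assms(3)] connecting_def by simp

lemma differential_extend_True:
  assumes "link_diagram D" "c \<in> xings D" "\<omega> \<in> chains (resolve D c True)"
  shows "differential D \<epsilon> (extend c True \<omega>) =
    extend c True (differential (resolve D c True) (part_signs c True \<epsilon>) \<omega>)"
proof -
  have "part c False (extend c True \<omega>) = 0" using part_extend(2)[OF assms(3)] by simp
  then have "part c False (differential D \<epsilon> (extend c True \<omega>)) = 0"
    unfolding part_False_differential[OF assms(1,2)]
    using natural_zero[OF natural_differential[OF link_diagram_resolve[OF assms(1,2)]]] by simp
  moreover have "extend c False 0 = 0" by (simp add: extend_def fun_eq_iff)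
  ultimately show ?thesis
    using extend_part[of c "differential D \<epsilon> (extend c True \<omega>)"]
    unfolding part_True_differential[OF assms] by simp
qed

lemma part_True_differential_sum:
  assumes "link_diagram D" "c \<in> xings D" "\<psi> \<in> chains D"
  shows "part c True (differential D \<epsilon> \<psi>) = connecting D \<epsilon> c (part c False \<psi>) +
    differential (resolve D c True) (part_signs c True \<epsilon>) (part c True \<psi>)"
proof -
  note part = natural_chains[OF natural_part[OF assms(1,2)] assms(3)]
  note extend = natural_chains[OF natural_extend[OF assms(1,2)] part]
  note d = natural_differential[OF assms(1), of \<epsilon>]
  have "part c True (differential D \<epsilon> \<psi>) =
      part c True (differential D \<epsilon> (extend c True (part c True \<psi>) + extend c False (part c False \<psi>)))"
    unfolding extend_part ..
  also have "\<dots> = part c True (differential D \<epsilon> (extend c True (part c True \<psi>))) +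
      connecting D \<epsilon> c (part c False \<psi>)"
    unfolding connecting_def natural_add[OF d extend extend]
    by (rule natural_add[OF natural_part[OF assms(1,2)] natural_chains[OF d extend] natural_chains[OF d extend]])
  finally show ?thesis
    unfolding part_True_differential[OF assms(1,2) part] by (simp only: add.commute)
qed

text \<open>
  The commutator of \<open>augment_chain\<close> with a homotopy \<open>E\<close> anticommutes with the differential, since
  \<open>augment_chain\<close> commutes with both ends of the homotopy.
\<close>
lemma homotopy_augment:
  assumes "link_diagram D" "natural D D p" "homotopy_to_id D \<epsilon> p E" "\<psi> \<in> chains D"
  shows "differential D \<epsilon> (augment_chain (E \<psi>) - E (augment_chain \<psi>)) +
    (augment_chain (E (differential D \<epsilon> \<psi>)) - E (augment_chain (differential D \<epsilon> \<psi>))) = 0"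
proof -
  let ?d = "differential D \<epsilon>"
  note d = natural_differential[OF assms(1), of \<epsilon>]
  have E: "E \<psi> \<in> chains D" "?d (E \<psi>) + E (?d \<psi>) = \<psi> - p \<psi>" if "\<psi> \<in> chains D" for \<psi>
    using assms(3) that unfolding homotopy_to_id_def by blast+
  note a = chains_augment[OF assms(1,4)] and aE = chains_augment[OF assms(1) E(1)[OF assms(4)]]
  note d\<psi> = natural_chains[OF d assms(4)] and p\<psi> = natural_chains[OF assms(2,4)]
  have "augment_chain (?d (E \<psi>) + E (?d \<psi>)) = augment_chain (\<psi> - p \<psi>)" using E(2)[OF assms(4)] by simp
  then have 1: "?d (augment_chain (E \<psi>)) + augment_chain (E (?d \<psi>)) = augment_chain \<psi> - augment_chain (p \<psi>)"
    using augment_chain_add[OF assms(1) natural_chains[OF d E(1)[OF assms(4)]] E(1)[OF d\<psi>]]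
      augment_chain_diff[OF assms(1,4) p\<psi>] natural_augment[OF d E(1)[OF assms(4)]] by simp
  have 2: "?d (E (augment_chain \<psi>)) + E (augment_chain (?d \<psi>)) = augment_chain \<psi> - augment_chain (p \<psi>)"
    using E(2)[OF a] natural_augment[OF d assms(4)] natural_augment[OF assms(2,4)] by simp
  have "?d (augment_chain (E \<psi>) - E (augment_chain \<psi>)) = ?d (augment_chain (E \<psi>)) - ?d (E (augment_chain \<psi>))"
    using natural_diff[OF d aE E(1)[OF a]] .
  moreover have "x - y + (z - w) = (x + z) - (y + w)" for x y z w :: chain
    by (simp add: algebra_simps)
  ultimately show ?thesis by (simp only: 1 2 diff_self)
qed

lemma extend_scale: "extend c r (scale_chain k \<psi>) = scale_chain k (extend c r \<psi>)"
  unfolding extend_def scale_chain_def by (auto simp: fun_eq_iff scale_def)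

lemma homotopy_additive:
  assumes "homotopy_to_id D \<epsilon> p E" "\<psi> \<in> chains D"
  shows "E \<psi> \<in> chains D" "\<xi> \<in> chains D \<Longrightarrow> E (\<psi> + \<xi>) = E \<psi> + E \<xi>"
    "differential D \<epsilon> (E \<psi>) + E (differential D \<epsilon> \<psi>) = \<psi> - p \<psi>"
  using assms unfolding homotopy_to_id_def by blast+

text \<open>
  The case in which the simplified resolution is the quotient complex of the cone. The only part of \<open>f\<close>
  that need not commute with \<open>augment_chain\<close> is the diagonal one, and the commutator is \<open>s\<close> times the map
  \<open>K\<close>, which is \<open>g\<close> after the connecting map, applied to the cycle \<open>\<delta>\<close> formed from the commutator with
  \<open>E\<close>. As \<open>f\<close> is a chain map, \<open>K\<close> is homotopic to the connecting map of \<open>D\<^sub>2\<close> after \<open>h\<close>, and every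
  connecting map becomes null-homotopic in the cone. So \<open>K \<delta>\<close> is a boundary.
\<close>
lemma cone_map_augment_target:
  fixes s :: int
  assumes D: "link_diagram D\<^sub>1" "link_diagram D\<^sub>2" "c \<in> xings D\<^sub>1" "c \<in> xings D\<^sub>2"
    and f: "chain_map D\<^sub>1 \<epsilon>\<^sub>1 D\<^sub>2 \<epsilon>\<^sub>2 f"
    and g: "natural (resolve D\<^sub>1 c True) (resolve D\<^sub>2 c True) g"
    and h: "natural (resolve D\<^sub>1 c False) (resolve D\<^sub>2 c False) h"
      "chain_map (resolve D\<^sub>1 c False) (part_signs c False \<epsilon>\<^sub>1) (resolve D\<^sub>2 c False) (part_signs c False \<epsilon>\<^sub>2) h"
    and p: "natural (resolve D\<^sub>1 c False) (resolve D\<^sub>1 c False) p"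
    and E: "homotopy_to_id (resolve D\<^sub>1 c False) (part_signs c False \<epsilon>\<^sub>1) p E"
    and f_eq: "\<And>\<psi>. \<psi> \<in> chains D\<^sub>1 \<Longrightarrow> f \<psi> = extend c True (g (part c True \<psi>)) +
      extend c False (h (part c False \<psi>)) +
      extend c True (scale_chain s (g (connecting D\<^sub>1 \<epsilon>\<^sub>1 c (E (part c False \<psi>)))))"
    and \<psi>: "\<psi> \<in> chains D\<^sub>1" "differential D\<^sub>1 \<epsilon>\<^sub>1 \<psi> = 0"
  shows "\<exists>\<kappa>\<in>chains D\<^sub>2. augment_chain (f \<psi>) = f (augment_chain \<psi>) + differential D\<^sub>2 \<epsilon>\<^sub>2 \<kappa>"
proof -
  let ?F\<^sub>1 = "resolve D\<^sub>1 c False" and ?T\<^sub>1 = "resolve D\<^sub>1 c True"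
  let ?F\<^sub>2 = "resolve D\<^sub>2 c False" and ?T\<^sub>2 = "resolve D\<^sub>2 c True"
  let ?d\<^sub>1 = "differential D\<^sub>1 \<epsilon>\<^sub>1" and ?d\<^sub>2 = "differential D\<^sub>2 \<epsilon>\<^sub>2"
  let ?dF\<^sub>1 = "differential ?F\<^sub>1 (part_signs c False \<epsilon>\<^sub>1)"
  let ?dF\<^sub>2 = "differential ?F\<^sub>2 (part_signs c False \<epsilon>\<^sub>2)"
  let ?dT\<^sub>2 = "differential ?T\<^sub>2 (part_signs c True \<epsilon>\<^sub>2)"
  let ?k\<^sub>2 = "connecting D\<^sub>2 \<epsilon>\<^sub>2 c"
  note res = link_diagram_resolve[OF D(1,3)] link_diagram_resolve[OF D(2,4)]
  define K where "K = (\<lambda>x. g (connecting D\<^sub>1 \<epsilon>\<^sub>1 c x))"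
  have K: "natural ?F\<^sub>1 ?T\<^sub>2 K"
    unfolding K_def by (rule natural_comp[OF natural_connecting[OF D(1,3)] g])
  have sK: "natural ?F\<^sub>1 ?T\<^sub>2 (\<lambda>x. scale_chain s (K x))"
    by (rule natural_comp[OF K natural_scale_chain[OF res(2)]])
  note Ec = homotopy_additive(1)[OF E]
  have E0: "E 0 = 0" by (rule additive_zero) (rule homotopy_additive(2)[OF E])
  note d\<^sub>1 = natural_differential[OF D(1), of \<epsilon>\<^sub>1]
  note d\<^sub>2 = natural_differential[OF D(2), of \<epsilon>\<^sub>2]
  note dF\<^sub>1 = natural_differential[OF res(1), of False "part_signs c False \<epsilon>\<^sub>1"]
  note dT\<^sub>2 = natural_differential[OF res(2), of True "part_signs c True \<epsilon>\<^sub>2"]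
  note extF\<^sub>2 = natural_extend[OF D(2,4), of False] and extT\<^sub>2 = natural_extend[OF D(2,4), of True]
  note extF\<^sub>1 = natural_extend[OF D(1,3), of False]
  note partF\<^sub>1 = natural_part[OF D(1,3), of False] and partT\<^sub>1 = natural_part[OF D(1,3), of True]
  \<comment> \<open>The component of \<open>d f = f d\<close> from the quotient complex of the first cone to the subcomplex of the second.\<close>
  have hom: "K x = ?k\<^sub>2 (h x) + ?dT\<^sub>2 (scale_chain s (K (E x))) - scale_chain s (K (E (?dF\<^sub>1 x)))"
    if x: "x \<in> chains ?F\<^sub>1" for x
  proof -
    note ex = natural_chains[OF extF\<^sub>1 x]
    have T0: "part c True (extend c False x) = 0" using part_extend(2)[OF x] by simp
    have f1: "f (extend c False x) = extend c False (h x) + extend c True (scale_chain s (K (E x)))"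
      unfolding f_eq[OF ex] T0 part_extend(1)[OF x] natural_zero[OF g] K_def natural_zero[OF extT\<^sub>2]
      by simp
    have hx: "h x \<in> chains ?F\<^sub>2" by (rule natural_chains[OF h(1) x])
    have sx: "scale_chain s (K (E x)) \<in> chains ?T\<^sub>2" by (rule natural_chains[OF sK Ec[OF x]])
    have "part c True (?d\<^sub>2 (f (extend c False x))) =
        ?k\<^sub>2 (part c False (f (extend c False x))) + ?dT\<^sub>2 (part c True (f (extend c False x)))"
      using f ex unfolding chain_map_def by (intro part_True_differential_sum[OF D(2,4)]) blast
    moreover have "part c False (f (extend c False x)) = h x" "part c True (f (extend c False x)) = scale_chain s (K (E x))"
      using part_extend[OF hx] part_extend[OF sx] natural_chains[OF extF\<^sub>2 hx] natural_chains[OF extT\<^sub>2 sx]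
      unfolding f1 by (simp_all add: natural_add[OF natural_part[OF D(2,4)]])
    ultimately have 1: "part c True (?d\<^sub>2 (f (extend c False x))) = ?k\<^sub>2 (h x) + ?dT\<^sub>2 (scale_chain s (K (E x)))"
      by simp
    have dx: "?d\<^sub>1 (extend c False x) \<in> chains D\<^sub>1" by (rule natural_chains[OF d\<^sub>1 ex])
    have pF: "part c False (?d\<^sub>1 (extend c False x)) = ?dF\<^sub>1 x"
      unfolding part_False_differential[OF D(1,3)] part_extend(1)[OF x] ..
    have pT: "part c True (?d\<^sub>1 (extend c False x)) = connecting D\<^sub>1 \<epsilon>\<^sub>1 c x"
      unfolding connecting_def ..
    have dFx: "?dF\<^sub>1 x \<in> chains ?F\<^sub>1" by (rule natural_chains[OF dF\<^sub>1 x])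
    have y: "K x \<in> chains ?T\<^sub>2" "h (?dF\<^sub>1 x) \<in> chains ?F\<^sub>2" "scale_chain s (K (E (?dF\<^sub>1 x))) \<in> chains ?T\<^sub>2"
      by (rule natural_chains[OF K x], rule natural_chains[OF h(1) dFx], rule natural_chains[OF sK Ec[OF dFx]])
    have "f (?d\<^sub>1 (extend c False x)) = extend c True (K x) + extend c False (h (?dF\<^sub>1 x)) +
        extend c True (scale_chain s (K (E (?dF\<^sub>1 x))))"
      unfolding f_eq[OF dx] pF pT K_def ..
    then have 2: "part c True (f (?d\<^sub>1 (extend c False x))) = K x + scale_chain s (K (E (?dF\<^sub>1 x)))"
      using part_extend[OF y(1)] part_extend[OF y(2)] part_extend[OF y(3)]
        natural_chains[OF extT\<^sub>2 y(1)] natural_chains[OF extF\<^sub>2 y(2)] natural_chains[OF extT\<^sub>2 y(3)]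
      by (simp add: natural_add[OF natural_part[OF D(2,4)]] chains_add)
    have "?d\<^sub>2 (f (extend c False x)) = f (?d\<^sub>1 (extend c False x))"
      using f ex unfolding chain_map_def by blast
    then show ?thesis using 1 2 by (simp add: algebra_simps)
  qed
  define \<psi>\<^sub>0 where "\<psi>\<^sub>0 = part c False \<psi>"
  define \<psi>\<^sub>1 where "\<psi>\<^sub>1 = part c True \<psi>"
  have \<psi>\<^sub>0: "\<psi>\<^sub>0 \<in> chains ?F\<^sub>1" and \<psi>\<^sub>1: "\<psi>\<^sub>1 \<in> chains ?T\<^sub>1"
    unfolding \<psi>\<^sub>0_def \<psi>\<^sub>1_def using \<psi>(1) by (rule natural_chains[OF partF\<^sub>1], rule natural_chains[OF partT\<^sub>1])
  have cycle: "?dF\<^sub>1 \<psi>\<^sub>0 = 0"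
    unfolding \<psi>\<^sub>0_def part_False_differential[OF D(1,3), symmetric] \<psi>(2) by (rule natural_zero[OF partF\<^sub>1])
  define \<delta> where "\<delta> = augment_chain (E \<psi>\<^sub>0) - E (augment_chain \<psi>\<^sub>0)"
  have a\<psi>\<^sub>0: "augment_chain \<psi>\<^sub>0 \<in> chains ?F\<^sub>1" by (rule chains_augment[OF res(1) \<psi>\<^sub>0])
  have aE: "augment_chain (E \<psi>\<^sub>0) \<in> chains ?F\<^sub>1" by (rule chains_augment[OF res(1) Ec[OF \<psi>\<^sub>0]])
  have \<delta>: "\<delta> \<in> chains ?F\<^sub>1" unfolding \<delta>_def by (rule chains_diff[OF aE Ec[OF a\<psi>\<^sub>0]])
  have d\<delta>: "?dF\<^sub>1 \<delta> = 0"
    using homotopy_augment[OF res(1) p E \<psi>\<^sub>0] unfolding cycle E0 augment_chain_zero \<delta>_def[symmetric]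
    by (simp add: E0)
  have h\<delta>: "h \<delta> \<in> chains ?F\<^sub>2" by (rule natural_chains[OF h(1) \<delta>])
  have sE\<delta>: "scale_chain s (K (E \<delta>)) \<in> chains ?T\<^sub>2" by (rule natural_chains[OF sK Ec[OF \<delta>]])
  have "?dF\<^sub>2 (h \<delta>) = 0"
    using h(2) \<delta> unfolding chain_map_def by (simp add: d\<delta> natural_zero[OF h(1)])
  then have d1: "?d\<^sub>2 (extend c False (h \<delta>)) = extend c True (?k\<^sub>2 (h \<delta>))"
    unfolding differential_extend_False[OF D(2,4) h\<delta>] by (simp add: natural_zero[OF extF\<^sub>2])
  have d2: "?d\<^sub>2 (extend c True (scale_chain s (K (E \<delta>)))) = extend c True (?dT\<^sub>2 (scale_chain s (K (E \<delta>))))"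
    by (rule differential_extend_True[OF D(2,4) sE\<delta>])
  define \<kappa> where "\<kappa> = extend c False (h \<delta>) + extend c True (scale_chain s (K (E \<delta>)))"
  note ext = natural_chains[OF extF\<^sub>2 h\<delta>] natural_chains[OF extT\<^sub>2 sE\<delta>]
  have \<kappa>: "\<kappa> \<in> chains D\<^sub>2" unfolding \<kappa>_def by (rule chains_add[OF ext])
  have k\<delta>: "?k\<^sub>2 (h \<delta>) \<in> chains ?T\<^sub>2" by (rule natural_chains[OF natural_connecting[OF D(2,4)] h\<delta>])
  have dE\<delta>: "?dT\<^sub>2 (scale_chain s (K (E \<delta>))) \<in> chains ?T\<^sub>2" by (rule natural_chains[OF dT\<^sub>2 sE\<delta>])
  have "K \<delta> = ?k\<^sub>2 (h \<delta>) + ?dT\<^sub>2 (scale_chain s (K (E \<delta>)))"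
    using hom[OF \<delta>] unfolding d\<delta> E0 natural_zero[OF sK] by simp
  then have K\<delta>: "extend c True (K \<delta>) = ?d\<^sub>2 \<kappa>"
    unfolding \<kappa>_def natural_add[OF d\<^sub>2 ext] d1 d2 by (simp add: natural_add[OF extT\<^sub>2 k\<delta> dE\<delta>])
  have parts: "part c False (augment_chain \<psi>) = augment_chain \<psi>\<^sub>0" "part c True (augment_chain \<psi>) = augment_chain \<psi>\<^sub>1"
    unfolding \<psi>\<^sub>0_def \<psi>\<^sub>1_def by (rule natural_augment[OF partF\<^sub>1 \<psi>(1)], rule natural_augment[OF partT\<^sub>1 \<psi>(1)])
  have f\<psi>: "f \<psi> = extend c True (g \<psi>\<^sub>1) + extend c False (h \<psi>\<^sub>0) + extend c True (scale_chain s (K (E \<psi>\<^sub>0)))"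
    unfolding f_eq[OF \<psi>(1)] \<psi>\<^sub>0_def \<psi>\<^sub>1_def K_def ..
  have fa\<psi>: "f (augment_chain \<psi>) = extend c True (g (augment_chain \<psi>\<^sub>1)) + extend c False (h (augment_chain \<psi>\<^sub>0)) +
      extend c True (scale_chain s (K (E (augment_chain \<psi>\<^sub>0))))"
    unfolding f_eq[OF chains_augment[OF D(1) \<psi>(1)]] parts K_def ..
  note gT = natural_comp[OF g extT\<^sub>2] and hF = natural_comp[OF h(1) extF\<^sub>2] and sKT = natural_comp[OF sK extT\<^sub>2]
  note c1 = natural_chains[OF gT \<psi>\<^sub>1] and c2 = natural_chains[OF hF \<psi>\<^sub>0] and c3 = natural_chains[OF sKT Ec[OF \<psi>\<^sub>0]]
  have "augment_chain (f \<psi>) = extend c True (g (augment_chain \<psi>\<^sub>1)) + extend c False (h (augment_chain \<psi>\<^sub>0)) +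
      extend c True (scale_chain s (K (augment_chain (E \<psi>\<^sub>0))))"
    unfolding f\<psi> augment_chain_add[OF D(2) chains_add[OF c1 c2] c3] augment_chain_add[OF D(2) c1 c2]
    by (simp only: natural_augment[OF gT \<psi>\<^sub>1] natural_augment[OF hF \<psi>\<^sub>0] natural_augment[OF sKT Ec[OF \<psi>\<^sub>0]])
  also have "\<dots> = f (augment_chain \<psi>) + extend c True (scale_chain s (K \<delta>))"
    unfolding fa\<psi> \<delta>_def natural_diff[OF sKT aE Ec[OF a\<psi>\<^sub>0]] by simp
  also have "extend c True (scale_chain s (K \<delta>)) = ?d\<^sub>2 (scale_chain s \<kappa>)"
    unfolding extend_scale K\<delta> differential_scale ..
  finally show ?thesis
    using natural_chains[OF natural_scale_chain[OF D(2)] \<kappa>] by blast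
qed

text \<open>
  The case in which the simplified resolution is the subcomplex of the cone. Now the homotopy is applied to
  \<open>K \<psi>\<^sub>0\<close>, the connecting map applied to a part of the cycle. In the second cone \<open>f \<psi>\<close> is a cycle
  as well, which says that \<open>K \<psi>\<^sub>0\<close> is a boundary, and the commutator with \<open>E\<close> takes boundaries to
  boundaries.
\<close>
lemma cone_map_augment_source:
  fixes s :: int
  assumes D: "link_diagram D\<^sub>1" "link_diagram D\<^sub>2" "c \<in> xings D\<^sub>1" "c \<in> xings D\<^sub>2"
    and f: "chain_map D\<^sub>1 \<epsilon>\<^sub>1 D\<^sub>2 \<epsilon>\<^sub>2 f"
    and g: "natural (resolve D\<^sub>1 c False) (resolve D\<^sub>2 c False) g"
    and h: "natural (resolve D\<^sub>1 c True) (resolve D\<^sub>2 c True) h"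
      "chain_map (resolve D\<^sub>1 c True) (part_signs c True \<epsilon>\<^sub>1) (resolve D\<^sub>2 c True) (part_signs c True \<epsilon>\<^sub>2) h"
    and p: "natural (resolve D\<^sub>2 c True) (resolve D\<^sub>2 c True) p"
    and E: "homotopy_to_id (resolve D\<^sub>2 c True) (part_signs c True \<epsilon>\<^sub>2) p E"
    and f_eq: "\<And>\<psi>. \<psi> \<in> chains D\<^sub>1 \<Longrightarrow> f \<psi> = extend c False (g (part c False \<psi>)) +
      extend c True (h (part c True \<psi>)) +
      extend c True (scale_chain s (E (connecting D\<^sub>2 \<epsilon>\<^sub>2 c (g (part c False \<psi>)))))"
    and \<psi>: "\<psi> \<in> chains D\<^sub>1" "differential D\<^sub>1 \<epsilon>\<^sub>1 \<psi> = 0"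
  shows "\<exists>\<kappa>\<in>chains D\<^sub>2. augment_chain (f \<psi>) = f (augment_chain \<psi>) + differential D\<^sub>2 \<epsilon>\<^sub>2 \<kappa>"
proof -
  let ?F\<^sub>1 = "resolve D\<^sub>1 c False" and ?T\<^sub>1 = "resolve D\<^sub>1 c True"
  let ?T\<^sub>2 = "resolve D\<^sub>2 c True" and ?d\<^sub>2 = "differential D\<^sub>2 \<epsilon>\<^sub>2"
  let ?dT\<^sub>2 = "differential ?T\<^sub>2 (part_signs c True \<epsilon>\<^sub>2)"
  let ?s = "scale_chain s"
  note res = link_diagram_resolve[OF D(1,3)] link_diagram_resolve[OF D(2,4)]
  define K where "K = (\<lambda>x. connecting D\<^sub>2 \<epsilon>\<^sub>2 c (g x))"
  have K: "natural ?F\<^sub>1 ?T\<^sub>2 K"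
    unfolding K_def by (rule natural_comp[OF g natural_connecting[OF D(2,4)]])
  note Ec = homotopy_additive(1)[OF E]
  have E0: "E 0 = 0" by (rule additive_zero) (rule homotopy_additive(2)[OF E])
  note dT\<^sub>2 = natural_differential[OF res(2), of True "part_signs c True \<epsilon>\<^sub>2"]
  note sT\<^sub>2 = natural_scale_chain[OF res(2), of True s]
  note extF\<^sub>2 = natural_extend[OF D(2,4), of False] and extT\<^sub>2 = natural_extend[OF D(2,4), of True]
  note partF\<^sub>1 = natural_part[OF D(1,3), of False] and partT\<^sub>1 = natural_part[OF D(1,3), of True]
  define \<psi>\<^sub>0 where "\<psi>\<^sub>0 = part c False \<psi>"
  define \<psi>\<^sub>1 where "\<psi>\<^sub>1 = part c True \<psi>"
  have \<psi>\<^sub>0: "\<psi>\<^sub>0 \<in> chains ?F\<^sub>1" and \<psi>\<^sub>1: "\<psi>\<^sub>1 \<in> chains ?T\<^sub>1"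
    unfolding \<psi>\<^sub>0_def \<psi>\<^sub>1_def using \<psi>(1) by (rule natural_chains[OF partF\<^sub>1], rule natural_chains[OF partT\<^sub>1])
  have f\<psi>: "f \<psi> = extend c False (g \<psi>\<^sub>0) + extend c True (h \<psi>\<^sub>1) + extend c True (?s (E (K \<psi>\<^sub>0)))"
    unfolding f_eq[OF \<psi>(1)] \<psi>\<^sub>0_def \<psi>\<^sub>1_def K_def ..
  note K\<psi>\<^sub>0 = natural_chains[OF K \<psi>\<^sub>0]
  note g\<psi>\<^sub>0 = natural_chains[OF g \<psi>\<^sub>0] and h\<psi>\<^sub>1 = natural_chains[OF h(1) \<psi>\<^sub>1]
    and sE = natural_chains[OF sT\<^sub>2 Ec[OF K\<psi>\<^sub>0]]
  have f0: "f 0 = 0"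
    unfolding f_eq[OF chains_zero] natural_zero[OF partF\<^sub>1] natural_zero[OF partT\<^sub>1] natural_zero[OF g]
      natural_zero[OF h(1)] natural_zero[OF natural_connecting[OF D(2,4)]] E0 natural_zero[OF sT\<^sub>2]
      natural_zero[OF extT\<^sub>2] natural_zero[OF extF\<^sub>2] by simp
  have cf: "f \<psi> \<in> chains D\<^sub>2" "?d\<^sub>2 (f \<psi>) = 0"
    using f \<psi> f0 unfolding chain_map_def by auto
  have "part c True (f \<psi>) = h \<psi>\<^sub>1 + ?s (E (K \<psi>\<^sub>0))" "part c False (f \<psi>) = g \<psi>\<^sub>0"
    using part_extend[OF g\<psi>\<^sub>0] part_extend[OF h\<psi>\<^sub>1] part_extend[OF sE]
      natural_chains[OF extF\<^sub>2 g\<psi>\<^sub>0] natural_chains[OF extT\<^sub>2 h\<psi>\<^sub>1] natural_chains[OF extT\<^sub>2 sE]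
    unfolding f\<psi> by (simp_all add: natural_add[OF natural_part[OF D(2,4)]] chains_add)
  \<comment> \<open>The component of \<open>d (f \<psi>) = 0\<close> in the subcomplex.\<close>
  then have "K \<psi>\<^sub>0 + ?dT\<^sub>2 (h \<psi>\<^sub>1 + ?s (E (K \<psi>\<^sub>0))) = 0"
    using part_True_differential_sum[OF D(2,4) cf(1), of \<epsilon>\<^sub>2] natural_zero[OF natural_part[OF D(2,4)]]
    unfolding cf(2) K_def by simp
  moreover define \<zeta> where "\<zeta> = 0 - (h \<psi>\<^sub>1 + ?s (E (K \<psi>\<^sub>0)))"
  moreover have \<zeta>: "\<zeta> \<in> chains ?T\<^sub>2"
    unfolding \<zeta>_def by (intro chains_diff chains_zero chains_add h\<psi>\<^sub>1 sE)
  moreover have "?dT\<^sub>2 \<zeta> = 0 - ?dT\<^sub>2 (h \<psi>\<^sub>1 + ?s (E (K \<psi>\<^sub>0)))"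
    unfolding \<zeta>_def natural_diff[OF dT\<^sub>2 chains_zero chains_add[OF h\<psi>\<^sub>1 sE]] natural_zero[OF dT\<^sub>2] ..
  ultimately have K\<zeta>: "K \<psi>\<^sub>0 = ?dT\<^sub>2 \<zeta>" by (metis add_diff_cancel_right')
  define \<delta> where "\<delta> = augment_chain (E (K \<psi>\<^sub>0)) - E (augment_chain (K \<psi>\<^sub>0))"
  define \<omega> where "\<omega> = 0 - (augment_chain (E \<zeta>) - E (augment_chain \<zeta>))"
  have \<omega>': "augment_chain (E \<zeta>) - E (augment_chain \<zeta>) \<in> chains ?T\<^sub>2"
    by (intro chains_diff chains_augment Ec res(2) \<zeta>)
  then have \<omega>: "\<omega> \<in> chains ?T\<^sub>2" unfolding \<omega>_def by (rule chains_diff[OF chains_zero])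
  have "?dT\<^sub>2 \<omega> = 0 - ?dT\<^sub>2 (augment_chain (E \<zeta>) - E (augment_chain \<zeta>))"
    unfolding \<omega>_def natural_diff[OF dT\<^sub>2 chains_zero \<omega>'] natural_zero[OF dT\<^sub>2] ..
  moreover have "?dT\<^sub>2 (augment_chain (E \<zeta>) - E (augment_chain \<zeta>)) + \<delta> = 0"
    using homotopy_augment[OF res(2) p E \<zeta>] unfolding \<delta>_def K\<zeta> .
  ultimately have \<delta>\<omega>: "\<delta> = ?dT\<^sub>2 \<omega>" by (metis add_diff_cancel_left')
  have aK: "augment_chain (K \<psi>\<^sub>0) = K (augment_chain \<psi>\<^sub>0)" using natural_augment[OF K \<psi>\<^sub>0] by simp
  have aK': "augment_chain (K \<psi>\<^sub>0) \<in> chains ?T\<^sub>2" by (rule chains_augment[OF res(2) K\<psi>\<^sub>0])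
  have aE: "augment_chain (E (K \<psi>\<^sub>0)) \<in> chains ?T\<^sub>2" by (rule chains_augment[OF res(2) Ec[OF K\<psi>\<^sub>0]])
  have parts: "part c False (augment_chain \<psi>) = augment_chain \<psi>\<^sub>0" "part c True (augment_chain \<psi>) = augment_chain \<psi>\<^sub>1"
    unfolding \<psi>\<^sub>0_def \<psi>\<^sub>1_def by (rule natural_augment[OF partF\<^sub>1 \<psi>(1)], rule natural_augment[OF partT\<^sub>1 \<psi>(1)])
  have fa\<psi>: "f (augment_chain \<psi>) = extend c False (g (augment_chain \<psi>\<^sub>0)) + extend c True (h (augment_chain \<psi>\<^sub>1)) +
      extend c True (?s (E (augment_chain (K \<psi>\<^sub>0))))"
    unfolding f_eq[OF chains_augment[OF D(1) \<psi>(1)]] parts aK unfolding K_def ..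
  note gF = natural_comp[OF g extF\<^sub>2] and hT = natural_comp[OF h(1) extT\<^sub>2] and sT = natural_comp[OF sT\<^sub>2 extT\<^sub>2]
  note c1 = natural_chains[OF gF \<psi>\<^sub>0] and c2 = natural_chains[OF hT \<psi>\<^sub>1] and c3 = natural_chains[OF sT Ec[OF K\<psi>\<^sub>0]]
  have "augment_chain (f \<psi>) = extend c False (g (augment_chain \<psi>\<^sub>0)) + extend c True (h (augment_chain \<psi>\<^sub>1)) +
      extend c True (?s (augment_chain (E (K \<psi>\<^sub>0))))"
    unfolding f\<psi> augment_chain_add[OF D(2) chains_add[OF c1 c2] c3] augment_chain_add[OF D(2) c1 c2]
    by (simp only: natural_augment[OF gF \<psi>\<^sub>0] natural_augment[OF hT \<psi>\<^sub>1] natural_augment[OF sT Ec[OF K\<psi>\<^sub>0]])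
  also have "\<dots> = f (augment_chain \<psi>) + extend c True (?s \<delta>)"
    unfolding fa\<psi> \<delta>_def natural_diff[OF sT aE Ec[OF aK']] by simp
  also have "extend c True (?s \<delta>) = ?d\<^sub>2 (scale_chain s (extend c True \<omega>))"
    unfolding differential_scale differential_extend_True[OF D(2,4) \<omega>] \<delta>\<omega> extend_scale ..
  finally show ?thesis
    using natural_chains[OF natural_scale_chain[OF D(2)] natural_chains[OF extT\<^sub>2 \<omega>]] by blast
qed

lemma chain_map_comp:
  "chain_map D \<epsilon> D' \<epsilon>' f \<Longrightarrow> chain_map D' \<epsilon>' D'' \<epsilon>'' g \<Longrightarrow> natural D D (differential D \<epsilon>) \<Longrightarrow>
     chain_map D \<epsilon> D'' \<epsilon>'' (\<lambda>\<psi>. g (f \<psi>))"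
  unfolding chain_map_def by simp

lemma chain_map_scale:
  "chain_map D \<epsilon> D' \<epsilon>' f \<Longrightarrow> chain_map D \<epsilon> D' \<epsilon>' (\<lambda>\<psi>. scale_chain k (f \<psi>))"
  unfolding chain_map_def by (auto simp: differential_scale) (simp add: scale_chain_def chains_scale)

text \<open>
  The move exchanges the two outer crossings up to a rotation of the disc, and \<open>R3_match\<close> is the resulting
  correspondence of all remaining crossings.
\<close>
lemma R3_xings:
  assumes "local_change \<beta> (R3_tangle ro so) (image_diagram uminus (R3_tangle ro so)) D\<^sub>1 D\<^sub>2"
  shows "\<beta> 0 \<in> xings D\<^sub>1" "\<beta> 0 \<in> xings D\<^sub>2"
    and "xings D\<^sub>2 - {\<beta> 0} \<subseteq> R3_match \<beta> ` (xings D\<^sub>1 - {\<beta> 0})"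
proof -
  let ?Z = "disc \<beta>"
  have lc: "disc_chart \<beta>" "has_tangle \<beta> (R3_tangle ro so) D\<^sub>1"
    "has_tangle \<beta> (image_diagram uminus (R3_tangle ro so)) D\<^sub>2" "agree_outside ?Z D\<^sub>1 D\<^sub>2"
    using assms unfolding local_change_def by blast+
  have 1: "xings D\<^sub>1 \<inter> ?Z = {\<beta> 0, \<beta> R3_right, \<beta> R3_below}"
    using has_tangle_xings[OF lc(2)] by (simp add: R3_tangle_def)
  have 2: "xings D\<^sub>2 \<inter> ?Z = {\<beta> 0, \<beta> (- R3_right), \<beta> (- R3_below)}"
    using has_tangle_xings[OF lc(3)] by (simp add: R3_tangle_def image_diagram_def)
  show "\<beta> 0 \<in> xings D\<^sub>1" "\<beta> 0 \<in> xings D\<^sub>2" using 1 2 by blast+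
  have inj: "inj_on \<beta> (cball 0 1)" using lc(1) unfolding disc_chart_def by blast
  have mem: "R3_right \<in> cball 0 1" "R3_below \<in> cball 0 1" "(0 :: complex) \<in> cball 0 1"
    unfolding R3_right_def R3_below_def by (simp_all add: cmod_eq_Re cmod_eq_Im)
  have "R3_right \<noteq> 0" "R3_below \<noteq> 0" "R3_right \<noteq> R3_below"
    unfolding R3_right_def R3_below_def by (simp_all add: complex_eq_iff)
  then have ne: "\<beta> R3_right \<noteq> \<beta> 0" "\<beta> R3_below \<noteq> \<beta> 0" "\<beta> R3_right \<noteq> \<beta> R3_below"
    using inj_on_eq_iff[OF inj] mem by blast+
  show "xings D\<^sub>2 - {\<beta> 0} \<subseteq> R3_match \<beta> ` (xings D\<^sub>1 - {\<beta> 0})"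
  proof
    fix x assume x: "x \<in> xings D\<^sub>2 - {\<beta> 0}"
    show "x \<in> R3_match \<beta> ` (xings D\<^sub>1 - {\<beta> 0})"
    proof (cases "x \<in> ?Z")
      case True
      then consider "x = \<beta> (- R3_right)" | "x = \<beta> (- R3_below)" using x 2 by blast
      then show ?thesis
      proof cases
        case 1
        then have "x = R3_match \<beta> (\<beta> R3_below)" using ne unfolding R3_match_def by simp
        then show ?thesis using \<open>xings D\<^sub>1 \<inter> ?Z = _\<close> ne by blast
      next
        case 2
        then have "x = R3_match \<beta> (\<beta> R3_right)" unfolding R3_match_def by simp
        then show ?thesis using \<open>xings D\<^sub>1 \<inter> ?Z = _\<close> ne by blast
      qed
    next
      case False
      then have "x \<noteq> \<beta> R3_right" "x \<noteq> \<beta> R3_below" using mem by blast+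
      then have "x = R3_match \<beta> x" unfolding R3_match_def by simp
      moreover have "x \<in> xings D\<^sub>1" using x False agree_outside_xings[OF lc(4)] by blast
      ultimately show ?thesis using x by blast
    qed
  qed
qed

lemma natural_R3_identity:
  assumes "link_diagram A" "xings A' \<subseteq> R3_match \<beta> ` xings A" "R3_identity \<beta> A A' g"
  shows "natural A A' g"
proof (rule naturalI[OF assms(1)])
  show "g \<psi> \<in> chains A'" if "\<psi> \<in> chains A" for \<psi> using assms(3) that unfolding R3_identity_def by blast
  obtain \<eta> where g: "\<forall>\<psi>\<in>chains A. \<forall>v\<subseteq>xings A.
      g \<psi> (R3_match \<beta> ` v) = scale (\<eta> v)
        (push (follow (disc \<beta>) (resolution A' (R3_match \<beta> ` v))) (circles A v) (\<psi> v))"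
    using assms(3) unfolding R3_identity_def by blast
  fix w assume "w \<subseteq> xings A'"
  then obtain v where v: "v \<subseteq> xings A" "w = R3_match \<beta> ` v"
    using assms(2) by (meson subset_imageE subset_trans)
  show "\<exists>B T. chain_op A B T \<and> (\<forall>\<psi>\<in>chains A. g \<psi> w = T \<psi>)"
    unfolding v(2) using g v(1)
      chain_op_vertex[OF exterior_op_scaled_push[OF finite_circles[OF assms(1) v(1)]] v(1)] by blast
qed

text \<open>
  Additivity has to be shown separately, since the homotopy is not natural, only additive.
\<close>
lemma R3_map_augment:
  assumes D: "link_diagram D\<^sub>1" "link_diagram D\<^sub>2"
    and lc: "local_change \<beta> (R3_tangle ro so) (image_diagram uminus (R3_tangle ro so)) D\<^sub>1 D\<^sub>2"
    and R3: "R3_map cv ro \<beta> D\<^sub>1 \<epsilon>\<^sub>1 D\<^sub>2 \<epsilon>\<^sub>2 f"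
    and f: "chain_map D\<^sub>1 \<epsilon>\<^sub>1 D\<^sub>2 \<epsilon>\<^sub>2 f"
  shows "\<forall>\<psi>\<in>chains D\<^sub>1. \<forall>\<xi>\<in>chains D\<^sub>1. f (\<psi> + \<xi>) = f \<psi> + f \<xi>"
    and "\<forall>\<psi>\<in>chains D\<^sub>1. differential D\<^sub>1 \<epsilon>\<^sub>1 \<psi> = 0 \<longrightarrow>
      (\<exists>\<kappa>\<in>chains D\<^sub>2. augment_chain (f \<psi>) = f (augment_chain \<psi>) + differential D\<^sub>2 \<epsilon>\<^sub>2 \<kappa>)"
proof -
  define c where "c = \<beta> 0"
  have c: "c \<in> xings D\<^sub>1" "c \<in> xings D\<^sub>2" "xings D\<^sub>2 - {c} \<subseteq> R3_match \<beta> ` (xings D\<^sub>1 - {c})"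
    using R3_xings[OF lc] unfolding c_def by blast+
  define r where "r = ro"
  let ?A\<^sub>1 = "resolve D\<^sub>1 c r" and ?A\<^sub>2 = "resolve D\<^sub>2 c r"
  let ?S\<^sub>1 = "resolve D\<^sub>1 c (\<not> r)" and ?S\<^sub>2 = "resolve D\<^sub>2 c (\<not> r)"
  let ?\<sigma>\<^sub>1 = "part_signs c (\<not> r) \<epsilon>\<^sub>1" and ?\<sigma>\<^sub>2 = "part_signs c (\<not> r) \<epsilon>\<^sub>2"
  obtain D\<^sub>0 \<epsilon>\<^sub>0 \<beta>\<^sub>1 \<beta>\<^sub>2 e\<^sub>1 i\<^sub>1 e\<^sub>2 i\<^sub>2 g E and \<tau> \<tau>' :: int where
    D0: "cube cv D\<^sub>0 \<epsilon>\<^sub>0"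
    and lc1: "local_change \<beta>\<^sub>1 (uncrossed res0) R2_crossed D\<^sub>0 ?S\<^sub>1"
    and lc2: "local_change \<beta>\<^sub>2 (uncrossed res0) R2_crossed D\<^sub>0 ?S\<^sub>2"
    and e1: "R2_add \<beta>\<^sub>1 D\<^sub>0 ?S\<^sub>1 e\<^sub>1" "chain_map D\<^sub>0 \<epsilon>\<^sub>0 ?S\<^sub>1 ?\<sigma>\<^sub>1 e\<^sub>1"
    and i1: "R2_remove \<beta>\<^sub>1 ?S\<^sub>1 D\<^sub>0 i\<^sub>1" "chain_map ?S\<^sub>1 ?\<sigma>\<^sub>1 D\<^sub>0 \<epsilon>\<^sub>0 i\<^sub>1"
    and e2: "R2_add \<beta>\<^sub>2 D\<^sub>0 ?S\<^sub>2 e\<^sub>2" "chain_map D\<^sub>0 \<epsilon>\<^sub>0 ?S\<^sub>2 ?\<sigma>\<^sub>2 e\<^sub>2"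
    and i2: "R2_remove \<beta>\<^sub>2 ?S\<^sub>2 D\<^sub>0 i\<^sub>2" "chain_map ?S\<^sub>2 ?\<sigma>\<^sub>2 D\<^sub>0 \<epsilon>\<^sub>0 i\<^sub>2"
    and g: "R3_identity \<beta> ?A\<^sub>1 ?A\<^sub>2 g"
    and E: "if r then homotopy_to_id ?S\<^sub>1 ?\<sigma>\<^sub>1 (e\<^sub>1 \<circ> i\<^sub>1) E else homotopy_to_id ?S\<^sub>2 ?\<sigma>\<^sub>2 (e\<^sub>2 \<circ> i\<^sub>2) E"
    and raw: "\<forall>\<psi>\<in>chains D\<^sub>1. f \<psi> =
           extend c r (g (part c r \<psi>)) +
           extend c (\<not> r) (\<lambda>v. scale \<tau> (e\<^sub>2 (i\<^sub>1 (part c (\<not> r) \<psi>)) v)) +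
           extend c True (\<lambda>v. scale \<tau>'
             (if r then g (connecting D\<^sub>1 \<epsilon>\<^sub>1 c (E (part c False \<psi>))) v
              else E (connecting D\<^sub>2 \<epsilon>\<^sub>2 c (g (part c False \<psi>))) v))"
    using R3[unfolded R3_map_def Let_def, folded c_def r_def]
    by (elim exE conjE) (rule that)
  have f_eq: "\<forall>\<psi>\<in>chains D\<^sub>1. f \<psi> =
           extend c r (g (part c r \<psi>)) +
           extend c (\<not> r) (scale_chain \<tau> (e\<^sub>2 (i\<^sub>1 (part c (\<not> r) \<psi>)))) +
           extend c True (scale_chain \<tau>'
             (if r then g (connecting D\<^sub>1 \<epsilon>\<^sub>1 c (E (part c False \<psi>)))
              else E (connecting D\<^sub>2 \<epsilon>\<^sub>2 c (g (part c False \<psi>)))))"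
    using raw unfolding scale_chain_def by (cases r) simp_all
  have D0: "link_diagram D\<^sub>0" using D0 unfolding cube_def by blast
  have A: "link_diagram ?A\<^sub>1" "link_diagram ?A\<^sub>2" and S: "link_diagram ?S\<^sub>1" "link_diagram ?S\<^sub>2"
    using link_diagram_resolve D c by blast+
  have into: "\<psi> \<in> chains D \<Longrightarrow> f \<psi> \<in> chains D'" if "chain_map D \<epsilon> D' \<epsilon>' f" for D \<epsilon> D' \<epsilon>' f \<psi>
    using that unfolding chain_map_def by blast
  have ng: "natural ?A\<^sub>1 ?A\<^sub>2 g" using natural_R3_identity[OF A(1) _ g] c(3) by simp
  have n: "natural D\<^sub>0 ?S\<^sub>1 e\<^sub>1" "natural ?S\<^sub>1 D\<^sub>0 i\<^sub>1" "natural D\<^sub>0 ?S\<^sub>2 e\<^sub>2" "natural ?S\<^sub>2 D\<^sub>0 i\<^sub>2"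
    using natural_R2_add[OF D0 S(1) into[OF e1(2)] lc1 e1(1)] natural_R2_remove[OF D0 S(1) into[OF i1(2)] lc1 i1(1)]
      natural_R2_add[OF D0 S(2) into[OF e2(2)] lc2 e2(1)] natural_R2_remove[OF D0 S(2) into[OF i2(2)] lc2 i2(1)]
    by blast+
  let ?h = "\<lambda>\<psi>. scale_chain \<tau> (e\<^sub>2 (i\<^sub>1 \<psi>))"
  have nh: "natural ?S\<^sub>1 ?S\<^sub>2 ?h"
    by (rule natural_comp[OF natural_comp[OF n(2,3)] natural_scale_chain[OF S(2)]])
  have ch: "chain_map ?S\<^sub>1 ?\<sigma>\<^sub>1 ?S\<^sub>2 ?\<sigma>\<^sub>2 ?h"
    by (rule chain_map_scale[OF chain_map_comp[OF i1(2) e2(2) natural_differential[OF S(1)]]])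
  have np: "natural ?S\<^sub>1 ?S\<^sub>1 (e\<^sub>1 \<circ> i\<^sub>1)" "natural ?S\<^sub>2 ?S\<^sub>2 (e\<^sub>2 \<circ> i\<^sub>2)"
    unfolding comp_def by (rule natural_comp[OF n(2,1)], rule natural_comp[OF n(4,3)])
  have "natural D\<^sub>1 D\<^sub>2 (\<lambda>\<psi>. extend c r (g (part c r \<psi>)))"
    by (rule natural_comp[OF natural_comp[OF natural_part[OF D(1) c(1)] ng] natural_extend[OF D(2) c(2)]])
  note add1 = natural_add[OF this]
  have "natural D\<^sub>1 D\<^sub>2 (\<lambda>\<psi>. extend c (\<not> r) (?h (part c (\<not> r) \<psi>)))"
    by (rule natural_comp[OF natural_comp[OF natural_part[OF D(1) c(1)] nh] natural_extend[OF D(2) c(2)]])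
  note add2 = natural_add[OF this]
  let ?t = "\<lambda>\<psi>. extend c True (scale_chain \<tau>' (if r then g (connecting D\<^sub>1 \<epsilon>\<^sub>1 c (E (part c False \<psi>)))
              else E (connecting D\<^sub>2 \<epsilon>\<^sub>2 c (g (part c False \<psi>)))))"
  have add3: "?t (\<psi> + \<xi>) = ?t \<psi> + ?t \<xi>" if \<psi>\<xi>: "\<psi> \<in> chains D\<^sub>1" "\<xi> \<in> chains D\<^sub>1" for \<psi> \<xi>
  proof (cases r)
    case True
    have "natural (resolve D\<^sub>1 c True) (resolve D\<^sub>2 c True) g" "link_diagram (resolve D\<^sub>2 c True)"
      using ng A(2) True by simp_all
    then have out: "natural ?S\<^sub>1 D\<^sub>2 (\<lambda>x. extend c True (scale_chain \<tau>' (g (connecting D\<^sub>1 \<epsilon>\<^sub>1 c x))))"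
      using natural_comp[OF natural_comp[OF natural_comp[OF natural_connecting[OF D(1) c(1)]]
        natural_scale_chain] natural_extend[OF D(2) c(2)]] True by simp
    have E: "homotopy_to_id ?S\<^sub>1 ?\<sigma>\<^sub>1 (e\<^sub>1 \<circ> i\<^sub>1) E" using E True by simp
    have part: "natural D\<^sub>1 ?S\<^sub>1 (part c False)" using natural_part[OF D(1) c(1), of False] True by simp
    note p = natural_chains[OF part \<psi>\<xi>(1)] natural_chains[OF part \<psi>\<xi>(2)]
    show ?thesis
      using natural_add[OF part \<psi>\<xi>] homotopy_additive(2)[OF E p]
        natural_add[OF out homotopy_additive(1)[OF E p(1)] homotopy_additive(1)[OF E p(2)]] True
      by simp
  next
    case False
    have "natural (resolve D\<^sub>1 c False) (resolve D\<^sub>2 c False) g" using ng False by simp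
    then have inn: "natural D\<^sub>1 ?S\<^sub>2 (\<lambda>x. connecting D\<^sub>2 \<epsilon>\<^sub>2 c (g (part c False x)))"
      using natural_comp[OF natural_comp[OF natural_part[OF D(1) c(1)]]
        natural_connecting[OF D(2) c(2)]] False by simp
    have E: "homotopy_to_id ?S\<^sub>2 ?\<sigma>\<^sub>2 (e\<^sub>2 \<circ> i\<^sub>2) E" using E False by simp
    have out: "natural ?S\<^sub>2 D\<^sub>2 (\<lambda>x. extend c True (scale_chain \<tau>' x))"
      using natural_comp[OF natural_scale_chain[OF S(2)] natural_extend[OF D(2) c(2), of "\<not> r"]] False by simp
    note p = natural_chains[OF inn \<psi>\<xi>(1)] natural_chains[OF inn \<psi>\<xi>(2)]
    show ?thesis
      using natural_add[OF inn \<psi>\<xi>] homotopy_additive(2)[OF E p]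
        natural_add[OF out homotopy_additive(1)[OF E p(1)] homotopy_additive(1)[OF E p(2)]] False
      by simp
  qed
  show "\<forall>\<psi>\<in>chains D\<^sub>1. \<forall>\<xi>\<in>chains D\<^sub>1. f (\<psi> + \<xi>) = f \<psi> + f \<xi>"
  proof (intro ballI)
    fix \<psi> \<xi> assume *: "\<psi> \<in> chains D\<^sub>1" "\<xi> \<in> chains D\<^sub>1"
    show "f (\<psi> + \<xi>) = f \<psi> + f \<xi>"
      unfolding f_eq[rule_format, OF *(1)] f_eq[rule_format, OF *(2)]
        f_eq[rule_format, OF chains_add[OF *]] add1[OF *] add2[OF *] add3[OF *]
      by (simp only: ac_simps)
  qed
  show "\<forall>\<psi>\<in>chains D\<^sub>1. differential D\<^sub>1 \<epsilon>\<^sub>1 \<psi> = 0 \<longrightarrow>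
      (\<exists>\<kappa>\<in>chains D\<^sub>2. augment_chain (f \<psi>) = f (augment_chain \<psi>) + differential D\<^sub>2 \<epsilon>\<^sub>2 \<kappa>)"
  proof (cases r)
    case True
    then show ?thesis
      using cone_map_augment_target[OF D c(1,2) f, of g ?h "e\<^sub>1 \<circ> i\<^sub>1" E \<tau>'] ng nh ch np(1) E f_eq by simp
  next
    case False
    then show ?thesis
      using cone_map_augment_source[OF D c(1,2) f, of g ?h "e\<^sub>2 \<circ> i\<^sub>2" E \<tau>'] ng nh ch np(2) E f_eq by simp
  qed
qed

section \<open>The class along a movie\<close>

text \<open>
  The weakening of \<open>natural\<close> that also holds for Reidemeister III: compatibility with \<open>augment_chain\<close> up to
  boundaries, and only on cycles.
\<close>
definition augment_compatible ::
    "diagram \<Rightarrow> edge_signs \<Rightarrow> diagram \<Rightarrow> edge_signs \<Rightarrow> (chain \<Rightarrow> chain) \<Rightarrow> bool" where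
  "augment_compatible D \<epsilon> D' \<epsilon>' f \<longleftrightarrow>
     (\<forall>\<psi>\<in>chains D. \<forall>\<xi>\<in>chains D. f (\<psi> + \<xi>) = f \<psi> + f \<xi>) \<and>
     (\<forall>\<psi>\<in>chains D. differential D \<epsilon> \<psi> = 0 \<longrightarrow>
        (\<exists>\<kappa>\<in>chains D'. augment_chain (f \<psi>) = f (augment_chain \<psi>) + differential D' \<epsilon>' \<kappa>))"

lemma natural_augment_compatible:
  assumes "link_diagram D'" "natural D D' f"
  shows "augment_compatible D \<epsilon> D' \<epsilon>' f"
proof -
  have "augment_chain (f \<psi>) = f (augment_chain \<psi>) + differential D' \<epsilon>' 0" if "\<psi> \<in> chains D" for \<psi>
    using natural_augment[OF assms(2) that] natural_zero[OF natural_differential[OF assms(1)]] by simp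
  then show ?thesis
    unfolding augment_compatible_def using natural_add[OF assms(2)] chains_zero by blast
qed

lemma local_move_change:
  "local_move G s t n \<beta> M M' D D' \<Longrightarrow> local_change \<beta> M M' D D'"
  "local_move G s t n \<beta> M M' D D' \<Longrightarrow> depicts D' (slice G t)"
  unfolding local_move_def by blast+

lemma local_change_tangle:
  assumes "local_change \<beta> M M' D D'"
  shows "has_tangle \<beta> M D" "has_tangle \<beta> M' D'" "agree_outside (disc \<beta>) D D'" "disc_chart \<beta>"
  using assms unfolding local_change_def by blast+

lemma local_change_uncrossed_xings:
  assumes "local_change \<beta> (uncrossed S) (uncrossed S') D D'"
  shows "xings D' = xings D"
proof -
  have "X' = X" if "X \<inter> Z = {}" "X' \<inter> Z = {}" "X - Z = X' - Z" for X X' Z :: "complex set"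
    using that by blast
  from this[OF xings_uncrossed[OF local_change_tangle(1)[OF assms]]
      xings_uncrossed[OF local_change_tangle(2)[OF assms]]
      agree_outside_xings[OF local_change_tangle(3)[OF assms]]]
  show ?thesis .
qed

lemma move_augment_compatible:
  assumes "move cv G s t D \<epsilon> D' \<epsilon>' f" "cube cv D \<epsilon>" "cube cv D' \<epsilon>'" "chain_map D \<epsilon> D' \<epsilon>' f"
  shows "augment_compatible D \<epsilon> D' \<epsilon>' f"
proof -
  have D: "link_diagram D" and D': "link_diagram D'" using assms(2,3) unfolding cube_def by auto
  have f: "\<psi> \<in> chains D \<Longrightarrow> f \<psi> \<in> chains D'" for \<psi> using assms(4) unfolding chain_map_def by blast
  note nat = natural_augment_compatible[OF D']
  from assms(1) show ?thesis
  proof cases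
    case (redecorate Z)
    have *: "xings D' = xings D" "redecoration_map (\<Union>x\<in>xings D. Z x) D D' f" by (fact redecorate)+
    show ?thesis by (rule nat, rule natural_redecoration[OF D _ *], rule f)
  next
    case (isotopy \<phi>)
    have *: "D' = image_diagram (\<phi> t) D" "isotopy_map (\<phi> t) D f" by (fact isotopy)+
    show ?thesis by (rule nat, unfold *(1), rule natural_isotopy[OF D _ *(2)], rule f[unfolded *(1)])
  next
    case (birth \<beta>)
    note lc = local_change_uncrossed_xings[OF local_move_change(1)[OF birth(1)]]
    show ?thesis by (rule nat, rule natural_birth[OF D _ lc birth(2)], rule f)
  next
    case (death \<beta>)
    note lc = local_change_uncrossed_xings[OF local_move_change(1)[OF death(1)]]
    show ?thesis by (rule nat, rule natural_death[OF D _ lc death(2)], rule f)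
  next
    case (saddle \<beta>)
    note lc = local_move_change(1)[OF saddle(1)]
    show ?thesis by (rule nat, rule natural_saddle[OF D D' _ lc saddle(2)], rule f)
  next
    case (R1_add one \<beta>)
    note lc = local_move_change(1)[OF R1_add(1)]
    show ?thesis by (rule nat, rule natural_R1_add[OF D _ lc R1_add(2)], rule f)
  next
    case (R1_remove one \<beta>)
    note lc = local_move_change(1)[OF R1_remove(1)]
    show ?thesis by (rule nat, rule natural_R1_remove[OF D _ lc R1_remove(2)], rule f)
  next
    case (R2_add \<beta>)
    note lc = local_move_change(1)[OF R2_add(1)]
    show ?thesis by (rule nat, rule natural_R2_add[OF D D' _ lc R2_add(2)], rule f)
  next
    case (R2_remove \<beta>)
    note lc = local_change_tangle[OF local_move_change(1)[OF R2_remove(1)]]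
    have "local_change \<beta> (uncrossed res0) R2_crossed D' D"
      unfolding local_change_def using lc agree_outside_sym[OF lc(3)] by (intro conjI)
    note lc' = this
    show ?thesis by (rule nat, rule natural_R2_remove[OF D' D _ lc' R2_remove(2)], rule f)
  next
    case (R3 \<beta> real_over sliding_over)
    show ?thesis
      unfolding augment_compatible_def
      using R3_map_augment[OF D D' local_move_change(1)[OF R3(1)] R3(2) assms(4)] by blast
  qed
qed

lemma mem_homology_class: "link_diagram D \<Longrightarrow> \<psi> \<in> homology_class D \<epsilon> \<psi>"
proof -
  assume "link_diagram D"
  then have "\<psi> = \<psi> + differential D \<epsilon> 0" using natural_zero[OF natural_differential] by simp
  then show ?thesis unfolding homology_class_def using chains_zero by blast
qed

text \<open>
  The map \<open>induced\<close> is a union over all representatives; for an additive chain map it is the coset of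
  the image of any single one.
\<close>
lemma induced_homology_class:
  assumes "link_diagram D" "link_diagram D'" "chain_map D \<epsilon> D' \<epsilon>' f"
    and add: "\<forall>\<psi>\<in>chains D. \<forall>\<xi>\<in>chains D. f (\<psi> + \<xi>) = f \<psi> + f \<xi>" and \<phi>: "\<phi> \<in> chains D"
  shows "induced D' \<epsilon>' f (homology_class D \<epsilon> \<phi>) = homology_class D' \<epsilon>' (f \<phi>)"
proof
  note d = natural_differential[OF assms(1), of \<epsilon>] and d' = natural_differential[OF assms(2), of \<epsilon>']
  have f: "f \<psi> \<in> chains D'" "differential D' \<epsilon>' (f \<psi>) = f (differential D \<epsilon> \<psi>)" if "\<psi> \<in> chains D" for \<psi>
    using assms(3) that unfolding chain_map_def by blast+
  show "induced D' \<epsilon>' f (homology_class D \<epsilon> \<phi>) \<subseteq> homology_class D' \<epsilon>' (f \<phi>)"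
  proof
    fix y assume "y \<in> induced D' \<epsilon>' f (homology_class D \<epsilon> \<phi>)"
    then obtain \<xi> \<xi>' where \<xi>: "\<xi> \<in> chains D" "\<xi>' \<in> chains D'"
      "y = f (\<phi> + differential D \<epsilon> \<xi>) + differential D' \<epsilon>' \<xi>'"
      unfolding induced_def homology_class_def by blast
    have "f (\<phi> + differential D \<epsilon> \<xi>) = f \<phi> + differential D' \<epsilon>' (f \<xi>)"
      using add \<phi> natural_chains[OF d \<xi>(1)] f(2)[OF \<xi>(1)] by simp
    then have "y = f \<phi> + differential D' \<epsilon>' (f \<xi> + \<xi>')"
      using \<xi>(3) natural_add[OF d' f(1)[OF \<xi>(1)] \<xi>(2)] by (simp add: add.assoc)
    then show "y \<in> homology_class D' \<epsilon>' (f \<phi>)"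
      unfolding homology_class_def using chains_add[OF f(1)[OF \<xi>(1)] \<xi>(2)] by blast
  qed
  show "homology_class D' \<epsilon>' (f \<phi>) \<subseteq> induced D' \<epsilon>' f (homology_class D \<epsilon> \<phi>)"
    unfolding induced_def using mem_homology_class[OF assms(1)] by blast
qed

text \<open>
  The property of the image of an integer that is preserved along a movie.
\<close>
definition augment_exact_class :: "diagram \<Rightarrow> edge_signs \<Rightarrow> chain set \<Rightarrow> bool" where
  "augment_exact_class D \<epsilon> U \<longleftrightarrow>
     (\<exists>\<phi>\<in>chains D. \<exists>\<xi>\<in>chains D. differential D \<epsilon> \<phi> = 0 \<and>
        augment_chain \<phi> = differential D \<epsilon> \<xi> \<and> U = homology_class D \<epsilon> \<phi>)"

lemma induced_augment_exact:
  assumes "link_diagram D" "link_diagram D'" "chain_map D \<epsilon> D' \<epsilon>' f"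
    and "augment_compatible D \<epsilon> D' \<epsilon>' f" "augment_exact_class D \<epsilon> U"
  shows "augment_exact_class D' \<epsilon>' (induced D' \<epsilon>' f U)"
proof -
  obtain \<phi> \<xi> where \<phi>: "\<phi> \<in> chains D" "\<xi> \<in> chains D" "differential D \<epsilon> \<phi> = 0"
    "augment_chain \<phi> = differential D \<epsilon> \<xi>" "U = homology_class D \<epsilon> \<phi>"
    using assms(5) unfolding augment_exact_class_def by blast
  have add: "\<forall>\<psi>\<in>chains D. \<forall>\<xi>\<in>chains D. f (\<psi> + \<xi>) = f \<psi> + f \<xi>"
    using assms(4) unfolding augment_compatible_def by blast
  obtain \<kappa> where \<kappa>: "\<kappa> \<in> chains D'" "augment_chain (f \<phi>) = f (augment_chain \<phi>) + differential D' \<epsilon>' \<kappa>"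
    using assms(4) \<phi>(1,3) unfolding augment_compatible_def by blast
  have f: "f \<psi> \<in> chains D'" "differential D' \<epsilon>' (f \<psi>) = f (differential D \<epsilon> \<psi>)" if "\<psi> \<in> chains D" for \<psi>
    using assms(3) that unfolding chain_map_def by blast+
  have f0: "f 0 = 0" using add by (intro additive_zero) blast
  have "augment_chain (f \<phi>) = differential D' \<epsilon>' (f \<xi> + \<kappa>)"
    unfolding \<kappa>(2) \<phi>(4) f(2)[OF \<phi>(2), symmetric]
    by (rule natural_add[OF natural_differential[OF assms(2)] f(1)[OF \<phi>(2)] \<kappa>(1), symmetric])
  moreover have "differential D' \<epsilon>' (f \<phi>) = 0" unfolding f(2)[OF \<phi>(1)] \<phi>(3) f0 ..
  moreover have "induced D' \<epsilon>' f U = homology_class D' \<epsilon>' (f \<phi>)"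
    unfolding \<phi>(5) by (rule induced_homology_class[OF assms(1-3) add \<phi>(1)])
  ultimately show ?thesis
    unfolding augment_exact_class_def using f(1) \<phi>(1,2) \<kappa>(1) chains_add by blast
qed

lemma empty_curve_xings: "link_diagram D \<Longrightarrow> curve D = {} \<Longrightarrow> xings D = {}"
proof (rule ccontr)
  assume D: "link_diagram D" "curve D = {}" "xings D \<noteq> {}"
  then obtain x where "x \<in> xings D" by blast
  then have "curve D \<inter> disc (chart D x) = chart D x ` cross" using D(1) unfolding link_diagram_def by blast
  moreover have "0 \<in> cross" unfolding cross_def by simp
  ultimately show False using D(2) by blast
qed

lemma differential_uncrossed:
  assumes "xings D = {}"
  shows "differential D \<epsilon> \<psi> = 0"
  unfolding differential_def assms by (intro ext) (auto simp: fun_eq_iff)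

lemma tangle_curves_nonempty:
  "curve (uncrossed res0) \<noteq> {}" "curve (uncrossed res1) \<noteq> {}" "curve R1_straight \<noteq> {}"
  "curve (R1_kink one) \<noteq> {}" "curve R2_crossed \<noteq> {}" "curve (R3_tangle ro so) \<noteq> {}"
  "curve (image_diagram uminus (R3_tangle ro so)) \<noteq> {}" "curve (uncrossed (sphere 0 (1/2))) \<noteq> {}"
  unfolding uncrossed_def R1_straight_def R1_kink_def R2_crossed_def R3_tangle_def image_diagram_def
    res0_def res1_def by auto

text \<open>
  On the exterior algebra with one generator, contraction with the augmentation and contraction with the dual of
  the generator agree.
\<close>
lemma contract_augment_zero:
  assumes "x \<in> exterior {a}" "augment x = 0"
  shows "contract a x = 0"
proof
  fix w
  show "contract a x w = 0 w"
  proof (rule ccontr)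
    assume "contract a x w \<noteq> 0 w"
    then have ne: "x (a # w) \<noteq> 0" by (simp add: contract_def)
    then have "distinct (a # w)" "set (a # w) \<subseteq> {a}"
      using exterior_distinct[OF assms(1)] exterior_support[OF assms(1)] by blast+
    then have "w = []" by (cases w) auto
    then have "x (a # w) = augment x []" using augment_eq_sum[OF _ assms(1), of "[]"] by simp
    then show False using ne assms(2) by simp
  qed
qed

text \<open>
  The dying circle is the whole diagram, so there are no crossings and the differential is zero. Then
  \<open>augment_chain \<phi>\<close> is not merely a boundary but zero.
\<close>
lemma last_death_zero:
  assumes D: "link_diagram D" "link_diagram D'"
    and lc: "local_change \<beta> (uncrossed (sphere 0 (1/2))) (uncrossed {}) D D'"
    and f: "death_map (\<beta> ` sphere 0 (1/2)) D f" "chain_map D \<epsilon> D' \<epsilon>' f"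
    and empty: "curve D' = {}"
    and \<phi>: "\<phi> \<in> chains D" "augment_chain \<phi> = differential D \<epsilon> \<xi>"
  shows "f \<phi> = 0"
proof -
  let ?O = "\<beta> ` sphere 0 (1/2)"
  note lc' = local_change_tangle[OF lc]
  have xings: "xings D' = {}" "xings D = {}"
    using empty_curve_xings[OF D(2) empty] local_change_uncrossed_xings[OF lc] by simp_all
  have "curve D \<inter> disc \<beta> = ?O" "curve D - disc \<beta> = {}"
    using has_tangle_curve[OF lc'(1)] agree_outside_curve[OF lc'(3)] empty
    by (simp_all add: uncrossed_def)
  then have "curve D = ?O" by blast
  then have res: "resolution D {} = ?O" unfolding resolution_def xings by simp
  have "continuous_on (sphere 0 (1/2)) \<beta>"
    using lc'(4) unfolding disc_chart_def by (auto intro: continuous_on_subset)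
  then have "connected ?O" by (intro connected_continuous_image connected_sphere) simp_all
  moreover have "?O \<noteq> {}" by simp
  ultimately have "components ?O = {?O}" unfolding components_eq_sing_iff by (rule conjI)
  then have \<phi>0: "\<phi> {} \<in> exterior {?O}" using chains_exterior[OF \<phi>(1), of "{}"] res by simp
  have "augment_chain \<phi> {} = (0 :: chain) {}" unfolding \<phi>(2) differential_uncrossed[OF xings(2)] ..
  then have "augment (\<phi> {}) = 0" unfolding augment_chain_def by simp
  then have contract: "contract ?O (\<phi> {}) = 0" by (rule contract_augment_zero[OF \<phi>0])
  obtain \<eta> where "\<forall>\<psi>\<in>chains D. \<forall>v\<subseteq>xings D. f \<psi> v = scale (\<eta> v) (contract ?O (\<psi> v))"
    using f(1) unfolding death_map_def by blast
  then have "f \<phi> {} = scale (\<eta> {}) 0" using \<phi>(1) contract by simp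
  then have "f \<phi> {} = 0" by (simp only: scale_zero)
  moreover have "f \<phi> v = 0" if "v \<noteq> {}" for v
    using f(2) \<phi>(1) that unfolding chain_map_def by (intro chains_outside[of _ D']) (auto simp: xings)
  ultimately show ?thesis by (intro ext) (metis zero_fun_apply)
qed

lemma depicts_curve: "depicts D L \<Longrightarrow> curve D = {} \<longleftrightarrow> L = {}"
  unfolding depicts_def by (metis image_is_empty)

lemma move_depicts:
  assumes "move cv G s t D \<epsilon> D' \<epsilon>' f"
  shows "depicts D' (slice G t)"
  using assms
proof cases
  case (redecorate Z)
  then show ?thesis by simp
next
  case (isotopy \<phi>)
  then have "t \<in> {s..t}" by simp
  then show ?thesis using isotopy by blast
qed (erule local_move_change(2))+

lemma local_move_empty:
  assumes "local_move G s t n \<beta> M M' D D'"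
  shows "curve D = {} \<Longrightarrow> curve M = {}" "curve D' = {} \<Longrightarrow> curve M' = {}"
  using has_tangle_curve[OF local_change_tangle(1)[OF local_move_change(1)[OF assms]]]
    has_tangle_curve[OF local_change_tangle(2)[OF local_move_change(1)[OF assms]]] by auto

text \<open>
  All local models contain a strand on at least one side of the move. What is left are isotopies and changes of
  decoration, which describe the surface at all times of the interval.
\<close>
lemma move_from_empty_to_empty:
  assumes "move cv G s t D \<epsilon> D' \<epsilon>' f" "curve D = {}" "curve D' = {}" "\<tau> \<in> {s..t}"
  shows "slice G \<tau> = {}"
  using assms(1)
proof cases
  case (redecorate Z)
  then show ?thesis using depicts_curve assms(3,4) by auto
next
  case (isotopy \<phi>)
  then have "depicts (image_diagram (\<phi> \<tau>) D) (slice G \<tau>)" using assms(4) by blast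
  moreover have "curve (image_diagram (\<phi> \<tau>) D) = {}" using assms(2) by (simp add: image_diagram_def)
  ultimately show ?thesis using depicts_curve by blast
qed (frule local_move_empty(1)[OF _ assms(2)], drule local_move_empty(2)[OF _ assms(3)],
    simp add: tangle_curves_nonempty)+

lemma move_to_empty:
  assumes "move cv G s t D \<epsilon> D' \<epsilon>' f" "cube cv D \<epsilon>" "cube cv D' \<epsilon>'" "chain_map D \<epsilon> D' \<epsilon>' f"
    and "curve D \<noteq> {}" "curve D' = {}" "augment_exact_class D \<epsilon> U"
  shows "induced D' \<epsilon>' f U = homology_class D' \<epsilon>' 0"
proof -
  have D: "link_diagram D" "link_diagram D'" using assms(2,3) unfolding cube_def by auto
  obtain \<phi> \<xi> where \<phi>: "\<phi> \<in> chains D" "augment_chain \<phi> = differential D \<epsilon> \<xi>" "U = homology_class D \<epsilon> \<phi>"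
    using assms(7) unfolding augment_exact_class_def by blast
  have add: "\<forall>\<psi>\<in>chains D. \<forall>\<xi>\<in>chains D. f (\<psi> + \<xi>) = f \<psi> + f \<xi>"
    using move_augment_compatible[OF assms(1-4)] unfolding augment_compatible_def by blast
  from assms(1) have "f \<phi> = 0"
  proof cases
    case (redecorate Z)
    then show ?thesis using assms(5,6) by simp
  next
    case (isotopy \<phi>)
    then show ?thesis using assms(5,6) by (simp add: image_diagram_def)
  next
    case (death \<beta>)
    then show ?thesis
      using last_death_zero[OF D local_move_change(1) _ assms(4,6) \<phi>(1,2)] by blast
  qed (drule local_move_empty(2)[OF _ assms(6)], simp add: tangle_curves_nonempty)+
  then show ?thesis using induced_homology_class[OF D assms(4) add \<phi>(1)] \<phi>(3) by metis
qed

lemma int_class_augment_exact: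
  assumes "link_diagram D" "xings D = {}"
  shows "augment_exact_class D \<epsilon> (int_class D \<epsilon> k)"
proof -
  define \<phi> :: chain where "\<phi> = (\<lambda>v w. if v = {} \<and> w = [] then k else 0)"
  have "\<phi> \<in> chains D"
  proof (rule chainsI)
    show "\<phi> v \<in> exterior (circles D v)" for v
      by (rule exteriorI) (auto simp: \<phi>_def split: if_splits)
    show "\<phi> v = 0" if "\<not> v \<subseteq> xings D" for v using that assms(2) by (auto simp: \<phi>_def)
  qed
  moreover have "augment_chain \<phi> = 0"
    by (auto simp: augment_chain_def augment_def \<phi>_def fun_eq_iff)
  ultimately show ?thesis
    unfolding augment_exact_class_def int_class_def \<phi>_def[symmetric]
    using chains_zero differential_uncrossed[OF assms(2)] by metis
qed

lemma int_class_zero: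
  assumes "link_diagram D" "xings D = {}" "int_class D \<epsilon> k = homology_class D \<epsilon> 0"
  shows "k = 0"
proof -
  let ?\<phi> = "(\<lambda>v w. if v = {} \<and> w = [] then k else 0) :: chain"
  have "?\<phi> \<in> homology_class D \<epsilon> 0"
    using mem_homology_class[OF assms(1)] assms(3) unfolding int_class_def by blast
  then have "?\<phi> = 0" unfolding homology_class_def differential_uncrossed[OF assms(2)] by simp
  from fun_cong[OF fun_cong[OF this, of "{}"], of "[]"] show ?thesis by simp
qed

text \<open>
  Either the diagram is nonempty, or it has become empty by a death and the class is zero, or nothing has been
  visible so far.
\<close>
lemma movie_invariant:
  assumes "movie cv G D\<^sub>0 \<epsilon>\<^sub>0 t D \<epsilon> F" "slice G 0 = {}"
  shows "cube cv D \<epsilon> \<and> depicts D (slice G t) \<and> (\<forall>k. augment_exact_class D \<epsilon> (F (int_class D\<^sub>0 \<epsilon>\<^sub>0 k))) \<and>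
    (curve D \<noteq> {} \<or> (\<forall>k. F (int_class D\<^sub>0 \<epsilon>\<^sub>0 k) = homology_class D \<epsilon> 0) \<or>
     curve D = {} \<and> (\<forall>\<tau>\<in>{0..t}. slice G \<tau> = {}))"
  using assms(1)
proof induction
  case start
  then have "link_diagram D\<^sub>0" "curve D\<^sub>0 = {}"
    using depicts_curve assms(2) unfolding cube_def by blast+
  then have "augment_exact_class D\<^sub>0 \<epsilon>\<^sub>0 (int_class D\<^sub>0 \<epsilon>\<^sub>0 k)" for k
    by (intro int_class_augment_exact empty_curve_xings)
  then show ?case using start assms(2) \<open>curve D\<^sub>0 = {}\<close> by simp
next
  case (step s D \<epsilon> F t D' \<epsilon>' f)
  have D: "link_diagram D" "link_diagram D'" using step unfolding cube_def by blast+
  have compatible: "augment_compatible D \<epsilon> D' \<epsilon>' f" using move_augment_compatible step by blast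
  have exact: "augment_exact_class D' \<epsilon>' ((induced D' \<epsilon>' f \<circ> F) (int_class D\<^sub>0 \<epsilon>\<^sub>0 k))" for k
    using induced_augment_exact[OF D _ compatible] step by simp
  have "curve D' \<noteq> {} \<or> (\<forall>k. (induced D' \<epsilon>' f \<circ> F) (int_class D\<^sub>0 \<epsilon>\<^sub>0 k) = homology_class D' \<epsilon>' 0) \<or>
     curve D' = {} \<and> (\<forall>\<tau>\<in>{0..t}. slice G \<tau> = {})"
  proof (cases "curve D' = {}")
    case empty': True
    consider "curve D \<noteq> {}" | "\<forall>k. F (int_class D\<^sub>0 \<epsilon>\<^sub>0 k) = homology_class D \<epsilon> 0"
      | "curve D = {}" "\<forall>\<tau>\<in>{0..s}. slice G \<tau> = {}" using step by blast
    then show ?thesis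
    proof cases
      case 1
      then have "(induced D' \<epsilon>' f \<circ> F) (int_class D\<^sub>0 \<epsilon>\<^sub>0 k) = homology_class D' \<epsilon>' 0" for k
        using move_to_empty[OF _ _ _ _ _ empty'] step by simp
      then show ?thesis by blast
    next
      case 2
      have add: "\<forall>\<psi>\<in>chains D. \<forall>\<xi>\<in>chains D. f (\<psi> + \<xi>) = f \<psi> + f \<xi>"
        using compatible unfolding augment_compatible_def by blast
      then have "f 0 = 0" by (intro additive_zero) blast
      then have "induced D' \<epsilon>' f (homology_class D \<epsilon> 0) = homology_class D' \<epsilon>' 0"
        using induced_homology_class[OF D step(4) add chains_zero] by metis
      then show ?thesis using 2 by (simp only: comp_apply simp_thms)
    next
      case 3
      then have "slice G \<tau> = {}" if "\<tau> \<in> {0..t}" for \<tau>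
        using move_from_empty_to_empty[OF _ 3(1) empty', of cv G s t] step that by (cases "\<tau> \<le> s") auto
      then show ?thesis using empty' by blast
    qed
  qed blast
  then show ?case using step exact move_depicts by blast
qed

theorem corollary2p3:
  fixes T :: "complex \<times> complex \<Rightarrow> R5"
  assumes "smooth_torus_embedding T"
  shows "(\<forall>n. Kh_number T n \<longrightarrow> n = 0) \<and> (\<forall>K. Kh_map T K \<longrightarrow> K = (\<lambda>_. 0))"
proof -
  have zero: "K = (\<lambda>_. 0)" if Kh: "Kh_map T K" for K
  proof -
    obtain H G cv D\<^sub>0 \<epsilon>\<^sub>0 D \<epsilon> F where G: "G ` torus \<subseteq> UNIV \<times> {0<..<1}"
      and movie: "movie cv G D\<^sub>0 \<epsilon>\<^sub>0 1 D \<epsilon> F"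
      and K: "\<forall>k. F (int_class D\<^sub>0 \<epsilon>\<^sub>0 k) = int_class D \<epsilon> (K k)"
      using Kh unfolding Kh_map_def by (elim exE conjE) (rule that)
    have ends: "slice G 0 = {}" "slice G 1 = {}" using G unfolding slice_def by auto
    have "(1, 1) \<in> torus" unfolding torus_def by simp
    moreover obtain p \<tau> where p: "G (1, 1) = (p, \<tau>)" by (cases "G (1, 1)")
    ultimately have "(p, \<tau>) \<in> G ` torus" by (metis imageI)
    then have "p \<in> slice G \<tau>" "\<tau> \<in> {0..1}" using G unfolding slice_def by auto
    then have "\<not> (\<forall>\<tau>\<in>{0..1}. slice G \<tau> = {})" by blast
    moreover note invariant = movie_invariant[OF movie ends(1)]
    moreover have D: "link_diagram D" "curve D = {}"
      using invariant depicts_curve ends(2) unfolding cube_def by blast+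
    ultimately have "\<forall>k. F (int_class D\<^sub>0 \<epsilon>\<^sub>0 k) = homology_class D \<epsilon> 0" by blast
    then have "int_class D \<epsilon> (K k) = homology_class D \<epsilon> 0" for k using K by simp
    then have "K k = 0" for k by (rule int_class_zero[OF D(1) empty_curve_xings[OF D]])
    then show ?thesis by blast
  qed
  then show ?thesis unfolding Kh_number_def by fastforce
qed

end
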